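(* Let $\Phi_1\in\mathcal C(A_0,A_1)$, $\Phi_2\in\mathcal C(A'_0,A_1)$ and $\epsilon\ge0$, and let $\delta_{\rm pre}(\Phi_1\|\Phi_2)=\min_{\Lambda\in\mathcal C(A'_0,A_0)}\|\Phi_1\circ\Lambda-\Phi_2\|_\diamond$. The following are equivalent. (i) $\delta_{\rm pre}(\Phi_1\|\Phi_2)\le\epsilon$. (ii) For every finite-dimensional ancilla $R_0$ and every $\rho\in\mathfrak S(R_0A_1)$, $$\|(\mathrm{id}_{R_0}\otimes\Phi_2^{\mathsf T})(\rho)\|^\diamond_{A'_0|R_0}\le\|(\mathrm{id}_{R_0}\otimes\Phi_1^{\mathsf T})(\rho)\|^\diamond_{A_0|R_0}+\frac{\epsilon}{2}\|\rho\|^\diamond_{A_1|R_0}.$$ (iii) For every ancilla $R_0$, every ensemble $\mathcal E=\{\lambda_i,\rho_i\}_{i=1}^k$ on $R_0A_1$ and every measurement $M=(M_1,\dots,M_k)$ on $A_1A_1$, $$\sup_{\alpha\in\mathcal C(R_0,A'_0)}P_{\rm succ}\big(((\Phi_2\circ\alpha)\otimes\mathrm{id}_{A_1})(\mathcal E),M\big)\le\sup_{\alpha\in\mathcal C(R_0,A_0)}P_{\rm succ}\big(((\Phi_1\circ\alpha)\otimes\mathrm{id}_{A_1})(\mathcal E),M\big)+\frac{\epsilon}{2}P_{\rm succ}(\mathcal E).$$ Moreover, (i) is also equivalent to (ii), resp. (iii), required only for $R_0=A'_0$.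
   Context: Finite-dimensional systems; $\mathcal C(X,Y)$ channels; $\|\cdot\|_\diamond$ diamond norm. For $\phi:\mathcal B(X)\to\mathcal B(Y)$ hermitian linear, $\phi^*$ is its Hilbert–Schmidt adjoint and $\phi^{\mathsf T}(Z)=(\phi^*(Z^{\mathsf T}))^{\mathsf T}$ (transpose in fixed standard bases), so $\Phi^{\mathsf T}$ maps $\mathcal B(A_1)$ to the input space of $\Phi$. For $X\in\mathcal B_h(R_0B)$ and $\phi\in\mathcal L(R_0,B)$ set $\langle X,\phi\rangle={\rm Tr}[XC_{\phi^*}]$, where $C_{\psi}=(\psi\otimes\mathrm{id})(|I\rangle\rangle\langle\langle I|)$ is the Choi matrix, $|I\rangle\rangle=\sum_i|i\rangle|i\rangle$. For $\rho\in\mathcal B_+(R_0B)$, $\|\rho\|^\diamond_{B|R_0}=\max_{\alpha\in\mathcal C(R_0,B)}\langle\rho,\alpha\rangle=\min\{\lambda>0:\rho\le\lambda\sigma\otimes I_B,\ \sigma\in\mathfrak S(R_0)\}$. An ensemble $\mathcal E=\{\lambda_i,\rho_i\}_{i=1}^k$ on $X$: states $\rho_i$ with probabilities $\lambda_i$; for a map $\Psi$, $\Psi(\mathcal E)=\{\lambda_i,\Psi(\rho_i)\}$; a $k$-outcome measurement $M$: $M_i\ge0$, $\sum M_i=I$; $P_{\rm succ}(\mathcal E,M)=\sum_i\lambda_i{\rm Tr}[\rho_iM_i]$, $P_{\rm succ}(\mathcal E)=\max_MP_{\rm succ}(\mathcal E,M)$. In (iii), $\Phi\circ\alpha$ acts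 on the $R_0$ part and the output is measured together with the $A_1$ part of the ensemble. *)

theory Defs
  imports "Jordan_Normal_Form.Schur_Decomposition"
begin

(* Finite-dimensional quantum systems are identified with their dimensions
   (positive naturals). Operators on a d-dimensional system are complex d x d
   matrices. Linear maps B(X) -> B(Y) are HOL functions on complex matrices,
   only their behaviour on carrier_mat dX dX matters.
   Composite systems X Y have dimension dX * dY, with the standard
   (lexicographic) tensor basis |i>|j> = e_(i*dY + j). *)

type_synonym cmap = "complex mat \<Rightarrow> complex mat"

definition mtrace :: "complex mat \<Rightarrow> complex" where
  "mtrace A = (\<Sum>i<dim_row A. A $$ (i,i))"

definition transp :: "complex mat \<Rightarrow> complex mat" where
  "transp A = transpose_mat A"

definition munit :: "nat \<Rightarrow> nat \<Rightarrow> nat \<Rightarrow> complex mat" where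
  "munit d i j = mat d d (\<lambda>(a,b). if a = i \<and> b = j then 1 else 0)"

definition psd :: "nat \<Rightarrow> complex mat \<Rightarrow> bool" where
  "psd d A \<longleftrightarrow> A \<in> carrier_mat d d \<and>
     (\<forall>v \<in> carrier_vec d. ((A *\<^sub>v v) \<bullet> conjugate v) \<in> \<real> \<and> 0 \<le> Re ((A *\<^sub>v v) \<bullet> conjugate v))"

definition state :: "nat \<Rightarrow> complex mat \<Rightarrow> bool" where
  "state d \<rho> \<longleftrightarrow> psd d \<rho> \<and> mtrace \<rho> = 1"

definition trace_norm :: "complex mat \<Rightarrow> real" where
  "trace_norm A = Re (mtrace (THE B. psd (dim_col A) B \<and> B * B = mat_adjoint A * A))"

definition lin_map :: "nat \<Rightarrow> nat \<Rightarrow> cmap \<Rightarrow> bool" where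
  "lin_map dX dY \<phi> \<longleftrightarrow>
     (\<forall>A \<in> carrier_mat dX dX. \<phi> A \<in> carrier_mat dY dY) \<and>
     (\<forall>A \<in> carrier_mat dX dX. \<forall>B \<in> carrier_mat dX dX. \<phi> (A + B) = \<phi> A + \<phi> B) \<and>
     (\<forall>A \<in> carrier_mat dX dX. \<forall>c. \<phi> (c \<cdot>\<^sub>m A) = c \<cdot>\<^sub>m \<phi> A)"

definition id_tensor :: "nat \<Rightarrow> nat \<Rightarrow> nat \<Rightarrow> cmap \<Rightarrow> cmap" where
  "id_tensor dR dX dY \<phi> M = mat (dR * dY) (dR * dY) (\<lambda>(p,q).
      \<phi> (mat dX dX (\<lambda>(i,j). M $$ ((p div dY) * dX + i, (q div dY) * dX + j)))
        $$ (p mod dY, q mod dY))"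

definition tensor_id :: "nat \<Rightarrow> nat \<Rightarrow> nat \<Rightarrow> cmap \<Rightarrow> cmap" where
  "tensor_id dX dY dR \<phi> M = mat (dY * dR) (dY * dR) (\<lambda>(p,q).
      \<phi> (mat dX dX (\<lambda>(i,j). M $$ (i * dR + p mod dR, j * dR + q mod dR)))
        $$ (p div dR, q div dR))"

definition CP_map :: "nat \<Rightarrow> nat \<Rightarrow> cmap \<Rightarrow> bool" where
  "CP_map dX dY \<phi> \<longleftrightarrow>
     (\<forall>n>0. \<forall>P. psd (n * dX) P \<longrightarrow> psd (n * dY) (id_tensor n dX dY \<phi> P))"

definition TP_map :: "nat \<Rightarrow> nat \<Rightarrow> cmap \<Rightarrow> bool" where
  "TP_map dX dY \<phi> \<longleftrightarrow> (\<forall>A \<in> carrier_mat dX dX. mtrace (\<phi> A) = mtrace A)"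

definition channel :: "nat \<Rightarrow> nat \<Rightarrow> cmap \<Rightarrow> bool" where
  "channel dX dY \<phi> \<longleftrightarrow> lin_map dX dY \<phi> \<and> CP_map dX dY \<phi> \<and> TP_map dX dY \<phi>"

(* Hilbert-Schmidt adjoint \<phi>^dag : B(Y) -> B(X) of \<phi> : B(X) -> B(Y):
   <A, \<phi>^dag(Z)> = <\<phi>(A), Z>, so \<phi>^dag(Z)_(i,j) = <\<phi>(|i><j|), Z> *)
definition hs_adj :: "nat \<Rightarrow> nat \<Rightarrow> cmap \<Rightarrow> cmap" where
  "hs_adj dX dY \<phi> Z = mat dX dX (\<lambda>(i,j). mtrace (mat_adjoint (\<phi> (munit dX i j)) * Z))"

definition map_transp :: "nat \<Rightarrow> nat \<Rightarrow> cmap \<Rightarrow> cmap" where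
  "map_transp dX dY \<phi> Z = transp (hs_adj dX dY \<phi> (transp Z))"

(* |I>> = \<Sum>_i |i>|i> as a column matrix, and |I>><<I| *)
definition max_ent :: "nat \<Rightarrow> complex mat" where
  "max_ent d = mat (d * d) (d * d) (\<lambda>(p,q).
      if p div d = p mod d \<and> q div d = q mod d then 1 else 0)"

definition choi :: "nat \<Rightarrow> nat \<Rightarrow> cmap \<Rightarrow> complex mat" where
  "choi dX dY \<psi> = tensor_id dX dY dX \<psi> (max_ent dX)"

definition pairing :: "nat \<Rightarrow> nat \<Rightarrow> complex mat \<Rightarrow> cmap \<Rightarrow> complex" where
  "pairing dR dB X \<phi> = mtrace (X * choi dB dR (hs_adj dR dB \<phi>))"

definition cond_dnorm :: "nat \<Rightarrow> nat \<Rightarrow> complex mat \<Rightarrow> real" where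
  "cond_dnorm dR dB \<rho> = Sup {Re (pairing dR dB \<rho> \<alpha>) | \<alpha>. channel dR dB \<alpha>}"

definition dnorm :: "nat \<Rightarrow> nat \<Rightarrow> cmap \<Rightarrow> real" where
  "dnorm dX dY \<phi> = Sup {trace_norm (tensor_id dX dY dX \<phi> X) | X.
      X \<in> carrier_mat (dX * dX) (dX * dX) \<and> trace_norm X \<le> 1}"

definition delta_pre :: "nat \<Rightarrow> nat \<Rightarrow> nat \<Rightarrow> cmap \<Rightarrow> cmap \<Rightarrow> real" where
  "delta_pre dA0 dA0' dA1 \<Phi>1 \<Phi>2 =
     Inf {dnorm dA0' dA1 (\<lambda>X. \<Phi>1 (\<Lambda> X) - \<Phi>2 X) | \<Lambda>. channel dA0' dA0 \<Lambda>}"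

definition ensemble :: "nat \<Rightarrow> nat \<Rightarrow> (nat \<Rightarrow> real) \<Rightarrow> (nat \<Rightarrow> complex mat) \<Rightarrow> bool" where
  "ensemble d k lam rho \<longleftrightarrow>
     (\<forall>i<k. 0 \<le> lam i \<and> state d (rho i)) \<and> (\<Sum>i<k. lam i) = 1"

definition measurement :: "nat \<Rightarrow> nat \<Rightarrow> (nat \<Rightarrow> complex mat) \<Rightarrow> bool" where
  "measurement d k M \<longleftrightarrow> (\<forall>i<k. psd d (M i)) \<and> (\<forall>a<d. \<forall>b<d. (\<Sum>i<k. M i $$ (a,b)) = 1\<^sub>m d $$ (a,b))"

definition psucc :: "nat \<Rightarrow> (nat \<Rightarrow> real) \<Rightarrow> (nat \<Rightarrow> complex mat) \<Rightarrow> (nat \<Rightarrow> complex mat) \<Rightarrow> real" where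
  "psucc k lam rho M = (\<Sum>i<k. lam i * Re (mtrace (rho i * M i)))"

definition psucc_opt :: "nat \<Rightarrow> nat \<Rightarrow> (nat \<Rightarrow> real) \<Rightarrow> (nat \<Rightarrow> complex mat) \<Rightarrow> real" where
  "psucc_opt d k lam rho = Sup {psucc k lam rho M | M. measurement d k M}"

definition cond_ii :: "nat \<Rightarrow> nat \<Rightarrow> nat \<Rightarrow> cmap \<Rightarrow> cmap \<Rightarrow> real \<Rightarrow> nat \<Rightarrow> bool" where
  "cond_ii dA0 dA0' dA1 \<Phi>1 \<Phi>2 \<epsilon> dR \<longleftrightarrow>
     (\<forall>\<rho>. state (dR * dA1) \<rho> \<longrightarrow>
        cond_dnorm dR dA0' (id_tensor dR dA1 dA0' (map_transp dA0' dA1 \<Phi>2) \<rho>)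
        \<le> cond_dnorm dR dA0 (id_tensor dR dA1 dA0 (map_transp dA0 dA1 \<Phi>1) \<rho>)
           + \<epsilon> / 2 * cond_dnorm dR dA1 \<rho>)"

definition cond_iii :: "nat \<Rightarrow> nat \<Rightarrow> nat \<Rightarrow> cmap \<Rightarrow> cmap \<Rightarrow> real \<Rightarrow> nat \<Rightarrow> bool" where
  "cond_iii dA0 dA0' dA1 \<Phi>1 \<Phi>2 \<epsilon> dR \<longleftrightarrow>
     (\<forall>k lam rho M. ensemble (dR * dA1) k lam rho \<longrightarrow> measurement (dA1 * dA1) k M \<longrightarrow>
        Sup {psucc k lam (\<lambda>i. tensor_id dR dA1 dA1 (\<lambda>X. \<Phi>2 (\<alpha> X)) (rho i)) M
               | \<alpha>. channel dR dA0' \<alpha>}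
        \<le> Sup {psucc k lam (\<lambda>i. tensor_id dR dA1 dA1 (\<lambda>X. \<Phi>1 (\<alpha> X)) (rho i)) M
               | \<alpha>. channel dR dA0 \<alpha>}
          + \<epsilon> / 2 * psucc_opt (dR * dA1) k lam rho)"

end

theory Submission
  imports Defs "HOL-Library.Function_Algebras" "HOL-Number_Theory.Cong"
begin

text \<open>
  Identify a map with its Choi kernel \<open>J\<close> and put \<open>\<langle>\<rho>, J\<rangle> = \<Sum> \<rho>\<^sub>p\<^sub>q J\<^sub>p\<^sub>q\<close>. Both sides of (ii) are then
  suprema of \<open>\<langle>\<rho>, \<Phi> \<circ> \<alpha>\<rangle>\<close> over channels \<open>\<alpha>\<close>, and so are those of (iii), with \<open>\<rho>\<close> the contraction of the
  ensemble with the measurement; pulling the measurement back through a channel bounds the conditional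
  norm of this contraction by the success probability of the ensemble.

  Contracting \<open>\<rho>\<close> with \<open>\<alpha>\<close> does not increase its conditional norm, so (ii) reduces to
  \<open>\<langle>\<rho>, \<Phi>\<^sub>2 - \<Phi>\<^sub>1 \<circ> \<Lambda>\<rangle> \<le> (\<lambda> / 2) \<parallel>\<Phi>\<^sub>1 \<circ> \<Lambda> - \<Phi>\<^sub>2\<parallel>\<close> for \<open>\<rho>\<close> of conditional norm \<open>\<lambda>\<close>. Duality gives
  \<open>\<rho> \<le> \<lambda> \<sigma> \<otimes> I\<close>. Undoing a purification \<open>X\<close> of \<open>\<sigma>\<close> turns \<open>\<rho> / \<lambda>\<close> into some \<open>0 \<le> S \<le> I\<close>, and the
  pairing into \<open>\<lambda>\<close> times that of \<open>S\<close> with the traceless Hermitian operator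
  \<open>((\<Phi>\<^sub>2 - \<Phi>\<^sub>1 \<circ> \<Lambda>) \<otimes> id) X\<close>, which is at most half its trace norm.

  If (i) fails, the convex set of all \<open>\<Phi>\<^sub>1 \<circ> \<Lambda> + (\<epsilon> / 2) \<gamma> - \<Phi>\<^sub>2\<close> with channels \<open>\<Lambda>\<close> and \<open>\<gamma>\<close> stays away
  from the positive cone, because \<open>\<Phi>\<^sub>2 - \<Phi>\<^sub>1 \<circ> \<Lambda> \<le> t \<gamma>\<close> forces a diamond distance of at most \<open>2 t\<close>. A
  separating functional is a state on \<open>A'\<^sub>0 A\<^sub>1\<close> that violates (ii) with \<open>\<alpha> = id\<close>; its Weyl rotations,
  measured in the basis of maximally entangled vectors, violate (iii).
\<close>

section \<open>Kernels on a finite index set\<close>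

type_synonym 'i kernel = "'i \<Rightarrow> 'i \<Rightarrow> complex"

definition kernel_eq :: "'i set \<Rightarrow> 'i kernel \<Rightarrow> 'i kernel \<Rightarrow> bool" where
  "kernel_eq I A B \<longleftrightarrow> (\<forall>p\<in>I. \<forall>q\<in>I. A p q = B p q)"

definition scale_kernel :: "real \<Rightarrow> 'i kernel \<Rightarrow> 'i kernel" (infixr "\<cdot>\<^sub>k" 75) where
  "(c \<cdot>\<^sub>k A) p q = of_real c * A p q"

definition id_kernel :: "'i kernel" where
  "id_kernel p q = of_bool (p = q)"

definition rank_one_kernel :: "('i \<Rightarrow> complex) \<Rightarrow> 'i kernel" where
  "rank_one_kernel u p q = u p * cnj (u q)"

definition transpose_kernel :: "'i kernel \<Rightarrow> 'i kernel" where
  "transpose_kernel A p q = A q p"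

definition inner_on :: "'i set \<Rightarrow> ('i \<Rightarrow> complex) \<Rightarrow> ('i \<Rightarrow> complex) \<Rightarrow> complex" where
  "inner_on I u v = (\<Sum>p\<in>I. cnj (u p) * v p)"

definition kernel_app :: "'i set \<Rightarrow> 'i kernel \<Rightarrow> ('i \<Rightarrow> complex) \<Rightarrow> 'i \<Rightarrow> complex" where
  "kernel_app I A v p = (\<Sum>q\<in>I. A p q * v q)"

definition sform :: "'i set \<Rightarrow> 'i kernel \<Rightarrow> ('i \<Rightarrow> complex) \<Rightarrow> ('i \<Rightarrow> complex) \<Rightarrow> complex" where
  "sform I A u v = (\<Sum>p\<in>I. \<Sum>q\<in>I. cnj (u p) * A p q * v q)"

definition kernel_mult :: "'i set \<Rightarrow> 'i kernel \<Rightarrow> 'i kernel \<Rightarrow> 'i kernel" where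
  "kernel_mult I A B p q = (\<Sum>r\<in>I. A p r * B r q)"

definition kernel_trace :: "'i set \<Rightarrow> 'i kernel \<Rightarrow> complex" where
  "kernel_trace I A = (\<Sum>p\<in>I. A p p)"

definition kernel_pair :: "'i set \<Rightarrow> 'i kernel \<Rightarrow> 'i kernel \<Rightarrow> complex" where
  "kernel_pair I A B = (\<Sum>p\<in>I. \<Sum>q\<in>I. A p q * B p q)"

definition herm_kernel :: "'i set \<Rightarrow> 'i kernel \<Rightarrow> bool" where
  "herm_kernel I A \<longleftrightarrow> (\<forall>p\<in>I. \<forall>q\<in>I. cnj (A p q) = A q p)"

definition pos_kernel :: "'i set \<Rightarrow> 'i kernel \<Rightarrow> bool" where
  "pos_kernel I A \<longleftrightarrow> (\<forall>v. 0 \<le> sform I A v v)"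

definition kernel_le :: "'i set \<Rightarrow> 'i kernel \<Rightarrow> 'i kernel \<Rightarrow> bool" where
  "kernel_le I A B \<longleftrightarrow> pos_kernel I (B - A)"

definition density_kernel :: "'i set \<Rightarrow> 'i kernel \<Rightarrow> bool" where
  "density_kernel I A \<longleftrightarrow> pos_kernel I A \<and> kernel_trace I A = 1"

lemma sum_rotate3:
  "(\<Sum>p\<in>I. \<Sum>q\<in>J. \<Sum>k\<in>K. f p q k) = (\<Sum>k\<in>K. \<Sum>p\<in>I. \<Sum>q\<in>J. (f p q k :: 'a :: comm_monoid_add))"
  by (subst (2) sum.swap, subst sum.swap) (rule refl)

lemma cnj_mult_self_nonneg: "0 \<le> cnj z * z"
  by (simp add: less_eq_complex_def mult.commute complex_mult_cnj)

lemma cnj_sgn_mult_self: "cnj (sgn z) * z = of_real (cmod z)"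
proof -
  have "cnj (sgn z) * z = z * cnj z / of_real (cmod z)" by (simp add: sgn_eq)
  then show ?thesis by (simp add: power2_eq_square flip: complex_norm_square)
qed

lemma complex_nonneg_iff: "0 \<le> z \<longleftrightarrow> Im z = 0 \<and> 0 \<le> Re z"
  by (auto simp: less_eq_complex_def)

lemma kernel_eqI: "(\<And>p q. p \<in> I \<Longrightarrow> q \<in> I \<Longrightarrow> A p q = B p q) \<Longrightarrow> kernel_eq I A B"
  by (simp add: kernel_eq_def)

lemma kernel_eqD: "kernel_eq I A B \<Longrightarrow> p \<in> I \<Longrightarrow> q \<in> I \<Longrightarrow> A p q = B p q"
  by (simp add: kernel_eq_def)

lemma kernel_eq_sym: "kernel_eq I A B \<Longrightarrow> kernel_eq I B A"
  by (simp add: kernel_eq_def)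

lemma kernel_eq_trans: "kernel_eq I A B \<Longrightarrow> kernel_eq I B C \<Longrightarrow> kernel_eq I A C"
  by (simp add: kernel_eq_def)

lemma rank_one_kernel_cong:
  "(\<And>p. p \<in> I \<Longrightarrow> u p = v p) \<Longrightarrow> kernel_eq I (rank_one_kernel u) (rank_one_kernel v)"
  by (simp add: kernel_eq_def rank_one_kernel_def)

subsection \<open>Vectors and sesquilinear forms\<close>

lemma inner_on_add_left: "inner_on I (\<lambda>x. u x + u' x) v = inner_on I u v + inner_on I u' v"
  by (simp add: inner_on_def algebra_simps sum.distrib)

lemma inner_on_scale_left: "inner_on I (\<lambda>x. c * u x) v = cnj c * inner_on I u v"
  by (simp add: inner_on_def algebra_simps sum_distrib_left)

lemma inner_on_scale_right: "inner_on I u (\<lambda>x. c * v x) = c * inner_on I u v"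
  by (simp add: inner_on_def algebra_simps sum_distrib_left)

lemma inner_on_cong:
  "(\<And>p. p \<in> I \<Longrightarrow> u p = u' p) \<Longrightarrow> (\<And>p. p \<in> I \<Longrightarrow> v p = v' p) \<Longrightarrow> inner_on I u v = inner_on I u' v'"
  by (simp add: inner_on_def)

lemma cnj_inner_on: "cnj (inner_on I u v) = inner_on I v u"
  by (simp add: inner_on_def mult.commute)

lemma inner_on_self: "inner_on I u u = of_real (\<Sum>p\<in>I. (cmod (u p))\<^sup>2)"
  unfolding inner_on_def by (simp add: complex_norm_square mult.commute del: of_real_power)

lemma inner_on_self_nonneg: "0 \<le> inner_on I u u"
  unfolding inner_on_self by (simp add: complex_nonneg_iff sum_nonneg)

lemma inner_on_self_eq_0_iff:
  assumes "finite I"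
  shows "inner_on I u u = 0 \<longleftrightarrow> (\<forall>p\<in>I. u p = 0)"
  unfolding inner_on_self of_real_eq_0_iff using assms by (simp add: sum_nonneg_eq_0_iff)

lemma sform_eq_inner_on: "sform I A u v = inner_on I u (kernel_app I A v)"
  by (simp add: sform_def inner_on_def kernel_app_def sum_distrib_left mult.assoc)

lemma sform_add_left: "sform I A (\<lambda>x. u x + u' x) v = sform I A u v + sform I A u' v"
  by (simp add: sform_eq_inner_on inner_on_add_left)

lemma sform_add_right: "sform I A u (\<lambda>x. v x + v' x) = sform I A u v + sform I A u v'"
  by (simp add: sform_def algebra_simps sum.distrib)

lemma sform_scale_left: "sform I A (\<lambda>x. c * u x) v = cnj c * sform I A u v"
  by (simp add: sform_eq_inner_on inner_on_scale_left)

lemma sform_scale_right: "sform I A u (\<lambda>x. c * v x) = c * sform I A u v"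
  by (simp add: sform_def algebra_simps sum_distrib_left)

lemma sform_cong: "kernel_eq I A B \<Longrightarrow> sform I A u v = sform I B u v"
  by (simp add: sform_def kernel_eq_def)

lemma sform_kernel_add: "sform I (A + B) u v = sform I A u v + sform I B u v"
  by (simp add: sform_def algebra_simps sum.distrib)

lemma sform_kernel_diff: "sform I (A - B) u v = sform I A u v - sform I B u v"
  by (simp add: sform_def algebra_simps sum_subtractf)

lemma sform_kernel_scale: "sform I (c \<cdot>\<^sub>k A) u v = of_real c * sform I A u v"
  by (simp add: sform_def scale_kernel_def algebra_simps sum_distrib_left)

lemma kernel_app_id: "finite I \<Longrightarrow> p \<in> I \<Longrightarrow> kernel_app I id_kernel v p = v p"
  by (simp add: kernel_app_def id_kernel_def of_bool_def if_distrib[of "\<lambda>x. x * _"] cong: if_cong)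

lemma sform_id_kernel: "finite I \<Longrightarrow> sform I id_kernel u v = inner_on I u v"
  by (simp add: sform_eq_inner_on kernel_app_id cong: inner_on_cong)

lemma sform_unit_vectors:
  assumes "finite I" "p \<in> I" "q \<in> I"
  shows "sform I A (\<lambda>x. of_bool (x = p)) (\<lambda>x. of_bool (x = q)) = A p q"
proof -
  have "sform I A (\<lambda>x. of_bool (x = p)) (\<lambda>x. of_bool (x = q)) =
      (\<Sum>x\<in>I. if x = p then (\<Sum>y\<in>I. if y = q then A x y else 0) else 0)"
    unfolding sform_def by (intro sum.cong refl) (auto intro!: sum.cong)
  then show ?thesis using assms by simp
qed

lemma inner_on_kernel_app:
  assumes "herm_kernel I A"
  shows "inner_on I u (kernel_app I A v) = inner_on I (kernel_app I A u) v"
proof -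
  have "inner_on I u (kernel_app I A v) = (\<Sum>q\<in>I. \<Sum>p\<in>I. cnj (u p) * A p q * v q)"
    by (subst sum.swap) (simp add: inner_on_def kernel_app_def sum_distrib_left mult.assoc)
  also have "\<dots> = (\<Sum>q\<in>I. \<Sum>p\<in>I. cnj (A q p) * cnj (u p) * v q)"
    using assms by (intro sum.cong refl) (simp add: herm_kernel_def mult.commute)
  also have "\<dots> = inner_on I (kernel_app I A u) v"
    by (simp add: inner_on_def kernel_app_def sum_distrib_right)
  finally show ?thesis .
qed

subsection \<open>Trace and pairing\<close>

lemma kernel_trace_add: "kernel_trace I (A + B) = kernel_trace I A + kernel_trace I B"
  by (simp add: kernel_trace_def sum.distrib)

lemma kernel_trace_diff: "kernel_trace I (A - B) = kernel_trace I A - kernel_trace I B"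
  by (simp add: kernel_trace_def sum_subtractf)

lemma kernel_trace_scale: "kernel_trace I (c \<cdot>\<^sub>k A) = of_real c * kernel_trace I A"
  by (simp add: kernel_trace_def scale_kernel_def sum_distrib_left)

lemma kernel_trace_id: "kernel_trace I id_kernel = of_nat (card I)"
  by (simp add: kernel_trace_def id_kernel_def)

lemma kernel_trace_cong: "kernel_eq I A B \<Longrightarrow> kernel_trace I A = kernel_trace I B"
  by (simp add: kernel_trace_def kernel_eq_def)

lemma kernel_pair_cong: "kernel_eq I A A' \<Longrightarrow> kernel_eq I B B' \<Longrightarrow> kernel_pair I A B = kernel_pair I A' B'"
  by (simp add: kernel_pair_def kernel_eq_def)

lemma kernel_pair_cong_right: "kernel_eq I B B' \<Longrightarrow> kernel_pair I A B = kernel_pair I A B'"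
  by (simp add: kernel_pair_def kernel_eq_def)

lemma kernel_pair_commute: "kernel_pair I A B = kernel_pair I B A"
  by (simp add: kernel_pair_def mult.commute)

lemma kernel_pair_add_right: "kernel_pair I A (B + C) = kernel_pair I A B + kernel_pair I A C"
  by (simp add: kernel_pair_def algebra_simps sum.distrib)

lemma kernel_pair_diff_right: "kernel_pair I A (B - C) = kernel_pair I A B - kernel_pair I A C"
  by (simp add: kernel_pair_def algebra_simps sum_subtractf)

lemma kernel_pair_scale_right: "kernel_pair I A (c \<cdot>\<^sub>k B) = of_real c * kernel_pair I A B"
  by (simp add: kernel_pair_def scale_kernel_def algebra_simps sum_distrib_left)

lemma kernel_pair_scale_left: "kernel_pair I (c \<cdot>\<^sub>k A) B = of_real c * kernel_pair I A B"
  unfolding kernel_pair_commute[of I _ B] by (rule kernel_pair_scale_right)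

lemma kernel_pair_sum_right:
  "kernel_pair I A (\<lambda>p q. \<Sum>k\<in>K. B k p q) = (\<Sum>k\<in>K. kernel_pair I A (B k))"
  unfolding kernel_pair_def sum_distrib_left by (rule sum_rotate3)

lemma kernel_pair_id: "finite I \<Longrightarrow> kernel_pair I A id_kernel = kernel_trace I A"
  by (simp add: kernel_pair_def kernel_trace_def id_kernel_def of_bool_def if_distrib cong: if_cong)

lemma kernel_pair_rank_one:
  "kernel_pair I A (rank_one_kernel u) = sform I A (\<lambda>p. cnj (u p)) (\<lambda>p. cnj (u p))"
  by (simp add: kernel_pair_def sform_def rank_one_kernel_def mult_ac)

lemma kernel_pair_transpose:
  "kernel_pair I (transpose_kernel A) (transpose_kernel B) = kernel_pair I A B"
  unfolding kernel_pair_def transpose_kernel_def by (rule sum.swap)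

lemma kernel_pair_transpose_left:
  "kernel_pair I (transpose_kernel A) B = kernel_trace I (kernel_mult I B A)"
  by (simp add: kernel_pair_def kernel_trace_def kernel_mult_def transpose_kernel_def mult.commute)

subsection \<open>Hermitian and positive kernels\<close>

lemma herm_kernel_diff: "herm_kernel I A \<Longrightarrow> herm_kernel I B \<Longrightarrow> herm_kernel I (A - B)"
  by (simp add: herm_kernel_def)

lemma herm_kernel_add: "herm_kernel I A \<Longrightarrow> herm_kernel I B \<Longrightarrow> herm_kernel I (A + B)"
  by (simp add: herm_kernel_def)

lemma herm_kernel_scale: "herm_kernel I A \<Longrightarrow> herm_kernel I (c \<cdot>\<^sub>k A)"
  by (simp add: herm_kernel_def scale_kernel_def)

lemma pos_kernel_cong:
  assumes "pos_kernel I A" "kernel_eq I A B"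
  shows "pos_kernel I B"
  using assms by (simp add: pos_kernel_def flip: sform_cong[OF assms(2)])

lemma pos_kernel_herm:
  assumes "finite I" "pos_kernel I A"
  shows "herm_kernel I A"
  unfolding herm_kernel_def
proof (intro ballI)
  fix p q assume pq: "p \<in> I" "q \<in> I"
  define e where "e p = (\<lambda>x. of_bool (x = p) :: complex)" for p :: 'a
  have entry: "sform I A (e x) (e y) = A x y" if "x \<in> I" "y \<in> I" for x y
    unfolding e_def using sform_unit_vectors[OF assms(1) that] .
  have nonneg: "0 \<le> sform I A v v" for v using assms(2) by (simp add: pos_kernel_def)
  have "0 \<le> A p p + c * A p q + cnj c * (A q p + c * A q q)" for c
    using nonneg[of "\<lambda>x. e p x + c * e q x"] pq
    by (simp add: sform_add_left sform_add_right sform_scale_left sform_scale_right entry algebra_simps)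
  from this[of 1] this[of \<i>] have "Im (A p q + A q p) = 0" "Re (A p q - A q p) = 0"
    using nonneg[of "e p"] nonneg[of "e q"] pq by (auto simp: entry complex_nonneg_iff)
  then show "cnj (A p q) = A q p" by (auto simp: complex_eq_iff)
qed

lemma pos_kernel_diag: "finite I \<Longrightarrow> pos_kernel I A \<Longrightarrow> p \<in> I \<Longrightarrow> 0 \<le> A p p"
  unfolding pos_kernel_def by (metis sform_unit_vectors)

lemma pos_kernel_trace_nonneg: "finite I \<Longrightarrow> pos_kernel I A \<Longrightarrow> 0 \<le> kernel_trace I A"
  unfolding kernel_trace_def by (intro sum_nonneg pos_kernel_diag)

lemma pos_kernel_trace_real:
  "finite I \<Longrightarrow> pos_kernel I A \<Longrightarrow> kernel_trace I A = of_real (Re (kernel_trace I A))"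
  using pos_kernel_trace_nonneg[of I A] by (simp add: complex_nonneg_iff complex_eq_iff)

lemma pos_kernel_add: "pos_kernel I A \<Longrightarrow> pos_kernel I B \<Longrightarrow> pos_kernel I (A + B)"
  by (simp add: pos_kernel_def sform_kernel_add)

lemma pos_kernel_scale: "pos_kernel I A \<Longrightarrow> 0 \<le> c \<Longrightarrow> pos_kernel I (c \<cdot>\<^sub>k A)"
  by (simp add: pos_kernel_def sform_kernel_scale complex_nonneg_iff)

lemma pos_kernel_zero: "pos_kernel I (\<lambda>p q. 0)"
  by (simp add: pos_kernel_def sform_def)

lemma pos_kernel_sum:
  assumes "\<And>k. k \<in> K \<Longrightarrow> pos_kernel I (A k)"
  shows "pos_kernel I (\<lambda>p q. \<Sum>k\<in>K. A k p q)"
  using assms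
proof (induction K rule: infinite_finite_induct)
  case (insert k K)
  then have "pos_kernel I (A k + (\<lambda>p q. \<Sum>k\<in>K. A k p q))" by (intro pos_kernel_add) auto
  with insert.hyps show ?case by (simp add: plus_fun_def)
qed (auto intro: pos_kernel_zero)

lemma pos_kernel_id: "finite I \<Longrightarrow> pos_kernel I id_kernel"
  by (simp add: pos_kernel_def sform_id_kernel inner_on_self_nonneg)

lemma pos_kernel_rank_one: "pos_kernel I (rank_one_kernel u)"
  unfolding pos_kernel_def
proof
  fix v
  have "sform I (rank_one_kernel u) v v = cnj (inner_on I u v) * inner_on I u v"
    by (simp add: sform_def rank_one_kernel_def inner_on_def sum_product mult_ac)
  then show "0 \<le> sform I (rank_one_kernel u) v v" by (simp only: cnj_mult_self_nonneg)
qed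

lemma pos_kernel_transpose:
  assumes "pos_kernel I A"
  shows "pos_kernel I (transpose_kernel A)"
proof -
  have "sform I (transpose_kernel A) v v = sform I A (\<lambda>p. cnj (v p)) (\<lambda>p. cnj (v p))" for v
    unfolding sform_def transpose_kernel_def by (subst sum.swap) (simp add: mult_ac)
  with assms show ?thesis by (simp add: pos_kernel_def)
qed

lemma density_kernel_cong: "density_kernel I A \<Longrightarrow> kernel_eq I A B \<Longrightarrow> density_kernel I B"
  using pos_kernel_cong[of I A B] kernel_trace_cong[of I A B] by (simp add: density_kernel_def)

lemma pos_kernel_diag_congruence:
  assumes "pos_kernel I A"
  shows "pos_kernel I (\<lambda>p q. s p * A p q * cnj (s q))"
proof -
  have "sform I (\<lambda>p q. s p * A p q * cnj (s q)) v v = sform I A (\<lambda>p. cnj (s p) * v p) (\<lambda>p. cnj (s p) * v p)"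
    for v
    by (simp add: sform_def mult_ac)
  with assms show ?thesis by (simp add: pos_kernel_def)
qed

lemma cmod_pos_kernel_le_trace:
  assumes "finite I" "pos_kernel I A" "p \<in> I" "q \<in> I"
  shows "cmod (A p q) \<le> Re (kernel_trace I A)"
proof -
  define c where "c = - cnj (sgn (A p q))"
  define e where "e p = (\<lambda>x. of_bool (x = p) :: complex)" for p :: 'a
  have entry: "sform I A (e x) (e y) = A x y" if "x \<in> I" "y \<in> I" for x y
    unfolding e_def using sform_unit_vectors[OF assms(1) that] .
  have diag_le: "Re (A x x) \<le> Re (kernel_trace I A)" if "x \<in> I" for x
    unfolding kernel_trace_def Re_sum using assms(1) that pos_kernel_diag[OF assms(1,2)]
    by (intro member_le_sum) (auto simp: complex_nonneg_iff)
  have diag_nonneg: "0 \<le> Re (A x x)" if "x \<in> I" for x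
    using pos_kernel_diag[OF assms(1,2) that] by (simp add: complex_nonneg_iff)
  have "A q p = cnj (A p q)"
    using pos_kernel_herm[OF assms(1,2)] assms(3,4) by (simp add: herm_kernel_def)
  moreover have "0 \<le> sform I A (\<lambda>x. e p x + c * e q x) (\<lambda>x. e p x + c * e q x)"
    using assms(2) by (simp add: pos_kernel_def)
  ultimately have "0 \<le> Re (A p p) + 2 * Re (c * A p q) + ((Re c)\<^sup>2 + (Im c)\<^sup>2) * Re (A q q)"
    using assms(3,4)
    by (simp add: sform_add_left sform_add_right sform_scale_left sform_scale_right entry
        complex_nonneg_iff power2_eq_square algebra_simps)
  moreover have "Re (c * A p q) = - cmod (A p q)"
    by (simp add: c_def cnj_sgn_mult_self)
  moreover have "((Re c)\<^sup>2 + (Im c)\<^sup>2) * Re (A q q) \<le> Re (A q q)"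
    using diag_nonneg[OF assms(4)] unfolding cmod_power2[symmetric] by (auto simp: c_def norm_sgn)
  ultimately show ?thesis using diag_le[OF assms(3)] diag_le[OF assms(4)] by linarith
qed

lemma pos_kernel_trace_pos:
  assumes "finite I" "pos_kernel I A" "kernel_pair I A B \<noteq> 0"
  shows "0 < Re (kernel_trace I A)"
proof (rule ccontr)
  assume "\<not> 0 < Re (kernel_trace I A)"
  then have "A p q = 0" if "p \<in> I" "q \<in> I" for p q
    using cmod_pos_kernel_le_trace[OF assms(1,2) that] by (metis norm_le_zero_iff not_le order_trans)
  then show False using assms(3) by (simp add: kernel_pair_def)
qed

section \<open>The spectral theorem\<close>

lemma mtrace_mult:
  assumes "A \<in> carrier_mat n m" "B \<in> carrier_mat m n"
  shows "mtrace (A * B) = (\<Sum>p<n. \<Sum>q<m. A $$ (p, q) * B $$ (q, p))"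
  using assms by (simp add: mtrace_def scalar_prod_def atLeast0LessThan)

lemma mtrace_mult_commute:
  assumes "A \<in> carrier_mat n m" "B \<in> carrier_mat m n"
  shows "mtrace (A * B) = mtrace (B * A)"
  unfolding mtrace_mult[OF assms] mtrace_mult[OF assms(2,1)]
  by (subst sum.swap) (simp add: mult.commute)

lemma mtrace_similar:
  assumes "similar_mat A B"
  shows "mtrace A = mtrace B"
proof -
  obtain n P Q where carrier: "A \<in> carrier_mat n n" "B \<in> carrier_mat n n" "P \<in> carrier_mat n n"
    "Q \<in> carrier_mat n n"
    and QP_one: "Q * P = 1\<^sub>m n" and A_eq: "A = P * B * Q"
    using similar_matD[OF assms] by auto
  have "mtrace A = mtrace (Q * (P * B))"
    unfolding A_eq by (rule mtrace_mult_commute) (use carrier in auto)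
  also have "\<dots> = mtrace (Q * P * B)" using carrier by (simp add: assoc_mult_mat[of Q n n P n B n])
  also have "\<dots> = mtrace B" using carrier QP_one by simp
  finally show ?thesis .
qed

lemma mtrace_square_zero_spectrum:
  fixes A :: "complex mat"
  assumes A_carrier: "A \<in> carrier_mat n n" and spectrum: "\<And>e. eigenvalue A e \<Longrightarrow> e = 0"
  shows "mtrace (A * A) = 0"
proof -
  obtain es where char_poly_es: "char_poly A = (\<Prod>a\<leftarrow>es. [:- a, 1:])"
    using char_poly_factorized[OF A_carrier] by blast
  obtain B P Q where BPQ: "schur_decomposition A es = (B, P, Q)" by (metis prod_cases3)
  have sim: "similar_mat_wit A B P Q" and tri: "upper_triangular B" and diag: "diag_mat B = es"
    using schur_decomposition[OF A_carrier char_poly_es BPQ] by auto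
  have B_carrier: "B \<in> carrier_mat n n" using similar_mat_witD2[OF A_carrier sim] by simp
  have "e = 0" if "e \<in> set es" for e
    using that spectrum
    by (auto simp: eigenvalue_root_char_poly[OF A_carrier] char_poly_es poly_prod_list prod_list_zero_iff)
  then have "B $$ (i, i) = 0" if "i < n" for i
    using that B_carrier diag by (force simp: diag_mat_def)
  then have lower: "B $$ (i, j) = 0" if "i < n" "j \<le> i" for i j
    using tri B_carrier that by (cases "i = j") (auto simp: upper_triangular_def)
  have "mtrace (A ^\<^sub>m 2) = mtrace (B ^\<^sub>m 2)"
    using similar_mat_wit_pow[OF sim] by (intro mtrace_similar) (auto simp: similar_mat_def)
  also have "\<dots> = (\<Sum>i<n. \<Sum>j<n. B $$ (i, j) * B $$ (j, i))"
    using B_carrier by (simp add: numeral_2_eq_2 mtrace_mult)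
  also have "\<dots> = 0"
  proof (intro sum.neutral ballI)
    fix i j assume "i \<in> {..<n}" "j \<in> {..<n}"
    then show "B $$ (i, j) * B $$ (j, i) = 0" using lower by (cases "j \<le> i") auto
  qed
  finally show ?thesis using A_carrier by (simp add: numeral_2_eq_2)
qed

lemma herm_kernel_eigenvalue_real:
  assumes "herm_kernel I A" "\<And>p. p \<in> I \<Longrightarrow> kernel_app I A u p = e * u p" "inner_on I u u \<noteq> 0"
  shows "e = of_real (Re e)"
proof -
  have "inner_on I u (kernel_app I A u) = e * inner_on I u u"
    using assms(2) by (simp add: inner_on_scale_right cong: inner_on_cong)
  moreover have "inner_on I (kernel_app I A u) u = cnj e * inner_on I u u"
    using assms(2) by (simp add: inner_on_scale_left cong: inner_on_cong)
  ultimately have "cnj e = e" using inner_on_kernel_app[OF assms(1), of u u] assms(3) by simp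
  then show ?thesis by (simp add: complex_eq_iff)
qed

lemma inner_on_normalise:
  assumes "inner_on I u u \<noteq> 0"
  obtains c where "inner_on I (\<lambda>p. of_real c * u p) (\<lambda>p. of_real c * u p) = 1"
proof
  define s where "s = (\<Sum>p\<in>I. (cmod (u p))\<^sup>2)"
  have inner_uu: "inner_on I u u = of_real s" unfolding s_def by (rule inner_on_self)
  moreover have "0 \<le> s" by (simp add: s_def sum_nonneg)
  ultimately have "0 < s" using assms by (cases "s = 0") auto
  then show "inner_on I (\<lambda>p. of_real (1 / sqrt s) * u p) (\<lambda>p. of_real (1 / sqrt s) * u p) = 1"
    unfolding inner_on_scale_left inner_on_scale_right inner_uu by (simp flip: of_real_mult)
qed

lemma hermitian_mat_nonzero_eigenvalue:
  fixes M :: "complex mat"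
  assumes M_carrier: "M \<in> carrier_mat n n" and herm: "\<And>i j. i < n \<Longrightarrow> j < n \<Longrightarrow> cnj (M $$ (i, j)) = M $$ (j, i)"
    and entry_nonzero: "k < n" "l < n" "M $$ (k, l) \<noteq> 0"
  obtains e where "eigenvalue M e" "e \<noteq> 0"
proof -
  have "mtrace (M * M) = (\<Sum>i<n. \<Sum>j<n. M $$ (i, j) * cnj (M $$ (i, j)))"
    unfolding mtrace_mult[OF M_carrier M_carrier] by (intro sum.cong refl) (simp add: herm)
  then have "mtrace (M * M) = of_real (\<Sum>i<n. \<Sum>j<n. (cmod (M $$ (i, j)))\<^sup>2)"
    by (simp only: of_real_sum complex_norm_square)
  moreover have "0 < (\<Sum>j<n. (cmod (M $$ (k, j)))\<^sup>2)"
    using entry_nonzero by (intro sum_pos2[of _ l]) auto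
  then have "0 < (\<Sum>i<n. \<Sum>j<n. (cmod (M $$ (i, j)))\<^sup>2)"
    using entry_nonzero(1) by - (rule sum_pos2[of _ k], auto intro: sum_nonneg)
  ultimately have "mtrace (M * M) \<noteq> 0" by (simp only: of_real_eq_0_iff)
  then show ?thesis using that mtrace_square_zero_spectrum[OF M_carrier] by blast
qed

lemma herm_kernel_nonzero_eigenvalue:
  assumes fin: "finite I" and herm: "herm_kernel I A" and pq: "p \<in> I" "q \<in> I" "A p q \<noteq> 0"
  obtains u and \<mu> :: real where "inner_on I u u \<noteq> 0" "\<mu> \<noteq> 0"
    "\<And>p. p \<in> I \<Longrightarrow> kernel_app I A u p = of_real \<mu> * u p"
proof -
  define n where "n = card I"
  obtain f where bij_f: "bij_betw f {..<n} I"
    using ex_bij_betw_nat_finite[OF fin] by (auto simp: n_def atLeast0LessThan)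
  then have f_in: "f i \<in> I" if "i < n" for i using that by (auto simp: bij_betw_def)
  define M where "M = mat n n (\<lambda>(i, j). A (f i) (f j))"
  have M_carrier: "M \<in> carrier_mat n n" by (simp add: M_def)
  have "cnj (M $$ (i, j)) = M $$ (j, i)" if "i < n" "j < n" for i j
    using that herm f_in by (simp add: M_def herm_kernel_def)
  moreover obtain k l where "k < n" "l < n" "M $$ (k, l) \<noteq> 0"
    using bij_f pq by (auto simp: bij_betw_def M_def)
  ultimately obtain e where "eigenvalue M e" and e_nonzero: "e \<noteq> 0"
    using hermitian_mat_nonzero_eigenvalue[OF M_carrier] by metis
  then obtain v where eigenvector_v: "v \<in> carrier_vec n" "v \<noteq> 0\<^sub>v n" "M *\<^sub>v v = e \<cdot>\<^sub>v v"
    using M_carrier by (auto simp: eigenvalue_def eigenvector_def)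
  define u where "u p = v $ (inv_into {..<n} f p)" for p
  have u_f: "u (f i) = v $ i" if "i < n" for i
    using bij_f that by (simp add: u_def bij_betw_def)
  have eigen: "kernel_app I A u x = e * u x" if x_in: "x \<in> I" for x
  proof -
    obtain i where x_index: "i < n" "x = f i" using bij_f x_in by (auto simp: bij_betw_def)
    have "kernel_app I A u x = (\<Sum>j<n. A (f i) (f j) * u (f j))"
      unfolding kernel_app_def x_index(2) by (rule sum.reindex_bij_betw[OF bij_f, symmetric])
    also have "\<dots> = (M *\<^sub>v v) $ i"
      using x_index(1) eigenvector_v(1) by (simp add: M_def u_f scalar_prod_def atLeast0LessThan)
    finally show ?thesis using x_index eigenvector_v by (simp add: u_f)
  qed
  obtain i where "i < n" "v $ i \<noteq> 0"
    using eigenvector_v(1,2) by (metis eq_vecI carrier_vecD index_zero_vec)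
  then have u_nonzero: "inner_on I u u \<noteq> 0"
    using inner_on_self_eq_0_iff[OF fin, of u] u_f f_in by metis
  show ?thesis
    using that[OF u_nonzero, of "Re e"] eigen herm_kernel_eigenvalue_real[OF herm eigen u_nonzero] e_nonzero
    by (metis of_real_eq_0_iff)
qed

definition orthonormal :: "'i set \<Rightarrow> 'j set \<Rightarrow> ('j \<Rightarrow> 'i \<Rightarrow> complex) \<Rightarrow> bool" where
  "orthonormal I J v \<longleftrightarrow> (\<forall>j\<in>J. \<forall>k\<in>J. inner_on I (v j) (v k) = of_bool (j = k))"

definition dyad_kernel ::
    "'j set \<Rightarrow> ('j \<Rightarrow> real) \<Rightarrow> ('j \<Rightarrow> 'i \<Rightarrow> complex) \<Rightarrow> ('j \<Rightarrow> 'i \<Rightarrow> complex) \<Rightarrow> 'i kernel" where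
  "dyad_kernel J a u v p q = (\<Sum>j\<in>J. of_real (a j) * u j p * cnj (v j q))"

definition orthonormal_basis :: "'i set \<Rightarrow> (nat \<Rightarrow> 'i \<Rightarrow> complex) \<Rightarrow> bool" where
  "orthonormal_basis I v \<longleftrightarrow> orthonormal I {..<card I} v \<and>
     kernel_eq I id_kernel (dyad_kernel {..<card I} (\<lambda>_. 1) v v)"

lemma orthonormalD: "orthonormal I J v \<Longrightarrow> j \<in> J \<Longrightarrow> k \<in> J \<Longrightarrow> inner_on I (v j) (v k) = of_bool (j = k)"
  by (simp add: orthonormal_def)

lemma kernel_app_dyad:
  "kernel_app I (dyad_kernel J a u v) x p = (\<Sum>j\<in>J. of_real (a j) * u j p * inner_on I (v j) x)"
  unfolding kernel_app_def dyad_kernel_def inner_on_def sum_distrib_right sum_distrib_left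
  by (subst sum.swap) (simp add: mult_ac)

lemma kernel_trace_dyad:
  "kernel_trace I (dyad_kernel J a u v) = (\<Sum>j\<in>J. of_real (a j) * inner_on I (v j) (u j))"
  unfolding kernel_trace_def dyad_kernel_def inner_on_def sum_distrib_left
  by (subst sum.swap) (simp add: mult_ac)

lemma kernel_trace_dyad_orthonormal:
  "orthonormal I J v \<Longrightarrow> kernel_trace I (dyad_kernel J a v v) = of_real (\<Sum>j\<in>J. a j)"
  by (simp add: kernel_trace_dyad orthonormalD)

lemma kernel_mult_dyad:
  assumes "finite J" "orthonormal I J v"
  shows "kernel_mult I (dyad_kernel J a u v) (dyad_kernel J b v w) = dyad_kernel J (\<lambda>j. a j * b j) u w"
proof (intro ext)
  fix p q
  have "kernel_mult I (dyad_kernel J a u v) (dyad_kernel J b v w) p q =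
      (\<Sum>r\<in>I. \<Sum>j\<in>J. \<Sum>k\<in>J. (of_real (a j) * u j p) * (of_real (b k) * cnj (w k q)) * (cnj (v j r) * v k r))"
    unfolding kernel_mult_def dyad_kernel_def sum_product by (simp add: mult_ac)
  also have "\<dots> = (\<Sum>j\<in>J. \<Sum>k\<in>J. (of_real (a j) * u j p) * (of_real (b k) * cnj (w k q)) *
      inner_on I (v j) (v k))"
    unfolding inner_on_def sum_distrib_left by (rule sum_rotate3[symmetric])
  also have "\<dots> = (\<Sum>j\<in>J. \<Sum>k\<in>J. if k = j then of_real (a j * b j) * u j p * cnj (w j q) else 0)"
    using assms(2) by (intro sum.cong refl) (auto simp: orthonormalD)
  finally show "kernel_mult I (dyad_kernel J a u v) (dyad_kernel J b v w) p q =
      dyad_kernel J (\<lambda>j. a j * b j) u w p q"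
    using assms(1) by (simp add: dyad_kernel_def)
qed

lemma herm_kernel_dyad: "herm_kernel I (dyad_kernel J a v v)"
  by (simp add: herm_kernel_def dyad_kernel_def mult_ac)

lemma pos_kernel_dyad:
  assumes "\<And>j. j \<in> J \<Longrightarrow> 0 \<le> a j"
  shows "pos_kernel I (dyad_kernel J a v v)"
proof -
  have "pos_kernel I (\<lambda>p q. \<Sum>j\<in>J. (a j \<cdot>\<^sub>k rank_one_kernel (v j)) p q)"
    using assms by (intro pos_kernel_sum pos_kernel_scale pos_kernel_rank_one)
  then show ?thesis
    by (rule pos_kernel_cong) (simp add: kernel_eq_def dyad_kernel_def scale_kernel_def rank_one_kernel_def
        mult.assoc)
qed

definition eigenfamily :: "'i set \<Rightarrow> 'i kernel \<Rightarrow> nat \<Rightarrow> (nat \<Rightarrow> 'i \<Rightarrow> complex) \<Rightarrow> (nat \<Rightarrow> real) \<Rightarrow> bool" where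
  "eigenfamily I A k v a \<longleftrightarrow> orthonormal I {..<k} v \<and>
     (\<forall>j<k. \<forall>p\<in>I. kernel_app I A (v j) p = of_real (a j) * v j p)"

definition residual_kernel :: "'j set \<Rightarrow> ('j \<Rightarrow> 'i \<Rightarrow> complex) \<Rightarrow> 'i kernel" where
  "residual_kernel J v = id_kernel - dyad_kernel J (\<lambda>_. 1) v v"

lemma residual_kernel_orthogonal:
  assumes "finite I" "finite J" "orthonormal I J v" "q \<in> I" "j \<in> J"
  shows "inner_on I (v j) (\<lambda>p. residual_kernel J v p q) = 0"
proof -
  have "(\<Sum>p\<in>I. cnj (v j p) * id_kernel p q) = cnj (v j q)"
    using assms(1,4) by (simp add: id_kernel_def of_bool_def if_distrib cong: if_cong)
  moreover have "(\<Sum>p\<in>I. cnj (v j p) * dyad_kernel J (\<lambda>_. 1) v v p q) =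
      (\<Sum>i\<in>J. inner_on I (v j) (v i) * cnj (v i q))"
    unfolding dyad_kernel_def inner_on_def sum_distrib_left sum_distrib_right
    by (subst sum.swap) (simp add: mult_ac)
  moreover have "\<dots> = (\<Sum>i\<in>J. if i = j then cnj (v j q) else 0)"
    using assms(3,5) by (intro sum.cong refl) (auto simp: orthonormalD)
  ultimately show ?thesis
    using assms(2,5) by (simp add: residual_kernel_def inner_on_def right_diff_distrib sum_subtractf)
qed

lemma pos_kernel_residual:
  assumes "finite I" "finite J" "orthonormal I J v"
  shows "pos_kernel I (residual_kernel J v)"
  unfolding pos_kernel_def
proof
  fix x
  define Ex where "Ex = kernel_app I (dyad_kernel J (\<lambda>_. 1) v v) x"
  have "kernel_app I (dyad_kernel J (\<lambda>_. 1) v v) Ex p =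
      kernel_app I (kernel_mult I (dyad_kernel J (\<lambda>_. 1) v v) (dyad_kernel J (\<lambda>_. 1) v v)) x p" for p
    unfolding Ex_def kernel_app_def kernel_mult_def sum_distrib_left sum_distrib_right
    by (subst sum.swap) (simp add: mult.assoc)
  then have idem: "kernel_app I (dyad_kernel J (\<lambda>_. 1) v v) Ex = Ex"
    unfolding kernel_mult_dyad[OF assms(2,3)] by (auto simp: Ex_def)
  have "inner_on I Ex Ex = inner_on I Ex x"
    using inner_on_kernel_app[OF herm_kernel_dyad, of I Ex J "\<lambda>_. 1" v x] by (simp add: idem flip: Ex_def)
  moreover have "inner_on I x Ex = inner_on I Ex x"
    unfolding Ex_def by (rule inner_on_kernel_app[OF herm_kernel_dyad])
  moreover have "inner_on I (\<lambda>p. x p - Ex p) (\<lambda>p. x p - Ex p) =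
      inner_on I x x - inner_on I x Ex - inner_on I Ex x + inner_on I Ex Ex"
    by (simp add: inner_on_def algebra_simps sum.distrib sum_subtractf)
  ultimately have "sform I (residual_kernel J v) x x = inner_on I (\<lambda>p. x p - Ex p) (\<lambda>p. x p - Ex p)"
    unfolding residual_kernel_def sform_kernel_diff sform_id_kernel[OF assms(1)]
    by (simp add: sform_eq_inner_on Ex_def)
  then show "0 \<le> sform I (residual_kernel J v) x x" by (simp add: inner_on_self_nonneg)
qed

lemma kernel_trace_residual:
  assumes "orthonormal I J v"
  shows "kernel_trace I (residual_kernel J v) = of_nat (card I) - of_nat (card J)"
  using kernel_trace_dyad_orthonormal[OF assms, of "\<lambda>_. 1"]
  by (simp add: residual_kernel_def kernel_trace_diff kernel_trace_id)

lemma orthonormal_card_basis: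
  assumes "finite I" "orthonormal I {..<card I} v"
  shows "orthonormal_basis I v"
proof -
  have "kernel_trace I (residual_kernel {..<card I} v) = 0" using kernel_trace_residual[OF assms(2)] by simp
  then have "residual_kernel {..<card I} v p q = 0" if "p \<in> I" "q \<in> I" for p q
    using cmod_pos_kernel_le_trace[OF assms(1) pos_kernel_residual[OF assms(1) _ assms(2)] that] by simp
  then show ?thesis using assms(2) by (simp add: orthonormal_basis_def kernel_eq_def residual_kernel_def)
qed

definition deflated_kernel :: "'i kernel \<Rightarrow> nat \<Rightarrow> (nat \<Rightarrow> 'i \<Rightarrow> complex) \<Rightarrow> (nat \<Rightarrow> real) \<Rightarrow> 'i kernel" where
  "deflated_kernel A k v a = A - dyad_kernel {..<k} a v v"

lemma kernel_app_deflated: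
  "kernel_app I (deflated_kernel A k v a) x p =
      kernel_app I A x p - (\<Sum>j<k. of_real (a j) * v j p * inner_on I (v j) x)"
  unfolding deflated_kernel_def kernel_app_dyad[symmetric]
  by (simp add: kernel_app_def left_diff_distrib sum_subtractf)

lemma herm_kernel_deflated: "herm_kernel I A \<Longrightarrow> herm_kernel I (deflated_kernel A k v a)"
  unfolding deflated_kernel_def by (rule herm_kernel_diff[OF _ herm_kernel_dyad])

lemma kernel_app_deflated_eigenfamily:
  assumes family: "eigenfamily I A k v a" and j_less: "j < k" and p_in: "p \<in> I"
  shows "kernel_app I (deflated_kernel A k v a) (v j) p = 0"
proof -
  have "(\<Sum>i<k. of_real (a i) * v i p * inner_on I (v i) (v j)) =
      (\<Sum>i<k. if i = j then of_real (a j) * v j p else 0)"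
    using family j_less by (intro sum.cong refl) (auto simp: eigenfamily_def orthonormalD)
  then show ?thesis using family j_less p_in by (simp add: kernel_app_deflated eigenfamily_def)
qed

lemma deflated_eigenvector_orthogonal:
  assumes herm: "herm_kernel I A" and family: "eigenfamily I A k v a" and j_less: "j < k"
    and eigen_u: "\<mu> \<noteq> 0" "\<And>p. p \<in> I \<Longrightarrow> kernel_app I (deflated_kernel A k v a) u p = of_real \<mu> * u p"
  shows "inner_on I (v j) u = 0"
proof -
  have "inner_on I (v j) (kernel_app I (deflated_kernel A k v a) u) = 0"
    unfolding inner_on_kernel_app[OF herm_kernel_deflated[OF herm]]
    using kernel_app_deflated_eigenfamily[OF family j_less] by (simp add: inner_on_def)
  moreover have "inner_on I (v j) (kernel_app I (deflated_kernel A k v a) u) =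
      of_real \<mu> * inner_on I (v j) u"
    using eigen_u(2) by (simp add: inner_on_scale_right cong: inner_on_cong)
  ultimately show ?thesis using eigen_u(1) by simp
qed

lemma herm_kernel_eigenvector_orthogonal:
  assumes fin: "finite I" and herm: "herm_kernel I A" and family: "eigenfamily I A k v a"
    and pq: "p \<in> I" "q \<in> I" "residual_kernel {..<k} v p q \<noteq> 0"
  obtains u \<mu> where "inner_on I u u \<noteq> 0" "\<And>j. j < k \<Longrightarrow> inner_on I (v j) u = 0"
    "\<And>p. p \<in> I \<Longrightarrow> kernel_app I A u p = of_real \<mu> * u p"
proof (cases "\<exists>p\<in>I. \<exists>q\<in>I. deflated_kernel A k v a p q \<noteq> 0")
  case True
  then obtain u \<mu> where eigen_u: "inner_on I u u \<noteq> 0" "\<mu> \<noteq> 0"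
    "\<And>p. p \<in> I \<Longrightarrow> kernel_app I (deflated_kernel A k v a) u p = of_real \<mu> * u p"
    using herm_kernel_nonzero_eigenvalue[OF fin herm_kernel_deflated[OF herm]] by metis
  then have orth: "inner_on I (v j) u = 0" if "j < k" for j
    using deflated_eigenvector_orthogonal[OF herm family that] by blast
  show ?thesis
  proof (rule that)
    show "kernel_app I A u p = of_real \<mu> * u p" if "p \<in> I" for p
      using eigen_u(3)[OF that] orth by (simp add: kernel_app_deflated)
  qed (use eigen_u(1) orth in auto)
next
  case False
  let ?w = "\<lambda>p. residual_kernel {..<k} v p q"
  have orth: "inner_on I (v j) ?w = 0" if "j < k" for j
    by (rule residual_kernel_orthogonal[OF fin _ _ pq(2)]) (use family that in \<open>auto simp: eigenfamily_def\<close>)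
  show ?thesis
  proof (rule that)
    show "inner_on I ?w ?w \<noteq> 0" using inner_on_self_eq_0_iff[OF fin, of ?w] pq(1,3) by auto
    have "kernel_app I (deflated_kernel A k v a) ?w p = 0" if "p \<in> I" for p
      using False that by (simp add: kernel_app_def)
    then show "kernel_app I A ?w p = of_real 0 * ?w p" if "p \<in> I" for p
      using orth that unfolding kernel_app_deflated by simp
  qed (use orth in auto)
qed

lemma eigenfamily_extend:
  assumes family: "eigenfamily I A k v a"
    and eigen_u: "inner_on I u u \<noteq> 0" "\<And>j. j < k \<Longrightarrow> inner_on I (v j) u = 0"
      "\<And>p. p \<in> I \<Longrightarrow> kernel_app I A u p = of_real \<mu> * u p"
  obtains w where "eigenfamily I A (Suc k) (v(k := w)) (a(k := \<mu>))"
proof -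
  obtain c where normalised: "inner_on I (\<lambda>p. of_real c * u p) (\<lambda>p. of_real c * u p) = 1"
    using inner_on_normalise[OF eigen_u(1)] .
  define w where "w = (\<lambda>p. of_real c * u p)"
  have "inner_on I w w = 1" using normalised by (simp add: w_def)
  moreover have "inner_on I (v j) w = 0" "inner_on I w (v j) = 0" if "j < k" for j
    using eigen_u(2)[OF that] cnj_inner_on[of I "v j" w] by (simp_all add: w_def inner_on_scale_right)
  moreover have "kernel_app I A w p = of_real \<mu> * w p" if "p \<in> I" for p
  proof -
    have "kernel_app I A w p = of_real c * kernel_app I A u p"
      by (simp add: kernel_app_def w_def sum_distrib_left mult_ac)
    then show ?thesis using eigen_u(3)[OF that] by (simp add: w_def)
  qed
  ultimately have "eigenfamily I A (Suc k) (v(k := w)) (a(k := \<mu>))"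
    using family by (auto simp: eigenfamily_def orthonormal_def less_Suc_eq)
  then show ?thesis using that by blast
qed

lemma herm_kernel_eigenbasis:
  assumes fin: "finite I" and herm: "herm_kernel I A"
  obtains v a where "orthonormal_basis I v" "eigenfamily I A (card I) v a"
proof -
  have "\<exists>v a. eigenfamily I A k v a" if "k \<le> card I" for k
    using that
  proof (induction k)
    case 0
    show ?case by (simp add: eigenfamily_def orthonormal_def)
  next
    case (Suc k)
    then obtain v a where family: "eigenfamily I A k v a" by auto
    then have orth: "orthonormal I {..<k} v" by (simp add: eigenfamily_def)
    have "kernel_trace I (residual_kernel {..<k} v) \<noteq> 0"
      using kernel_trace_residual[OF orth] Suc.prems by simp
    then obtain p where "p \<in> I" "residual_kernel {..<k} v p p \<noteq> 0"
      unfolding kernel_trace_def by (meson sum.neutral)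
    then obtain u \<mu> where "inner_on I u u \<noteq> 0" "\<And>j. j < k \<Longrightarrow> inner_on I (v j) u = 0"
      "\<And>p. p \<in> I \<Longrightarrow> kernel_app I A u p = of_real \<mu> * u p"
      using herm_kernel_eigenvector_orthogonal[OF fin herm family] by metis
    then show ?case using eigenfamily_extend[OF family] by metis
  qed
  then obtain v a where "eigenfamily I A (card I) v a" by blast
  then show ?thesis
    using that orthonormal_card_basis[OF fin] by (simp add: eigenfamily_def)
qed

definition spectral_decomposition :: "'i set \<Rightarrow> 'i kernel \<Rightarrow> (nat \<Rightarrow> real) \<Rightarrow> (nat \<Rightarrow> 'i \<Rightarrow> complex) \<Rightarrow> bool" where
  "spectral_decomposition I A a v \<longleftrightarrow> orthonormal_basis I v \<and> kernel_eq I A (dyad_kernel {..<card I} a v v)"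

lemma spectral_decompositionD:
  assumes "spectral_decomposition I A a v"
  shows "orthonormal I {..<card I} v" "kernel_eq I A (dyad_kernel {..<card I} a v v)"
  using assms by (simp_all add: spectral_decomposition_def orthonormal_basis_def)

lemma orthonormal_basis_kernel_expansion:
  assumes "finite I" "orthonormal_basis I v" "p \<in> I" "q \<in> I"
  shows "A p q = (\<Sum>j<card I. kernel_app I A (v j) p * cnj (v j q))"
proof -
  have "A p q = (\<Sum>r\<in>I. A p r * id_kernel r q)"
    using assms(1,4) by (simp add: id_kernel_def of_bool_def if_distrib cong: if_cong)
  also have "\<dots> = (\<Sum>r\<in>I. A p r * (\<Sum>j<card I. v j r * cnj (v j q)))"
    using assms(2,4) by (simp add: orthonormal_basis_def kernel_eq_def dyad_kernel_def)
  also have "\<dots> = (\<Sum>j<card I. kernel_app I A (v j) p * cnj (v j q))"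
    unfolding kernel_app_def sum_distrib_left sum_distrib_right by (subst sum.swap) (simp add: mult.assoc)
  finally show ?thesis .
qed

theorem herm_kernel_spectral_decomposition:
  assumes fin: "finite I" and herm: "herm_kernel I A"
  obtains a v where "spectral_decomposition I A a v"
proof -
  obtain v a where basis: "orthonormal_basis I v" and family: "eigenfamily I A (card I) v a"
    using herm_kernel_eigenbasis[OF assms] .
  have "A p q = dyad_kernel {..<card I} a v v p q" if "p \<in> I" "q \<in> I" for p q
    unfolding orthonormal_basis_kernel_expansion[OF fin basis that, of A]
    using family that by (simp add: eigenfamily_def dyad_kernel_def)
  then show ?thesis using basis by (intro that[of a v]) (simp add: spectral_decomposition_def kernel_eq_def)
qed

lemma kernel_app_cong: "kernel_eq I A B \<Longrightarrow> p \<in> I \<Longrightarrow> kernel_app I A v p = kernel_app I B v p"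
  by (simp add: kernel_app_def kernel_eq_def)

lemma spectral_decomposition_eigenvector:
  assumes "spectral_decomposition I A a v" "j < card I" "p \<in> I"
  shows "kernel_app I A (v j) p = of_real (a j) * v j p"
proof -
  note orth = spectral_decompositionD(1)[OF assms(1)] and A = spectral_decompositionD(2)[OF assms(1)]
  have "kernel_app I A (v j) p = (\<Sum>i<card I. of_real (a i) * v i p * inner_on I (v i) (v j))"
    unfolding kernel_app_cong[OF A assms(3)] by (rule kernel_app_dyad)
  also have "\<dots> = (\<Sum>i<card I. if i = j then of_real (a j) * v j p else 0)"
    using orth assms(2) by (intro sum.cong refl) (auto simp: orthonormalD)
  finally show ?thesis using assms(2) by simp
qed

lemma sform_spectral_decomposition:
  assumes "spectral_decomposition I A a v" "j < card I" "k < card I"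
  shows "sform I A (v j) (v k) = of_real (a k) * of_bool (j = k)"
proof -
  have "sform I A (v j) (v k) = of_real (a k) * inner_on I (v j) (v k)"
    unfolding sform_eq_inner_on inner_on_scale_right[symmetric]
    by (rule inner_on_cong[OF refl spectral_decomposition_eigenvector[OF assms(1,3)]])
  then show ?thesis
    using assms by (auto simp: spectral_decomposition_def orthonormal_basis_def orthonormalD)
qed

lemma spectral_decomposition_affine:
  assumes "spectral_decomposition I A a v"
  shows "spectral_decomposition I (s \<cdot>\<^sub>k A + c \<cdot>\<^sub>k id_kernel) (\<lambda>j. s * a j + c) v"
proof -
  have "(s \<cdot>\<^sub>k A + c \<cdot>\<^sub>k id_kernel) p q = dyad_kernel {..<card I} (\<lambda>j. s * a j + c) v v p q"
    if "p \<in> I" "q \<in> I" for p q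
  proof -
    have "A p q = dyad_kernel {..<card I} a v v p q"
      "id_kernel p q = dyad_kernel {..<card I} (\<lambda>_. 1) v v p q"
      using assms that by (auto simp: spectral_decomposition_def orthonormal_basis_def kernel_eq_def)
    then show ?thesis
      by (simp add: scale_kernel_def dyad_kernel_def sum_distrib_left sum.distrib algebra_simps)
  qed
  with assms show ?thesis by (simp add: spectral_decomposition_def kernel_eq_def)
qed

lemma pos_kernel_spectralI:
  "spectral_decomposition I A a v \<Longrightarrow> (\<And>j. j < card I \<Longrightarrow> 0 \<le> a j) \<Longrightarrow> pos_kernel I A"
  using pos_kernel_cong[OF pos_kernel_dyad] unfolding spectral_decomposition_def kernel_eq_def
  by (metis lessThan_iff)

lemma kernel_le_scaled_id_spectralI:
  assumes "spectral_decomposition I A a v" "\<And>j. j < card I \<Longrightarrow> a j \<le> c"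
  shows "kernel_le I A (c \<cdot>\<^sub>k id_kernel)"
proof -
  have "pos_kernel I ((-1) \<cdot>\<^sub>k A + c \<cdot>\<^sub>k id_kernel)"
    using assms(2) by (intro pos_kernel_spectralI[OF spectral_decomposition_affine[OF assms(1)]]) simp
  then show ?thesis
    unfolding kernel_le_def by (rule pos_kernel_cong) (simp add: kernel_eq_def scale_kernel_def)
qed

lemma pos_kernel_spectral_decomposition:
  assumes "finite I" "pos_kernel I A"
  obtains a v where "spectral_decomposition I A a v" "\<And>j. j < card I \<Longrightarrow> 0 \<le> a j"
proof -
  obtain a v where spec: "spectral_decomposition I A a v"
    using herm_kernel_spectral_decomposition[OF assms(1) pos_kernel_herm[OF assms]] .
  have "0 \<le> a j" if "j < card I" for j
  proof -
    have "0 \<le> sform I A (v j) (v j)" using assms(2) by (simp add: pos_kernel_def)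
    then show ?thesis using sform_spectral_decomposition[OF spec that that]
      by (simp add: complex_nonneg_iff)
  qed
  with spec show ?thesis using that by blast
qed

lemma pos_kernel_gram:
  assumes "finite I" "pos_kernel I A"
  obtains g where "kernel_eq I A (\<lambda>p q. \<Sum>k<card I. rank_one_kernel (g k) p q)"
proof -
  obtain a v where spec: "spectral_decomposition I A a v" and a_nonneg: "\<And>j. j < card I \<Longrightarrow> 0 \<le> a j"
    using pos_kernel_spectral_decomposition[OF assms] by blast
  define g where "g j p = of_real (sqrt (a j)) * v j p" for j p
  have "of_real (a j) * v j p * cnj (v j q) = rank_one_kernel (g j) p q" if "j < card I" for j p q
  proof -
    have "rank_one_kernel (g j) p q = of_real (sqrt (a j) * sqrt (a j)) * v j p * cnj (v j q)"
      unfolding g_def rank_one_kernel_def of_real_mult by simp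
    then show ?thesis using a_nonneg[OF that] by simp
  qed
  then show ?thesis
    using spec by (intro that[of g]) (simp add: spectral_decomposition_def kernel_eq_def dyad_kernel_def)
qed

lemma herm_kernel_le_max_eigenvalue:
  assumes "finite I" "I \<noteq> {}" "herm_kernel I A"
  obtains \<sigma> where "density_kernel I \<sigma>" "kernel_le I A (Re (kernel_pair I A \<sigma>) \<cdot>\<^sub>k id_kernel)"
proof -
  obtain a v where spec: "spectral_decomposition I A a v"
    using herm_kernel_spectral_decomposition[OF assms(1,3)] .
  have "0 < card I" using assms(1,2) by (simp add: card_gt_0_iff)
  then have "Max (a ` {..<card I}) \<in> a ` {..<card I}" by (intro Max_in) auto
  then obtain j where j_less: "j < card I" and max: "a j = Max (a ` {..<card I})" by auto
  define \<sigma> where "\<sigma> = rank_one_kernel (\<lambda>p. cnj (v j p))"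
  have "inner_on I (v j) (v j) = 1"
    using spec j_less by (auto simp: spectral_decomposition_def orthonormal_basis_def orthonormal_def)
  then have "density_kernel I \<sigma>"
    unfolding density_kernel_def \<sigma>_def
    by (simp add: pos_kernel_rank_one kernel_trace_def rank_one_kernel_def inner_on_def)
  moreover have "kernel_pair I A \<sigma> = of_real (a j)"
    using sform_spectral_decomposition[OF spec j_less j_less] by (simp add: \<sigma>_def kernel_pair_rank_one)
  moreover have "kernel_le I A (a j \<cdot>\<^sub>k id_kernel)"
    by (rule kernel_le_scaled_id_spectralI[OF spec]) (simp add: max)
  ultimately show ?thesis using that by simp
qed

lemma kernel_pair_nonneg:
  assumes "finite I" "pos_kernel I A" "pos_kernel I B"
  shows "0 \<le> kernel_pair I A B"
proof -
  obtain g where "kernel_eq I B (\<lambda>p q. \<Sum>k<card I. rank_one_kernel (g k) p q)"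
    using pos_kernel_gram[OF assms(1,3)] .
  then have "kernel_pair I A B = kernel_pair I A (\<lambda>p q. \<Sum>k<card I. rank_one_kernel (g k) p q)"
    by (intro kernel_pair_cong) (simp_all add: kernel_eq_def)
  also have "\<dots> = (\<Sum>k<card I. kernel_pair I A (rank_one_kernel (g k)))"
    by (rule kernel_pair_sum_right)
  finally show ?thesis
    using assms(2) by (simp add: kernel_pair_rank_one pos_kernel_def sum_nonneg)
qed

lemma kernel_pair_mono:
  assumes "finite I" "pos_kernel I A" "kernel_le I B C"
  shows "Re (kernel_pair I A B) \<le> Re (kernel_pair I A C)"
  using kernel_pair_nonneg[OF assms(1,2), of "C - B"] assms(3)
  by (simp add: kernel_le_def kernel_pair_diff_right complex_nonneg_iff)

lemma pos_kernel_pullback: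
  assumes "finite J" "pos_kernel J A" "f ` I \<subseteq> J"
  shows "pos_kernel I (\<lambda>p q. A (f p) (f q))"
proof -
  obtain g where gram_g: "kernel_eq J A (\<lambda>p q. \<Sum>k<card J. rank_one_kernel (g k) p q)"
    using pos_kernel_gram[OF assms(1,2)] .
  have "pos_kernel I (\<lambda>p q. \<Sum>k<card J. rank_one_kernel (\<lambda>p. g k (f p)) p q)"
    by (intro pos_kernel_sum pos_kernel_rank_one)
  then show ?thesis
    by (rule pos_kernel_cong) (use gram_g assms(3) in \<open>auto simp: kernel_eq_def rank_one_kernel_def
        image_subset_iff\<close>)
qed

section \<open>Kernels on product sets\<close>

definition kernel_tensor :: "'a kernel \<Rightarrow> 'b kernel \<Rightarrow> ('a \<times> 'b) kernel" where
  "kernel_tensor A B p q = A (fst p) (fst q) * B (snd p) (snd q)"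

definition swap_kernel :: "('a \<times> 'b) kernel \<Rightarrow> ('b \<times> 'a) kernel" where
  "swap_kernel A p q = A (prod.swap p) (prod.swap q)"

definition partial_trace :: "'b set \<Rightarrow> ('a \<times> 'b) kernel \<Rightarrow> 'a kernel" where
  "partial_trace S A i j = (\<Sum>a\<in>S. A (i, a) (j, a))"

definition link_kernel :: "'r set \<Rightarrow> ('r \<times> 's) kernel \<Rightarrow> ('r \<times> 't) kernel \<Rightarrow> ('s \<times> 't) kernel" where
  "link_kernel R A C p q = (\<Sum>i\<in>R. \<Sum>j\<in>R. A (i, fst p) (j, fst q) * C (i, snd p) (j, snd q))"

lemma id_kernel_prod: "id_kernel = kernel_tensor id_kernel id_kernel"
  by (intro ext) (simp add: id_kernel_def kernel_tensor_def prod_eq_iff)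

lemma swap_swap_kernel [simp]: "swap_kernel (swap_kernel A) = A"
  by (simp add: swap_kernel_def fun_eq_iff)

lemma swap_rank_one_kernel: "swap_kernel (rank_one_kernel u) = rank_one_kernel (\<lambda>p. u (prod.swap p))"
  by (simp add: swap_kernel_def rank_one_kernel_def fun_eq_iff)

lemma transpose_rank_one_kernel: "transpose_kernel (rank_one_kernel u) = rank_one_kernel (\<lambda>p. cnj (u p))"
  by (simp add: transpose_kernel_def rank_one_kernel_def fun_eq_iff mult.commute)

lemma transpose_transpose_kernel [simp]: "transpose_kernel (transpose_kernel A) = A"
  by (simp add: transpose_kernel_def fun_eq_iff)

lemma transpose_swap_kernel: "transpose_kernel (swap_kernel A) = swap_kernel (transpose_kernel A)"
  by (simp add: transpose_kernel_def swap_kernel_def fun_eq_iff)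

lemma kernel_pair_prod:
  "kernel_pair (R \<times> S) A C = (\<Sum>i\<in>R. \<Sum>j\<in>R. \<Sum>a\<in>S. \<Sum>b\<in>S. A (i, a) (j, b) * C (i, a) (j, b))"
  unfolding kernel_pair_def sum.cartesian_product' by (intro sum.cong refl sum.swap)

lemma kernel_pair_swap: "kernel_pair (S \<times> R) (swap_kernel A) (swap_kernel C) = kernel_pair (R \<times> S) A C"
  unfolding kernel_pair_prod swap_kernel_def swap_simp by (subst sum_rotate3, subst sum_rotate3) (rule refl)

lemma kernel_trace_prod: "kernel_trace (R \<times> S) A = kernel_trace R (partial_trace S A)"
  by (simp add: kernel_trace_def partial_trace_def sum.cartesian_product')

lemma kernel_trace_swap: "kernel_trace (S \<times> R) (swap_kernel A) = kernel_trace (R \<times> S) A"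
  unfolding kernel_trace_def swap_kernel_def sum.cartesian_product' swap_simp by (rule sum.swap)

lemma partial_trace_add: "partial_trace S (A + B) = partial_trace S A + partial_trace S B"
  by (simp add: partial_trace_def fun_eq_iff sum.distrib)

lemma partial_trace_diff: "partial_trace S (A - B) = partial_trace S A - partial_trace S B"
  by (simp add: partial_trace_def fun_eq_iff sum_subtractf)

lemma partial_trace_scale: "partial_trace S (c \<cdot>\<^sub>k A) = c \<cdot>\<^sub>k partial_trace S A"
  by (simp add: partial_trace_def scale_kernel_def fun_eq_iff sum_distrib_left)

lemma partial_trace_tensor_id: "partial_trace S (kernel_tensor A id_kernel) = real (card S) \<cdot>\<^sub>k A"
  by (simp add: partial_trace_def kernel_tensor_def scale_kernel_def id_kernel_def fun_eq_iff)

lemma kernel_pair_tensor_id: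
  assumes "finite S"
  shows "kernel_pair (R \<times> S) Y (kernel_tensor A id_kernel) = kernel_pair R (partial_trace S Y) A"
proof -
  have "kernel_pair (R \<times> S) Y (kernel_tensor A id_kernel) =
      (\<Sum>i\<in>R. \<Sum>j\<in>R. \<Sum>a\<in>S. \<Sum>b\<in>S. if b = a then Y (i, a) (j, a) * A i j else 0)"
    unfolding kernel_pair_prod by (intro sum.cong refl) (auto simp: kernel_tensor_def id_kernel_def)
  then show ?thesis using assms by (simp add: kernel_pair_def partial_trace_def sum_distrib_right)
qed

lemma pos_kernel_swap:
  "finite R \<Longrightarrow> finite S \<Longrightarrow> pos_kernel (R \<times> S) A \<Longrightarrow> pos_kernel (S \<times> R) (swap_kernel A)"
  unfolding swap_kernel_def[abs_def] by (rule pos_kernel_pullback[of "R \<times> S"]) auto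

lemma pos_kernel_partial_trace:
  assumes "finite R" "finite S" "pos_kernel (R \<times> S) A"
  shows "pos_kernel R (partial_trace S A)"
  unfolding partial_trace_def[abs_def]
  by (intro pos_kernel_sum pos_kernel_pullback[OF _ assms(3)]) (use assms in auto)

lemma pos_kernel_tensor:
  assumes "finite R" "finite S" "pos_kernel R A" "pos_kernel S B"
  shows "pos_kernel (R \<times> S) (kernel_tensor A B)"
proof -
  obtain g where gram_g: "kernel_eq S B (\<lambda>p q. \<Sum>k<card S. rank_one_kernel (g k) p q)"
    using pos_kernel_gram[OF assms(2,4)] .
  have "pos_kernel (R \<times> S) (\<lambda>p q. A (fst p) (fst q))"
    by (rule pos_kernel_pullback[OF assms(1,3)]) auto
  then have "pos_kernel (R \<times> S) (\<lambda>p q. \<Sum>k<card S. g k (snd p) * A (fst p) (fst q) * cnj (g k (snd q)))"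
    by (intro pos_kernel_sum pos_kernel_diag_congruence)
  then show ?thesis
    by (rule pos_kernel_cong)
      (use gram_g in \<open>auto simp: kernel_eq_def kernel_tensor_def rank_one_kernel_def sum_distrib_left
          mult_ac\<close>)
qed

lemma pos_kernel_sum_over:
  assumes "pos_kernel (R \<times> I) B"
  shows "pos_kernel I (\<lambda>p q. \<Sum>i\<in>R. \<Sum>j\<in>R. B (i, p) (j, q))"
proof -
  have "sform I (\<lambda>p q. \<Sum>i\<in>R. \<Sum>j\<in>R. B (i, p) (j, q)) v v = sform (R \<times> I) B (\<lambda>x. v (snd x)) (\<lambda>x. v (snd x))"
    for v
  proof -
    have "sform (R \<times> I) B (\<lambda>x. v (snd x)) (\<lambda>x. v (snd x)) =
        (\<Sum>i\<in>R. \<Sum>j\<in>R. \<Sum>p\<in>I. \<Sum>q\<in>I. cnj (v p) * B (i, p) (j, q) * v q)"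
      unfolding sform_def sum.cartesian_product' fst_conv snd_conv by (intro sum.cong refl sum.swap)
    also have "\<dots> = (\<Sum>p\<in>I. \<Sum>q\<in>I. \<Sum>i\<in>R. \<Sum>j\<in>R. cnj (v p) * B (i, p) (j, q) * v q)"
      by (subst sum_rotate3, subst sum_rotate3) (rule refl)
    finally show ?thesis by (simp add: sform_def sum_distrib_left sum_distrib_right)
  qed
  with assms show ?thesis by (simp add: pos_kernel_def)
qed

text \<open>\<open>A (i, s) (j, s') * C (i, t) (j, t')\<close> is the restriction of \<open>A \<otimes> C\<close> to a diagonal.\<close>

lemma pos_kernel_link:
  assumes "finite R" "finite S" "finite T" "pos_kernel (R \<times> S) A" "pos_kernel (R \<times> T) C"
  shows "pos_kernel (S \<times> T) (link_kernel R A C)"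
proof -
  have "pos_kernel ((R \<times> S) \<times> (R \<times> T)) (kernel_tensor A C)"
    using assms by (intro pos_kernel_tensor) auto
  then have "pos_kernel (R \<times> (S \<times> T)) (\<lambda>p q. kernel_tensor A C ((fst p, fst (snd p)), (fst p, snd (snd p)))
      ((fst q, fst (snd q)), (fst q, snd (snd q))))"
    by (rule pos_kernel_pullback[rotated]) (use assms in auto)
  from pos_kernel_sum_over[OF this] show ?thesis
    by (simp add: link_kernel_def[abs_def] kernel_tensor_def)
qed

lemma swap_link_kernel: "swap_kernel (link_kernel R A C) = link_kernel R C A"
  by (simp add: swap_kernel_def link_kernel_def fun_eq_iff mult.commute)

lemma link_kernel_cong:
  "kernel_eq (R \<times> S) A A' \<Longrightarrow> kernel_eq (R \<times> T) C C' \<Longrightarrow>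
      kernel_eq (S \<times> T) (link_kernel R A C) (link_kernel R A' C')"
  by (auto simp: kernel_eq_def link_kernel_def intro!: sum.cong)

lemma link_kernel_diff_left: "link_kernel R (A - B) C = link_kernel R A C - link_kernel R B C"
  by (simp add: link_kernel_def fun_eq_iff left_diff_distrib sum_subtractf)

lemma link_kernel_scale_right: "link_kernel R A (c \<cdot>\<^sub>k C) = c \<cdot>\<^sub>k link_kernel R A C"
  by (simp add: link_kernel_def scale_kernel_def fun_eq_iff sum_distrib_left mult_ac)

lemma link_kernel_sum_right:
  "link_kernel R A (\<lambda>p q. \<Sum>k\<in>K. C k p q) = (\<lambda>p q. \<Sum>k\<in>K. link_kernel R A (C k) p q)"
  unfolding link_kernel_def sum_distrib_left by (intro ext sum_rotate3)

lemma kernel_pair_link: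
  "kernel_pair (S \<times> T) (link_kernel R A C) F = kernel_pair (R \<times> T) C (link_kernel S (swap_kernel A) F)"
proof -
  let ?f = "\<lambda>i j s s' t t'. A (i, s) (j, s') * C (i, t) (j, t') * F (s, t) (s', t')"
  have "kernel_pair (S \<times> T) (link_kernel R A C) F =
      (\<Sum>s\<in>S. \<Sum>s'\<in>S. \<Sum>t\<in>T. \<Sum>t'\<in>T. \<Sum>i\<in>R. \<Sum>j\<in>R. ?f i j s s' t t')"
    unfolding kernel_pair_prod link_kernel_def by (simp add: sum_distrib_right)
  also have "\<dots> = (\<Sum>t\<in>T. \<Sum>t'\<in>T. \<Sum>i\<in>R. \<Sum>j\<in>R. \<Sum>s\<in>S. \<Sum>s'\<in>S. ?f i j s s' t t')"
    by (subst sum_rotate3, subst sum_rotate3, intro sum.cong refl, subst sum_rotate3, subst sum_rotate3)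
      (rule refl)
  also have "\<dots> = (\<Sum>i\<in>R. \<Sum>j\<in>R. \<Sum>t\<in>T. \<Sum>t'\<in>T. \<Sum>s\<in>S. \<Sum>s'\<in>S. ?f i j s s' t t')"
    by (subst sum_rotate3, subst sum_rotate3) (rule refl)
  also have "\<dots> = kernel_pair (R \<times> T) C (link_kernel S (swap_kernel A) F)"
    unfolding kernel_pair_prod link_kernel_def by (simp add: sum_distrib_left swap_kernel_def mult_ac)
  finally show ?thesis .
qed

section \<open>Separation from the positive cone\<close>

definition hs_inner :: "'i set \<Rightarrow> 'i kernel \<Rightarrow> 'i kernel \<Rightarrow> real" where
  "hs_inner I A B = Re (kernel_pair I (transpose_kernel A) B)"

definition negative_part :: "'i set \<Rightarrow> 'i kernel \<Rightarrow> 'i kernel \<Rightarrow> bool" where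
  "negative_part I A N \<longleftrightarrow> pos_kernel I N \<and> pos_kernel I (A + N) \<and> hs_inner I N (A + N) = 0"

definition convex_kernels :: "'i kernel set \<Rightarrow> bool" where
  "convex_kernels C \<longleftrightarrow> (\<forall>x\<in>C. \<forall>y\<in>C. \<forall>t. 0 \<le> t \<longrightarrow> t \<le> 1 \<longrightarrow> (1 - t) \<cdot>\<^sub>k x + t \<cdot>\<^sub>k y \<in> C)"

lemma hs_inner_commute: "hs_inner I A B = hs_inner I B A"
  unfolding hs_inner_def by (metis kernel_pair_commute kernel_pair_transpose transpose_transpose_kernel)

lemma hs_inner_add_right: "hs_inner I A (B + C) = hs_inner I A B + hs_inner I A C"
  by (simp add: hs_inner_def kernel_pair_add_right)

lemma hs_inner_diff_right: "hs_inner I A (B - C) = hs_inner I A B - hs_inner I A C"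
  by (simp add: hs_inner_def kernel_pair_diff_right)

lemma hs_inner_scale_right: "hs_inner I A (c \<cdot>\<^sub>k B) = c * hs_inner I A B"
  by (simp add: hs_inner_def kernel_pair_scale_right)

lemma hs_inner_diff_self:
  "hs_inner I (A - B) (A - B) = hs_inner I A A - 2 * hs_inner I A B + hs_inner I B B"
  unfolding hs_inner_diff_right hs_inner_commute[of I "A - B"] by (simp add: hs_inner_commute[of I B A])

lemma hs_inner_self:
  assumes "herm_kernel I A"
  shows "hs_inner I A A = (\<Sum>p\<in>I. \<Sum>q\<in>I. (cmod (A p q))\<^sup>2)"
proof -
  have "kernel_pair I (transpose_kernel A) A = (\<Sum>p\<in>I. \<Sum>q\<in>I. A p q * cnj (A p q))"
    using assms by (simp add: kernel_pair_def transpose_kernel_def herm_kernel_def mult.commute)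
  then have "kernel_pair I (transpose_kernel A) A = of_real (\<Sum>p\<in>I. \<Sum>q\<in>I. (cmod (A p q))\<^sup>2)"
    by (simp only: of_real_sum complex_norm_square)
  then show ?thesis by (simp add: hs_inner_def)
qed

lemma hs_inner_self_nonneg: "herm_kernel I A \<Longrightarrow> 0 \<le> hs_inner I A A"
  by (simp add: hs_inner_self sum_nonneg)

lemma hs_inner_self_le_of_bounded:
  assumes "herm_kernel I A" "\<And>p q. p \<in> I \<Longrightarrow> q \<in> I \<Longrightarrow> cmod (A p q) \<le> K"
  shows "hs_inner I A A \<le> (\<Sum>p\<in>I. \<Sum>q\<in>I. K\<^sup>2)"
  unfolding hs_inner_self[OF assms(1)] by (intro sum_mono power_mono assms(2)) auto

lemma hs_inner_pos_kernel_nonneg: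
  "finite I \<Longrightarrow> pos_kernel I A \<Longrightarrow> pos_kernel I B \<Longrightarrow> 0 \<le> hs_inner I A B"
  using kernel_pair_nonneg[OF _ pos_kernel_transpose, of I A B]
  by (simp add: hs_inner_def complex_nonneg_iff)

lemma hs_inner_cong: "kernel_eq I A A' \<Longrightarrow> kernel_eq I B B' \<Longrightarrow> hs_inner I A B = hs_inner I A' B'"
  by (simp add: hs_inner_def kernel_pair_def transpose_kernel_def kernel_eq_def)

lemma hs_inner_dyad:
  assumes "finite J" "orthonormal I J v"
  shows "hs_inner I (dyad_kernel J a v v) (dyad_kernel J b v v) = (\<Sum>j\<in>J. a j * b j)"
  unfolding hs_inner_def kernel_pair_transpose_left
  by (simp add: kernel_mult_dyad[OF assms] kernel_trace_dyad_orthonormal[OF assms(2)] mult.commute)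

lemma herm_kernel_le_hs_norm:
  assumes "finite I" "herm_kernel I A" "0 \<le> c" "hs_inner I A A \<le> c\<^sup>2"
  shows "kernel_le I A (c \<cdot>\<^sub>k id_kernel)"
proof -
  obtain a v where spec: "spectral_decomposition I A a v"
    using herm_kernel_spectral_decomposition[OF assms(1,2)] .
  note orth = spectral_decompositionD(1)[OF spec] and A = spectral_decompositionD(2)[OF spec]
  show ?thesis
  proof (rule kernel_le_scaled_id_spectralI[OF spec])
    fix j assume "j < card I"
    then have "(a j)\<^sup>2 \<le> (\<Sum>j<card I. (a j)\<^sup>2)" by (intro member_le_sum) auto
    also have "\<dots> = hs_inner I A A"
      by (simp add: hs_inner_cong[OF A A] hs_inner_dyad[OF _ orth] power2_eq_square)
    also have "\<dots> \<le> c\<^sup>2" by (rule assms(4))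
    finally show "a j \<le> c" using assms(3) by (rule power2_le_imp_le)
  qed
qed

lemma herm_kernel_negative_part:
  assumes "finite I" "herm_kernel I A"
  obtains N where "negative_part I A N"
proof -
  obtain a v where spec: "spectral_decomposition I A a v"
    using herm_kernel_spectral_decomposition[OF assms] .
  note orth = spectral_decompositionD(1)[OF spec] and A = spectral_decompositionD(2)[OF spec]
  define neg where "neg j = max 0 (- a j)" for j
  define N where "N = dyad_kernel {..<card I} neg v v"
  let ?P = "dyad_kernel {..<card I} (\<lambda>j. a j + neg j) v v"
  have P_eq: "kernel_eq I ?P (A + N)"
    using A by (simp add: kernel_eq_def N_def dyad_kernel_def sum.distrib distrib_right)
  have "negative_part I A N"
    unfolding negative_part_def
  proof (intro conjI)
    show "pos_kernel I N" unfolding N_def by (rule pos_kernel_dyad) (simp add: neg_def)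
    show "pos_kernel I (A + N)"
      by (rule pos_kernel_cong[OF pos_kernel_dyad P_eq]) (simp add: neg_def)
    have "hs_inner I N (A + N) = hs_inner I N ?P"
      using P_eq by (intro hs_inner_cong) (simp_all add: kernel_eq_def)
    also have "\<dots> = (\<Sum>j<card I. neg j * (a j + neg j))"
      unfolding N_def by (rule hs_inner_dyad[OF _ orth]) simp
    also have "\<dots> = 0" by (intro sum.neutral) (auto simp: neg_def max_def)
    finally show "hs_inner I N (A + N) = 0" .
  qed
  then show ?thesis by (rule that)
qed

lemma pos_kernel_add_scaled_id:
  assumes "finite I" "negative_part I A N" "0 \<le> c" "hs_inner I N N \<le> c\<^sup>2"
  shows "pos_kernel I (A + c \<cdot>\<^sub>k id_kernel)"
proof -
  have N_parts: "pos_kernel I N" "pos_kernel I (A + N)" using assms(2) by (auto simp: negative_part_def)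
  have "pos_kernel I (c \<cdot>\<^sub>k id_kernel - N)"
    using herm_kernel_le_hs_norm[OF assms(1) pos_kernel_herm[OF assms(1) N_parts(1)] assms(3,4)]
    by (simp add: kernel_le_def)
  from pos_kernel_add[OF N_parts(2) this] show ?thesis by (simp add: algebra_simps)
qed

text \<open>\<open>A + N\<close> is the projection of \<open>A\<close> to the positive cone.\<close>

lemma hs_inner_negative_part_le:
  assumes "finite I" "herm_kernel I A" "negative_part I A N" "pos_kernel I P"
  shows "hs_inner I N N \<le> hs_inner I (A - P) (A - P)"
proof -
  have N_parts: "pos_kernel I N" "pos_kernel I (A + N)" "hs_inner I N (A + N) = 0"
    using assms(3) by (auto simp: negative_part_def)
  define Q where "Q = A + N - P"
  have "A - P = Q - N" by (simp add: Q_def)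
  then have "hs_inner I (A - P) (A - P) = hs_inner I Q Q - 2 * hs_inner I N Q + hs_inner I N N"
    by (simp only: hs_inner_diff_self hs_inner_commute[of I Q N])
  moreover have "hs_inner I N Q \<le> 0"
    using hs_inner_pos_kernel_nonneg[OF assms(1) N_parts(1) assms(4)] N_parts(3)
    by (simp add: Q_def hs_inner_diff_right)
  moreover have "0 \<le> hs_inner I Q Q"
    unfolding Q_def by (intro hs_inner_self_nonneg herm_kernel_diff pos_kernel_herm assms N_parts)
  ultimately show ?thesis by simp
qed

lemma hs_inner_negative_part_segment:
  assumes "finite I" "herm_kernel I x" "herm_kernel I y" "negative_part I x N"
    and "\<And>M. negative_part I ((1 - t) \<cdot>\<^sub>k x + t \<cdot>\<^sub>k y) M \<Longrightarrow> \<mu> \<le> hs_inner I M M"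
  shows "2 * t * hs_inner I N (y - x) \<le> hs_inner I N N - \<mu> + t\<^sup>2 * hs_inner I (y - x) (y - x)"
proof -
  let ?z = "(1 - t) \<cdot>\<^sub>k x + t \<cdot>\<^sub>k y"
  have herm: "herm_kernel I ?z" by (intro herm_kernel_add herm_kernel_scale assms)
  obtain M where neg_part_M: "negative_part I ?z M" using herm_kernel_negative_part[OF assms(1) herm] .
  have "\<mu> \<le> hs_inner I M M" using assms(5)[OF neg_part_M] .
  also have "\<dots> \<le> hs_inner I (?z - (x + N)) (?z - (x + N))"
    using assms(4)
    by (intro hs_inner_negative_part_le[OF assms(1) herm neg_part_M]) (simp add: negative_part_def)
  also have "?z - (x + N) = t \<cdot>\<^sub>k (y - x) - N"
    by (simp add: fun_eq_iff scale_kernel_def algebra_simps)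
  finally show ?thesis
    unfolding hs_inner_diff_self hs_inner_scale_right hs_inner_commute[of I "t \<cdot>\<^sub>k (y - x)"]
    by (simp add: power2_eq_square)
qed

definition cone_gap :: "'i set \<Rightarrow> 'i kernel set \<Rightarrow> real" where
  "cone_gap I C = Inf {hs_inner I N N | x N. x \<in> C \<and> negative_part I x N}"

lemma cone_gap_le:
  assumes "finite I" "x \<in> C" "negative_part I x N"
  shows "cone_gap I C \<le> hs_inner I N N"
  unfolding cone_gap_def
proof (rule cInf_lower)
  show "bdd_below {hs_inner I N N | x N. x \<in> C \<and> negative_part I x N}"
    using hs_inner_pos_kernel_nonneg[OF assms(1)]
    by (intro bdd_belowI[of _ 0]) (auto simp: negative_part_def)
qed (use assms in blast)

lemma negative_parts_nonempty:
  assumes "finite I" "C \<noteq> {}" "\<And>x. x \<in> C \<Longrightarrow> herm_kernel I x"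
  shows "{hs_inner I N N | x N. x \<in> C \<and> negative_part I x N} \<noteq> {}"
proof -
  obtain x where x_in: "x \<in> C" using assms(2) by blast
  obtain N where "negative_part I x N" using herm_kernel_negative_part[OF assms(1) assms(3)[OF x_in]] .
  with x_in show ?thesis by blast
qed

lemma le_cone_gap:
  assumes "finite I" "C \<noteq> {}" "\<And>x. x \<in> C \<Longrightarrow> herm_kernel I x"
    and "\<And>x N. x \<in> C \<Longrightarrow> negative_part I x N \<Longrightarrow> \<nu> \<le> hs_inner I N N"
  shows "\<nu> \<le> cone_gap I C"
  unfolding cone_gap_def
  by (rule cInf_greatest[OF negative_parts_nonempty[OF assms(1-3)]]) (use assms(4) in auto)

lemma cone_gap_approx:
  assumes "finite I" "C \<noteq> {}" "\<And>x. x \<in> C \<Longrightarrow> herm_kernel I x" "cone_gap I C < b"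
  obtains x N where "x \<in> C" "negative_part I x N" "hs_inner I N N < b"
proof -
  have "\<exists>s\<in>{hs_inner I N N | x N. x \<in> C \<and> negative_part I x N}. s < b"
    by (rule cInf_lessD[OF negative_parts_nonempty[OF assms(1-3)] assms(4)[unfolded cone_gap_def]])
  then show ?thesis using that by auto
qed

lemma convex_kernels_negative_part_separation:
  assumes fin: "finite I" and convex: "convex_kernels C" and ne: "C \<noteq> {}"
    and herm: "\<And>x. x \<in> C \<Longrightarrow> herm_kernel I x"
    and bounded: "\<And>x p q. x \<in> C \<Longrightarrow> p \<in> I \<Longrightarrow> q \<in> I \<Longrightarrow> cmod (x p q) \<le> K"
    and gap: "0 < cone_gap I C"
  obtains N where "pos_kernel I N" "\<And>x. x \<in> C \<Longrightarrow> hs_inner I N x \<le> - cone_gap I C / 2"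
proof -
  define \<mu> where "\<mu> = cone_gap I C"
  define B where "B = (\<Sum>p\<in>I. \<Sum>q\<in>I. (2 * K)\<^sup>2)"
  define t where "t = \<mu> / (2 * B + \<mu>)"
  have \<mu>_pos: "0 < \<mu>" using gap by (simp add: \<mu>_def)
  have "0 \<le> B" by (simp add: B_def sum_nonneg)
  then have t_bounds: "0 < t" "t \<le> 1" "t * B \<le> \<mu> / 2" using \<mu>_pos by (auto simp: t_def field_simps)
  have "cone_gap I C < \<mu> + t * \<mu> / 2" using t_bounds(1) \<mu>_pos by (simp add: \<mu>_def)
  then obtain x N where x_in: "x \<in> C" and neg_part_N: "negative_part I x N"
    and near: "hs_inner I N N < \<mu> + t * \<mu> / 2"
    using cone_gap_approx[OF fin ne herm] by blast
  have "hs_inner I N y \<le> - \<mu> / 2" if y_in: "y \<in> C" for y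
  proof -
    have "(1 - t) \<cdot>\<^sub>k x + t \<cdot>\<^sub>k y \<in> C" using convex x_in y_in t_bounds by (simp add: convex_kernels_def)
    then have "2 * t * hs_inner I N (y - x) \<le> hs_inner I N N - \<mu> + t\<^sup>2 * hs_inner I (y - x) (y - x)"
      unfolding \<mu>_def
      by (intro hs_inner_negative_part_segment[OF fin herm[OF x_in] herm[OF y_in] neg_part_N]
          cone_gap_le[OF fin])
    also have "\<dots> \<le> t * \<mu> / 2 + t\<^sup>2 * B"
    proof (intro add_mono mult_left_mono)
      have "cmod ((y - x) p q) \<le> 2 * K" if "p \<in> I" "q \<in> I" for p q
        using bounded[OF x_in that] bounded[OF y_in that] norm_triangle_ineq4[of "y p q" "x p q"] by simp
      then show "hs_inner I (y - x) (y - x) \<le> B"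
        unfolding B_def
        by (rule hs_inner_self_le_of_bounded[OF herm_kernel_diff[OF herm[OF y_in] herm[OF x_in]]])
    qed (use near in auto)
    also have "\<dots> = t * (\<mu> / 2 + t * B)" by (simp add: power2_eq_square algebra_simps)
    also have "\<dots> \<le> t * \<mu>" using t_bounds by (intro mult_left_mono) auto
    finally have "2 * hs_inner I N (y - x) \<le> \<mu>" using t_bounds(1) by simp
    moreover have "hs_inner I N x = - hs_inner I N N"
      using neg_part_N by (simp add: negative_part_def hs_inner_add_right)
    ultimately show ?thesis
      using cone_gap_le[OF fin x_in neg_part_N] by (simp add: hs_inner_diff_right \<mu>_def)
  qed
  then show ?thesis using that neg_part_N by (auto simp: negative_part_def \<mu>_def)
qed

text \<open>Strict separation needs no closedness, because the first alternative asks for positivity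
  only up to an arbitrarily small multiple of the identity.\<close>

theorem convex_kernels_positive_or_separated:
  assumes fin: "finite I" and convex: "convex_kernels C" and ne: "C \<noteq> {}"
    and herm: "\<forall>x\<in>C. herm_kernel I x" and bounded: "\<forall>x\<in>C. \<forall>p\<in>I. \<forall>q\<in>I. cmod (x p q) \<le> K"
    and "0 < \<eta>"
  obtains (positive) x where "x \<in> C" "pos_kernel I (x + \<eta> \<cdot>\<^sub>k id_kernel)"
    | (separated) Y m where "density_kernel I Y" "0 < m" "\<And>x. x \<in> C \<Longrightarrow> Re (kernel_pair I Y x) \<le> - m"
proof (cases "\<exists>x\<in>C. pos_kernel I (x + \<eta> \<cdot>\<^sub>k id_kernel)")
  case True
  then show ?thesis using positive by blast
next
  case False
  have "\<eta>\<^sup>2 \<le> hs_inner I N N" if "x \<in> C" "negative_part I x N" for x N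
    using pos_kernel_add_scaled_id[OF fin that(2), of \<eta>] False that(1) \<open>0 < \<eta>\<close> by fastforce
  then have "\<eta>\<^sup>2 \<le> cone_gap I C" using herm by (intro le_cone_gap fin ne) auto
  then have gap: "0 < cone_gap I C" using \<open>0 < \<eta>\<close> by (smt (verit) zero_less_power)
  obtain N where pos_N: "pos_kernel I N" and N_separates: "\<And>x. x \<in> C \<Longrightarrow> hs_inner I N x \<le> - cone_gap I C / 2"
    by (rule convex_kernels_negative_part_separation[OF fin convex ne _ _ gap, of K])
      (use herm bounded in auto)
  define Z where "Z = transpose_kernel N"
  define \<tau> where "\<tau> = Re (kernel_trace I Z)"
  have pos_Z: "pos_kernel I Z" unfolding Z_def by (rule pos_kernel_transpose[OF pos_N])
  obtain x where "x \<in> C" using ne by blast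
  then have "kernel_pair I Z x \<noteq> 0" using N_separates[of x] gap by (auto simp: hs_inner_def Z_def)
  then have \<tau>_pos: "0 < \<tau>" unfolding \<tau>_def by (rule pos_kernel_trace_pos[OF fin pos_Z])
  show ?thesis
  proof (rule separated)
    show "density_kernel I ((1 / \<tau>) \<cdot>\<^sub>k Z)"
      using \<tau>_pos pos_kernel_trace_real[OF fin pos_Z, folded \<tau>_def] pos_kernel_scale[OF pos_Z, of "1 / \<tau>"]
      by (simp add: density_kernel_def kernel_trace_scale)
    show "0 < cone_gap I C / 2 / \<tau>" using \<tau>_pos gap by simp
    show "Re (kernel_pair I ((1 / \<tau>) \<cdot>\<^sub>k Z) x) \<le> - (cone_gap I C / 2 / \<tau>)" if "x \<in> C" for x
      using divide_right_mono[OF N_separates[OF that], of \<tau>] \<tau>_pos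
      by (simp add: kernel_pair_scale_left hs_inner_def Z_def)
  qed
qed

section \<open>Choi kernels of channels\<close>

definition scaled_channel_kernel :: "real \<Rightarrow> 'a set \<Rightarrow> 'b set \<Rightarrow> ('a \<times> 'b) kernel \<Rightarrow> bool" where
  "scaled_channel_kernel t R N c \<longleftrightarrow> pos_kernel (R \<times> N) c \<and> kernel_eq R (partial_trace N c) (t \<cdot>\<^sub>k id_kernel)"

abbreviation channel_kernel :: "'a set \<Rightarrow> 'b set \<Rightarrow> ('a \<times> 'b) kernel \<Rightarrow> bool" where
  "channel_kernel \<equiv> scaled_channel_kernel 1"

text \<open>Composition is written in diagrammatic order: \<open>c\<close> is applied before \<open>d\<close>.\<close>

definition choi_comp :: "'b set \<Rightarrow> ('a \<times> 'b) kernel \<Rightarrow> ('b \<times> 'c) kernel \<Rightarrow> ('a \<times> 'c) kernel" where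
  "choi_comp M c d = link_kernel M (swap_kernel c) d"

definition choi_id :: "('a \<times> 'a) kernel" where
  "choi_id = rank_one_kernel (\<lambda>p. of_bool (fst p = snd p))"

lemma swap_choi_comp: "swap_kernel (choi_comp M c d) = choi_comp M (swap_kernel d) (swap_kernel c)"
  by (simp add: choi_comp_def swap_link_kernel)

lemma choi_comp_cong:
  assumes "kernel_eq (R \<times> M) c c'" "kernel_eq (M \<times> N) d d'"
  shows "kernel_eq (R \<times> N) (choi_comp M c d) (choi_comp M c' d')"
  unfolding choi_comp_def
  by (rule link_kernel_cong[OF _ assms(2)]) (use assms(1) in \<open>auto simp: kernel_eq_def swap_kernel_def\<close>)

lemma choi_comp_add_left: "choi_comp M (c + c') d = choi_comp M c d + choi_comp M c' d"
  by (simp add: choi_comp_def link_kernel_def swap_kernel_def fun_eq_iff distrib_right sum.distrib)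

lemma choi_comp_scale_left: "choi_comp M (t \<cdot>\<^sub>k c) d = t \<cdot>\<^sub>k choi_comp M c d"
  by (simp add: choi_comp_def link_kernel_def swap_kernel_def scale_kernel_def fun_eq_iff sum_distrib_left
      mult.assoc)

lemma choi_comp_scale_right: "choi_comp M c (t \<cdot>\<^sub>k d) = t \<cdot>\<^sub>k choi_comp M c d"
  by (simp add: choi_comp_def link_kernel_scale_right)

lemma choi_comp_rank_one:
  "choi_comp M (rank_one_kernel u) (rank_one_kernel v) =
      rank_one_kernel (\<lambda>p. \<Sum>m\<in>M. u (fst p, m) * v (m, snd p))"
  by (simp add: choi_comp_def link_kernel_def swap_kernel_def rank_one_kernel_def fun_eq_iff sum_product
      mult_ac)

lemma choi_comp_assoc: "choi_comp M c (choi_comp M' d e) = choi_comp M' (choi_comp M c d) e"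
proof (intro ext)
  fix p q
  have "choi_comp M c (choi_comp M' d e) p q = (\<Sum>x\<in>M. \<Sum>y\<in>M. \<Sum>u\<in>M'. \<Sum>v\<in>M'.
      c (fst p, x) (fst q, y) * d (x, u) (y, v) * e (u, snd p) (v, snd q))"
    by (simp add: choi_comp_def link_kernel_def swap_kernel_def sum_distrib_left mult.assoc)
  also have "\<dots> = (\<Sum>u\<in>M'. \<Sum>v\<in>M'. \<Sum>x\<in>M. \<Sum>y\<in>M.
      c (fst p, x) (fst q, y) * d (x, u) (y, v) * e (u, snd p) (v, snd q))"
    by (subst sum_rotate3, subst sum_rotate3) (rule refl)
  also have "\<dots> = choi_comp M' (choi_comp M c d) e p q"
    by (simp add: choi_comp_def link_kernel_def swap_kernel_def sum_distrib_right)
  finally show "choi_comp M c (choi_comp M' d e) p q = choi_comp M' (choi_comp M c d) e p q" .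
qed

lemma kernel_pair_choi_comp_left:
  "kernel_pair (R \<times> N) (choi_comp M C d) F = kernel_pair (R \<times> M) C (choi_comp N F (swap_kernel d))"
proof -
  have "kernel_pair (R \<times> N) (choi_comp M C d) F =
      kernel_pair (N \<times> R) (link_kernel M d (swap_kernel C)) (swap_kernel F)"
    unfolding choi_comp_def swap_link_kernel[symmetric, of M d] by (rule kernel_pair_swap[symmetric])
  also have "\<dots> = kernel_pair (M \<times> R) (swap_kernel C) (link_kernel N (swap_kernel d) (swap_kernel F))"
    by (rule kernel_pair_link)
  also have "link_kernel N (swap_kernel d) (swap_kernel F) = swap_kernel (choi_comp N F (swap_kernel d))"
    by (simp add: choi_comp_def swap_link_kernel)
  also have "kernel_pair (M \<times> R) (swap_kernel C) \<dots> = kernel_pair (R \<times> M) C (choi_comp N F (swap_kernel d))"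
    by (rule kernel_pair_swap)
  finally show ?thesis .
qed

lemma choi_comp_id_left:
  assumes "finite M"
  shows "kernel_eq (M \<times> N) (choi_comp M choi_id d) d"
proof (rule kernel_eqI)
  fix p q assume "p \<in> M \<times> N" "q \<in> M \<times> N"
  then have "fst p \<in> M" "fst q \<in> M" by auto
  have "choi_comp M choi_id d p q =
      (\<Sum>x\<in>M. \<Sum>y\<in>M. if y = fst q then if x = fst p then d p q else 0 else 0)"
    unfolding choi_comp_def link_kernel_def swap_kernel_def choi_id_def rank_one_kernel_def
    by (intro sum.cong refl) auto
  then show "choi_comp M choi_id d p q = d p q"
    using assms \<open>fst p \<in> M\<close> \<open>fst q \<in> M\<close> by simp
qed

lemma swap_choi_id: "swap_kernel choi_id = choi_id"
  by (simp add: swap_kernel_def choi_id_def rank_one_kernel_def fun_eq_iff eq_commute)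

lemma choi_comp_id_right:
  assumes "finite M"
  shows "kernel_eq (R \<times> M) (choi_comp M c choi_id) c"
proof -
  have "kernel_eq (M \<times> R) (swap_kernel (choi_comp M c choi_id)) (swap_kernel c)"
    unfolding swap_choi_comp swap_choi_id by (rule choi_comp_id_left[OF assms])
  then show ?thesis by (auto simp: kernel_eq_def swap_kernel_def)
qed

lemma choi_comp_id_kernel:
  assumes "finite N"
  shows "choi_comp N c id_kernel = kernel_tensor (partial_trace N c) id_kernel"
proof (intro ext)
  fix p q
  have "choi_comp N c id_kernel p q =
      (\<Sum>x\<in>N. \<Sum>y\<in>N. if y = x then c (fst p, x) (fst q, x) * id_kernel (snd p) (snd q) else 0)"
    unfolding choi_comp_def link_kernel_def swap_kernel_def id_kernel_def by (intro sum.cong refl) auto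
  then show "choi_comp N c id_kernel p q = kernel_tensor (partial_trace N c) id_kernel p q"
    using assms by (simp add: kernel_tensor_def partial_trace_def sum_distrib_right)
qed

lemma pos_kernel_choi_comp:
  "finite R \<Longrightarrow> finite M \<Longrightarrow> finite N \<Longrightarrow> pos_kernel (R \<times> M) c \<Longrightarrow> pos_kernel (M \<times> N) d \<Longrightarrow>
    pos_kernel (R \<times> N) (choi_comp M c d)"
  unfolding choi_comp_def by (intro pos_kernel_link pos_kernel_swap)

lemma scaled_channel_kernelD:
  assumes "scaled_channel_kernel t R N c"
  shows "pos_kernel (R \<times> N) c" "kernel_eq R (partial_trace N c) (t \<cdot>\<^sub>k id_kernel)"
  using assms by (simp_all add: scaled_channel_kernel_def)

lemma scaled_channel_kernel_herm:
  "finite R \<Longrightarrow> finite N \<Longrightarrow> scaled_channel_kernel t R N c \<Longrightarrow> herm_kernel (R \<times> N) c"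
  by (intro pos_kernel_herm) (auto simp: scaled_channel_kernel_def)

lemma scaled_channel_kernel_add:
  "scaled_channel_kernel s R N c \<Longrightarrow> scaled_channel_kernel t R N d \<Longrightarrow>
      scaled_channel_kernel (s + t) R N (c + d)"
  by (auto simp: scaled_channel_kernel_def partial_trace_add kernel_eq_def scale_kernel_def distrib_right
      intro: pos_kernel_add)

lemma scaled_channel_kernel_scale:
  "scaled_channel_kernel t R N c \<Longrightarrow> 0 \<le> s \<Longrightarrow> scaled_channel_kernel (s * t) R N (s \<cdot>\<^sub>k c)"
  by (auto simp: scaled_channel_kernel_def partial_trace_scale kernel_eq_def scale_kernel_def[of t]
      scale_kernel_def[of s "partial_trace _ _"] scale_kernel_def[of "s * t"] intro: pos_kernel_scale)

lemma scaled_channel_kernel_sum: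
  assumes "\<And>k. k \<in> K \<Longrightarrow> pos_kernel (R \<times> N) (c k)"
    "\<And>i j. i \<in> R \<Longrightarrow> j \<in> R \<Longrightarrow> (\<Sum>k\<in>K. partial_trace N (c k) i j) = (t \<cdot>\<^sub>k id_kernel) i j"
  shows "scaled_channel_kernel t R N (\<lambda>p q. \<Sum>k\<in>K. c k p q)"
  unfolding scaled_channel_kernel_def
proof
  show "pos_kernel (R \<times> N) (\<lambda>p q. \<Sum>k\<in>K. c k p q)" using assms(1) by (rule pos_kernel_sum)
  have "partial_trace N (\<lambda>p q. \<Sum>k\<in>K. c k p q) i j = (\<Sum>k\<in>K. partial_trace N (c k) i j)" for i j
    unfolding partial_trace_def by (rule sum.swap)
  then show "kernel_eq R (partial_trace N (\<lambda>p q. \<Sum>k\<in>K. c k p q)) (t \<cdot>\<^sub>k id_kernel)"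
    using assms(2) by (simp add: kernel_eq_def)
qed

lemma scaled_channel_kernel_id: "finite R \<Longrightarrow> finite N \<Longrightarrow> scaled_channel_kernel (card N) R N id_kernel"
  using pos_kernel_id[of "R \<times> N"]
  by (simp add: scaled_channel_kernel_def kernel_eq_def partial_trace_def id_kernel_def scale_kernel_def)

lemma depolarising_channel_kernel:
  assumes "finite R" "finite N" "N \<noteq> {}"
  shows "channel_kernel R N ((1 / card N) \<cdot>\<^sub>k id_kernel)"
  using scaled_channel_kernel_scale[OF scaled_channel_kernel_id[OF assms(1,2)], of "1 / card N"] assms(2,3)
  by simp

lemma channel_kernel_choi_id:
  assumes "finite M"
  shows "channel_kernel M M choi_id"
proof -
  have "partial_trace M choi_id i j = (1 \<cdot>\<^sub>k id_kernel) i j" if "i \<in> M" "j \<in> M" for i j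
  proof -
    have "partial_trace M choi_id i j = (\<Sum>a\<in>M. if a = i then of_bool (i = j) else 0)"
      unfolding partial_trace_def choi_id_def rank_one_kernel_def by (intro sum.cong refl) auto
    then show ?thesis using assms that by (simp add: scale_kernel_def id_kernel_def)
  qed
  then show ?thesis
    by (simp add: scaled_channel_kernel_def kernel_eq_def choi_id_def[symmetric])
      (simp add: choi_id_def pos_kernel_rank_one)
qed

lemma channel_kernel_convex:
  assumes "channel_kernel R N c" "channel_kernel R N d" "0 \<le> t" "t \<le> 1"
  shows "channel_kernel R N ((1 - t) \<cdot>\<^sub>k c + t \<cdot>\<^sub>k d)"
  using scaled_channel_kernel_add[OF scaled_channel_kernel_scale[OF assms(1), of "1 - t"]
      scaled_channel_kernel_scale[OF assms(2), of t]] assms(3,4) by simp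

lemma partial_trace_choi_comp:
  assumes "finite M" "kernel_eq M (partial_trace N d) (t \<cdot>\<^sub>k id_kernel)"
  shows "partial_trace N (choi_comp M c d) = t \<cdot>\<^sub>k partial_trace M c"
proof (intro ext)
  fix i j
  have "partial_trace N (choi_comp M c d) i j = (\<Sum>x\<in>M. \<Sum>y\<in>M. c (i, x) (j, y) * partial_trace N d x y)"
    unfolding partial_trace_def choi_comp_def link_kernel_def swap_kernel_def swap_simp fst_conv snd_conv
      sum_distrib_left
    by (rule sum_rotate3[symmetric])
  also have "\<dots> = (\<Sum>x\<in>M. \<Sum>y\<in>M. if y = x then of_real t * c (i, x) (j, x) else 0)"
    using assms(2) by (intro sum.cong refl) (auto simp: kernel_eq_def scale_kernel_def id_kernel_def)
  finally show "partial_trace N (choi_comp M c d) i j = (t \<cdot>\<^sub>k partial_trace M c) i j"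
    using assms(1) by (simp add: scale_kernel_def partial_trace_def sum_distrib_left)
qed

lemma scaled_channel_kernel_comp:
  assumes "finite R" "finite M" "finite N" "scaled_channel_kernel s R M c" "scaled_channel_kernel t M N d"
  shows "scaled_channel_kernel (t * s) R N (choi_comp M c d)"
proof -
  have "partial_trace N (choi_comp M c d) = t \<cdot>\<^sub>k partial_trace M c"
    by (rule partial_trace_choi_comp[OF assms(2) scaled_channel_kernelD(2)[OF assms(5)]])
  moreover have "pos_kernel (R \<times> N) (choi_comp M c d)"
    by (rule pos_kernel_choi_comp[OF assms(1-3) scaled_channel_kernelD(1)[OF assms(4)]
        scaled_channel_kernelD(1)[OF assms(5)]])
  ultimately show ?thesis
    using assms(4) by (simp add: scaled_channel_kernel_def kernel_eq_def scale_kernel_def)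
qed

lemma channel_kernel_comp:
  "finite R \<Longrightarrow> finite M \<Longrightarrow> finite N \<Longrightarrow> channel_kernel R M c \<Longrightarrow> channel_kernel M N d \<Longrightarrow>
    channel_kernel R N (choi_comp M c d)"
  using scaled_channel_kernel_comp[of R M N 1 c 1 d] by simp

lemma kernel_trace_choi_comp:
  assumes "finite M" "scaled_channel_kernel t M N d"
  shows "kernel_trace (R \<times> N) (choi_comp M c d) = of_real t * kernel_trace (R \<times> M) c"
  unfolding kernel_trace_prod partial_trace_choi_comp[OF assms(1) scaled_channel_kernelD(2)[OF assms(2)]]
  by (rule kernel_trace_scale)

lemma kernel_trace_link:
  assumes "finite M" "scaled_channel_kernel t M N c"
  shows "kernel_trace (N \<times> S) (link_kernel M c X) = of_real t * kernel_trace (M \<times> S) X"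
proof -
  have "kernel_trace (N \<times> S) (link_kernel M c X) = kernel_trace (S \<times> N) (choi_comp M (swap_kernel X) c)"
    unfolding choi_comp_def swap_swap_kernel swap_link_kernel[symmetric, of M c] by (rule kernel_trace_swap)
  also have "\<dots> = of_real t * kernel_trace (M \<times> S) X"
    unfolding kernel_trace_choi_comp[OF assms] kernel_trace_swap ..
  finally show ?thesis .
qed

lemma cmod_channel_kernel_le:
  assumes "finite R" "finite N" "channel_kernel R N c" "p \<in> R \<times> N" "q \<in> R \<times> N"
  shows "cmod (c p q) \<le> card R"
proof -
  have "kernel_trace (R \<times> N) c = of_nat (card R)"
    using scaled_channel_kernelD(2)[OF assms(3)]
      kernel_trace_cong[of R "partial_trace N c" "1 \<cdot>\<^sub>k id_kernel"]
    by (simp add: kernel_trace_prod kernel_trace_scale kernel_trace_id)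
  then show ?thesis
    using cmod_pos_kernel_le_trace[OF _ scaled_channel_kernelD(1)[OF assms(3)] assms(4,5)] assms(1,2)
    by simp
qed

section \<open>The conditional norm and its dual\<close>

definition cond_norm :: "'a set \<Rightarrow> 'b set \<Rightarrow> ('a \<times> 'b) kernel \<Rightarrow> real" where
  "cond_norm R N \<rho> = Sup {Re (kernel_pair (R \<times> N) \<rho> c) | c. channel_kernel R N c}"

lemma cond_norm_cong:
  assumes "kernel_eq (R \<times> N) \<rho> \<rho>'"
  shows "cond_norm R N \<rho> = cond_norm R N \<rho>'"
  unfolding cond_norm_def kernel_pair_cong[OF assms kernel_eqI[OF refl]] ..

lemma cond_norm_upper:
  assumes "finite R" "finite N" "channel_kernel R N c"
  shows "Re (kernel_pair (R \<times> N) \<rho> c) \<le> cond_norm R N \<rho>"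
  unfolding cond_norm_def
proof (rule cSup_upper)
  have "Re (kernel_pair (R \<times> N) \<rho> d) \<le> (\<Sum>p\<in>R \<times> N. \<Sum>q\<in>R \<times> N. cmod (\<rho> p q) * card R)"
    if channel_d: "channel_kernel R N d" for d
  proof -
    have "Re (kernel_pair (R \<times> N) \<rho> d) \<le> cmod (kernel_pair (R \<times> N) \<rho> d)" by (rule complex_Re_le_cmod)
    also have "\<dots> \<le> (\<Sum>p\<in>R \<times> N. \<Sum>q\<in>R \<times> N. cmod (\<rho> p q * d p q))"
      unfolding kernel_pair_def by (intro order_trans[OF norm_sum] sum_mono order_refl)
    also have "\<dots> \<le> (\<Sum>p\<in>R \<times> N. \<Sum>q\<in>R \<times> N. cmod (\<rho> p q) * card R)"
      unfolding norm_mult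
      by (intro sum_mono mult_left_mono cmod_channel_kernel_le[OF assms(1,2) channel_d]) auto
    finally show ?thesis .
  qed
  then show "bdd_above {Re (kernel_pair (R \<times> N) \<rho> c) | c. channel_kernel R N c}"
    by (intro bdd_aboveI) blast
qed (use assms in blast)

lemma cond_norm_least:
  assumes "finite R" "finite N" "N \<noteq> {}"
    "\<And>c. channel_kernel R N c \<Longrightarrow> Re (kernel_pair (R \<times> N) \<rho> c) \<le> B"
  shows "cond_norm R N \<rho> \<le> B"
  unfolding cond_norm_def
  by (rule cSup_least) (use depolarising_channel_kernel[OF assms(1-3)] assms(4) in blast)+

lemma cond_norm_approx:
  assumes "finite R" "finite N" "N \<noteq> {}" "0 < \<delta>"
  obtains c where "channel_kernel R N c" "cond_norm R N \<rho> - \<delta> < Re (kernel_pair (R \<times> N) \<rho> c)"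
proof -
  have "\<exists>c. channel_kernel R N c \<and> cond_norm R N \<rho> - \<delta> < Re (kernel_pair (R \<times> N) \<rho> c)"
  proof (rule ccontr)
    assume "\<nexists>c. channel_kernel R N c \<and> cond_norm R N \<rho> - \<delta> < Re (kernel_pair (R \<times> N) \<rho> c)"
    then have "cond_norm R N \<rho> \<le> cond_norm R N \<rho> - \<delta>"
      by (intro cond_norm_least[OF assms(1-3)]) (auto simp: not_less)
    then show False using assms(4) by simp
  qed
  then show ?thesis using that by blast
qed

lemma cond_norm_scale:
  assumes "finite R" "finite N" "N \<noteq> {}" "0 < s"
  shows "cond_norm R N (s \<cdot>\<^sub>k \<rho>) = s * cond_norm R N \<rho>"
proof (rule antisym)
  show "cond_norm R N (s \<cdot>\<^sub>k \<rho>) \<le> s * cond_norm R N \<rho>"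
    using cond_norm_upper[OF assms(1,2)] assms(4)
    by (intro cond_norm_least[OF assms(1-3)]) (simp add: kernel_pair_scale_left)
  have "cond_norm R N \<rho> \<le> cond_norm R N (s \<cdot>\<^sub>k \<rho>) / s"
    using cond_norm_upper[OF assms(1,2), of _ "s \<cdot>\<^sub>k \<rho>"] assms(4)
    by (intro cond_norm_least[OF assms(1-3)]) (simp add: kernel_pair_scale_left field_simps)
  then show "s * cond_norm R N \<rho> \<le> cond_norm R N (s \<cdot>\<^sub>k \<rho>)" using assms(4) by (simp add: field_simps)
qed

lemma cond_norm_nonneg:
  assumes "finite R" "finite N" "N \<noteq> {}" "pos_kernel (R \<times> N) \<rho>"
  shows "0 \<le> cond_norm R N \<rho>"
proof -
  have channel_c: "channel_kernel R N ((1 / card N) \<cdot>\<^sub>k id_kernel)"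
    by (rule depolarising_channel_kernel[OF assms(1-3)])
  have "0 \<le> kernel_pair (R \<times> N) \<rho> ((1 / card N) \<cdot>\<^sub>k id_kernel)"
    using assms(1,2) by (intro kernel_pair_nonneg assms(4) scaled_channel_kernelD(1)[OF channel_c]) auto
  then show ?thesis using cond_norm_upper[OF assms(1,2) channel_c, of \<rho>] by (simp add: complex_nonneg_iff)
qed

lemma cond_norm_link_le:
  assumes "finite R" "finite M" "finite N" "N \<noteq> {}" "channel_kernel R M c"
  shows "cond_norm M N (link_kernel R c \<rho>) \<le> cond_norm R N \<rho>"
proof (rule cond_norm_least[OF assms(2-4)])
  fix d assume "channel_kernel M N d"
  then show "Re (kernel_pair (M \<times> N) (link_kernel R c \<rho>) d) \<le> cond_norm R N \<rho>"
    unfolding kernel_pair_link choi_comp_def[symmetric]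
    by (intro cond_norm_upper channel_kernel_comp assms)
qed

text \<open>\<open>Y / \<kappa>\<close> is completed to a channel by distributing the missing marginal uniformly.\<close>

lemma kernel_pair_le_cond_norm:
  fixes \<rho> :: "('a \<times> 'b) kernel"
  assumes fin: "finite R" "finite N" and ne: "N \<noteq> {}" and pos_\<rho>: "pos_kernel (R \<times> N) \<rho>"
    and pos_Y: "pos_kernel (R \<times> N) Y" and marginal_le: "kernel_le R (partial_trace N Y) (\<kappa> \<cdot>\<^sub>k id_kernel)"
      and \<kappa>_pos: "0 < \<kappa>"
  shows "Re (kernel_pair (R \<times> N) \<rho> Y) \<le> \<kappa> * cond_norm R N \<rho>"
proof -
  define Z where "Z = (1 / \<kappa>) \<cdot>\<^sub>k (\<kappa> \<cdot>\<^sub>k id_kernel - partial_trace N Y)"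
  define E :: "('a \<times> 'b) kernel" where "E = (1 / card N) \<cdot>\<^sub>k kernel_tensor Z id_kernel"
  have "pos_kernel R Z" unfolding Z_def using marginal_le \<kappa>_pos
    by (intro pos_kernel_scale) (auto simp: kernel_le_def)
  then have pos_E: "pos_kernel (R \<times> N) E"
    unfolding E_def using fin by (intro pos_kernel_scale pos_kernel_tensor pos_kernel_id) auto
  have "partial_trace N ((1 / \<kappa>) \<cdot>\<^sub>k Y + E) = 1 \<cdot>\<^sub>k id_kernel"
    unfolding E_def partial_trace_add partial_trace_scale partial_trace_tensor_id Z_def
    using fin ne \<kappa>_pos by (simp add: fun_eq_iff scale_kernel_def algebra_simps flip: of_real_mult)
  then have "channel_kernel R N ((1 / \<kappa>) \<cdot>\<^sub>k Y + E)"
    unfolding scaled_channel_kernel_def using pos_Y pos_E \<kappa>_pos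
    by (auto intro!: pos_kernel_add pos_kernel_scale simp: kernel_eq_def)
  then have "Re (kernel_pair (R \<times> N) \<rho> ((1 / \<kappa>) \<cdot>\<^sub>k Y + E)) \<le> cond_norm R N \<rho>"
    by (rule cond_norm_upper[OF fin])
  moreover have "0 \<le> Re (kernel_pair (R \<times> N) \<rho> E)"
    using kernel_pair_nonneg[OF _ pos_\<rho> pos_E] fin by (simp add: complex_nonneg_iff)
  ultimately have "Re (kernel_pair (R \<times> N) \<rho> Y) / \<kappa> \<le> cond_norm R N \<rho>"
    by (simp add: kernel_pair_add_right kernel_pair_scale_right)
  then show ?thesis using \<kappa>_pos by (simp add: field_simps)
qed

definition product_defects :: "'a set \<Rightarrow> real \<Rightarrow> ('a \<times> 'b) kernel \<Rightarrow> ('a \<times> 'b) kernel set" where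
  "product_defects R v \<rho> = {kernel_tensor (v \<cdot>\<^sub>k \<sigma>) id_kernel - \<rho> | \<sigma>. density_kernel R \<sigma>}"

lemma maximally_mixed_density: "finite R \<Longrightarrow> R \<noteq> {} \<Longrightarrow> density_kernel R ((1 / card R) \<cdot>\<^sub>k id_kernel)"
  by (simp add: density_kernel_def pos_kernel_scale pos_kernel_id kernel_trace_scale kernel_trace_id)

lemma product_defects_nonempty: "finite R \<Longrightarrow> R \<noteq> {} \<Longrightarrow> product_defects R v \<rho> \<noteq> {}"
  using maximally_mixed_density by (auto simp: product_defects_def)

lemma convex_product_defects: "convex_kernels (product_defects R v \<rho>)"
  unfolding convex_kernels_def
proof (intro ballI allI impI)
  fix x y and t :: real
  assume "x \<in> product_defects R v \<rho>" "y \<in> product_defects R v \<rho>" and t_bounds: "0 \<le> t" "t \<le> 1"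
  then obtain \<sigma> \<sigma>' where density_\<sigma>: "density_kernel R \<sigma>" "x = kernel_tensor (v \<cdot>\<^sub>k \<sigma>) id_kernel - \<rho>"
    and density_\<sigma>': "density_kernel R \<sigma>'" "y = kernel_tensor (v \<cdot>\<^sub>k \<sigma>') id_kernel - \<rho>"
    unfolding product_defects_def by blast
  have "density_kernel R ((1 - t) \<cdot>\<^sub>k \<sigma> + t \<cdot>\<^sub>k \<sigma>')"
    using density_\<sigma>(1) density_\<sigma>'(1) t_bounds
    by (auto simp: density_kernel_def kernel_trace_add kernel_trace_scale
        intro!: pos_kernel_add pos_kernel_scale)
  moreover have "(1 - t) \<cdot>\<^sub>k x + t \<cdot>\<^sub>k y = kernel_tensor (v \<cdot>\<^sub>k ((1 - t) \<cdot>\<^sub>k \<sigma> + t \<cdot>\<^sub>k \<sigma>')) id_kernel - \<rho>"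
    unfolding density_\<sigma>(2) density_\<sigma>'(2)
    by (simp add: fun_eq_iff kernel_tensor_def scale_kernel_def algebra_simps)
  ultimately show "(1 - t) \<cdot>\<^sub>k x + t \<cdot>\<^sub>k y \<in> product_defects R v \<rho>"
    unfolding product_defects_def by blast
qed

lemma product_defects_herm_bounded:
  assumes fin: "finite R" "finite N" and pos_\<rho>: "pos_kernel (R \<times> N) \<rho>" and v_nonneg: "0 \<le> v"
    and x_in: "x \<in> product_defects R v \<rho>"
  shows "herm_kernel (R \<times> N) x"
    and "p \<in> R \<times> N \<Longrightarrow> q \<in> R \<times> N \<Longrightarrow> cmod (x p q) \<le> v + Re (kernel_trace (R \<times> N) \<rho>)"
proof -
  have finite_RN: "finite (R \<times> N)" using fin by simp
  obtain \<sigma> where density_\<sigma>: "density_kernel R \<sigma>" and x_eq: "x = kernel_tensor (v \<cdot>\<^sub>k \<sigma>) id_kernel - \<rho>"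
    using x_in by (auto simp: product_defects_def)
  have "pos_kernel (R \<times> N) (kernel_tensor (v \<cdot>\<^sub>k \<sigma>) id_kernel)"
    using density_\<sigma> v_nonneg fin
    by (intro pos_kernel_tensor pos_kernel_scale pos_kernel_id) (auto simp: density_kernel_def)
  then show "herm_kernel (R \<times> N) x"
    unfolding x_eq
    by (rule herm_kernel_diff[OF pos_kernel_herm[OF finite_RN] pos_kernel_herm[OF finite_RN pos_\<rho>]])
  assume pq: "p \<in> R \<times> N" "q \<in> R \<times> N"
  have "cmod (\<sigma> (fst p) (fst q)) \<le> 1"
    using cmod_pos_kernel_le_trace[OF fin(1), of \<sigma> "fst p" "fst q"] density_\<sigma> pq
    by (auto simp: density_kernel_def)
  then have "cmod (kernel_tensor (v \<cdot>\<^sub>k \<sigma>) id_kernel p q) \<le> v"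
    using v_nonneg by (simp add: kernel_tensor_def scale_kernel_def id_kernel_def norm_mult mult_left_le)
  moreover have "cmod (\<rho> p q) \<le> Re (kernel_trace (R \<times> N) \<rho>)"
    by (rule cmod_pos_kernel_le_trace[OF finite_RN pos_\<rho> pq])
  ultimately show "cmod (x p q) \<le> v + Re (kernel_trace (R \<times> N) \<rho>)"
    unfolding x_eq using norm_triangle_ineq4[of "kernel_tensor (v \<cdot>\<^sub>k \<sigma>) id_kernel p q" "\<rho> p q"] by simp
qed

lemma kernel_pair_le_dominating_product:
  assumes fin: "finite R" "finite N" and ne: "R \<noteq> {}" "N \<noteq> {}"
    and pos_\<rho>: "pos_kernel (R \<times> N) \<rho>" and density_Y: "density_kernel (R \<times> N) Y"
  obtains \<sigma> where "density_kernel R \<sigma>"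
    "Re (kernel_pair (R \<times> N) Y \<rho>) \<le>
        Re (kernel_pair (R \<times> N) Y (kernel_tensor (cond_norm R N \<rho> \<cdot>\<^sub>k \<sigma>) id_kernel))"
proof -
  have pos_Y: "pos_kernel (R \<times> N) Y" using density_Y by (simp add: density_kernel_def)
  define y where "y = partial_trace N Y"
  have "pos_kernel R y" unfolding y_def by (rule pos_kernel_partial_trace[OF fin pos_Y])
  then obtain \<sigma> where density_\<sigma>: "density_kernel R \<sigma>" "kernel_le R y (Re (kernel_pair R y \<sigma>) \<cdot>\<^sub>k id_kernel)"
    using herm_kernel_le_max_eigenvalue[OF fin(1) ne(1) pos_kernel_herm[OF fin(1)]] by blast
  define \<kappa> where "\<kappa> = Re (kernel_pair R y \<sigma>)"
  have "0 \<le> Re (kernel_trace R (\<kappa> \<cdot>\<^sub>k id_kernel - y))"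
    using pos_kernel_trace_nonneg[OF fin(1)] density_\<sigma>(2)
    by (auto simp: kernel_le_def \<kappa>_def complex_nonneg_iff)
  then have "1 \<le> \<kappa> * card R"
    using density_Y
    by (simp add: kernel_trace_diff kernel_trace_scale kernel_trace_id y_def density_kernel_def
        kernel_trace_prod)
  then have "0 < \<kappa>" using mult_nonpos_nonneg[of \<kappa> "card R"] by fastforce
  then have "Re (kernel_pair (R \<times> N) \<rho> Y) \<le> \<kappa> * cond_norm R N \<rho>"
    using density_\<sigma>(2)
    by (intro kernel_pair_le_cond_norm[OF fin ne(2) pos_\<rho> pos_Y]) (simp_all add: \<kappa>_def y_def)
  then show ?thesis
    using density_\<sigma>(1) by (intro that[of \<sigma>])
      (simp_all add: kernel_pair_tensor_id[OF fin(2)] kernel_pair_scale_right kernel_pair_commute[of _ Y \<rho>]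
          \<kappa>_def y_def mult.commute)
qed

theorem cond_norm_dual:
  assumes fin: "finite R" "finite N" and ne: "R \<noteq> {}" "N \<noteq> {}"
    and pos_\<rho>: "pos_kernel (R \<times> N) \<rho>" and \<eta>_pos: "0 < \<eta>"
  obtains \<sigma> where "density_kernel R \<sigma>"
    "kernel_le (R \<times> N) \<rho> (kernel_tensor (cond_norm R N \<rho> \<cdot>\<^sub>k \<sigma> + \<eta> \<cdot>\<^sub>k id_kernel) id_kernel)"
proof -
  define v where "v = cond_norm R N \<rho>"
  have v_nonneg: "0 \<le> v" unfolding v_def by (rule cond_norm_nonneg[OF fin ne(2) pos_\<rho>])
  have "finite (R \<times> N)" using fin by simp
  moreover note convex_product_defects[of R v \<rho>] product_defects_nonempty[OF fin(1) ne(1), of v \<rho>]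
  moreover have "\<forall>x\<in>product_defects R v \<rho>. herm_kernel (R \<times> N) x"
    using product_defects_herm_bounded(1)[OF fin pos_\<rho> v_nonneg] by blast
  moreover have "\<forall>x\<in>product_defects R v \<rho>. \<forall>p\<in>R \<times> N. \<forall>q\<in>R \<times> N. cmod (x p q) \<le>
      v + Re (kernel_trace (R \<times> N) \<rho>)"
    using product_defects_herm_bounded(2)[OF fin pos_\<rho> v_nonneg] by blast
  ultimately show ?thesis using \<eta>_pos
  proof (cases rule: convex_kernels_positive_or_separated)
    case (positive x)
    then obtain \<sigma> where density_\<sigma>: "density_kernel R \<sigma>"
      and x_eq: "x = kernel_tensor (v \<cdot>\<^sub>k \<sigma>) id_kernel - \<rho>"
      by (auto simp: product_defects_def)
    have "x + \<eta> \<cdot>\<^sub>k id_kernel = kernel_tensor (v \<cdot>\<^sub>k \<sigma> + \<eta> \<cdot>\<^sub>k id_kernel) id_kernel - \<rho>"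
      unfolding x_eq id_kernel_prod[where 'a = 'a and 'b = 'b]
      by (simp add: fun_eq_iff kernel_tensor_def scale_kernel_def algebra_simps)
    then show ?thesis using that[OF density_\<sigma>] positive(2) by (simp add: kernel_le_def v_def)
  next
    case (separated Y m)
    obtain \<sigma> where density_\<sigma>: "density_kernel R \<sigma>"
      "Re (kernel_pair (R \<times> N) Y \<rho>) \<le> Re (kernel_pair (R \<times> N) Y (kernel_tensor (v \<cdot>\<^sub>k \<sigma>) id_kernel))"
      unfolding v_def using kernel_pair_le_dominating_product[OF fin ne pos_\<rho> separated(1)] .
    then show ?thesis
      using separated(2) separated(3)[of "kernel_tensor (v \<cdot>\<^sub>k \<sigma>) id_kernel - \<rho>"]
      by (auto simp: product_defects_def kernel_pair_diff_right)
  qed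
qed

section \<open>Singular values\<close>

definition adjoint_kernel :: "'i kernel \<Rightarrow> 'i kernel" where
  "adjoint_kernel A p q = cnj (A q p)"

definition gram_kernel :: "'i set \<Rightarrow> 'i kernel \<Rightarrow> 'i kernel" where
  "gram_kernel I A = kernel_mult I (adjoint_kernel A) A"

definition singular_decomposition ::
    "'i set \<Rightarrow> 'i kernel \<Rightarrow> nat set \<Rightarrow> (nat \<Rightarrow> real) \<Rightarrow> (nat \<Rightarrow> 'i \<Rightarrow> complex) \<Rightarrow> (nat \<Rightarrow> 'i \<Rightarrow> complex) \<Rightarrow> bool" where
  "singular_decomposition I A J s u v \<longleftrightarrow> finite J \<and> (\<forall>j\<in>J. 0 \<le> s j) \<and>
     orthonormal I J u \<and> orthonormal I J v \<and> kernel_eq I A (dyad_kernel J s u v)"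

lemma cnj_sform: "cnj (sform I A u v) = sform I (adjoint_kernel A) v u"
  unfolding sform_def cnj_sum adjoint_kernel_def by (subst sum.swap) (simp add: mult_ac)

lemma kernel_mult_cong:
  "kernel_eq I A A' \<Longrightarrow> kernel_eq I B B' \<Longrightarrow> kernel_eq I (kernel_mult I A B) (kernel_mult I A' B')"
  by (simp add: kernel_eq_def kernel_mult_def)

lemma gram_kernel_cong: "kernel_eq I A B \<Longrightarrow> kernel_eq I (gram_kernel I A) (gram_kernel I B)"
  unfolding gram_kernel_def by (rule kernel_mult_cong) (simp_all add: kernel_eq_def adjoint_kernel_def)

lemma inner_on_kernel_app_gram:
  "inner_on I (kernel_app I A u) (kernel_app I A v) = sform I (gram_kernel I A) u v"
proof -
  have "inner_on I (kernel_app I A u) (kernel_app I A v) =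
      (\<Sum>r\<in>I. \<Sum>p\<in>I. \<Sum>q\<in>I. cnj (u p) * (cnj (A r p) * A r q) * v q)"
    unfolding inner_on_def kernel_app_def cnj_sum sum_product by (simp add: mult_ac)
  also have "\<dots> = (\<Sum>p\<in>I. \<Sum>q\<in>I. \<Sum>r\<in>I. cnj (u p) * (cnj (A r p) * A r q) * v q)"
    by (rule sum_rotate3[symmetric])
  finally show ?thesis
    by (simp add: sform_def gram_kernel_def kernel_mult_def adjoint_kernel_def sum_distrib_left
        sum_distrib_right)
qed

lemma pos_kernel_gram_kernel: "pos_kernel I (gram_kernel I A)"
  unfolding pos_kernel_def inner_on_kernel_app_gram[symmetric] by (simp add: inner_on_self_nonneg)

text \<open>If \<open>B u - C u = \<mu> u\<close> and \<open>\<parallel>B u\<parallel> = \<parallel>C u\<parallel>\<close>, then \<open>2 \<langle>u, C u\<rangle> = - \<mu> \<parallel>u\<parallel>\<^sup>2\<close> and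
  \<open>2 \<langle>u, B u\<rangle> = \<mu> \<parallel>u\<parallel>\<^sup>2\<close>; positivity of both sides leaves only \<open>\<mu> = 0\<close>.\<close>

lemma pos_kernel_eq_if_gram_eq:
  assumes fin: "finite I" and pos_B: "pos_kernel I B" and pos_C: "pos_kernel I C"
    and gram: "kernel_eq I (gram_kernel I B) (gram_kernel I C)"
  shows "kernel_eq I B C"
proof (rule ccontr)
  assume "\<not> kernel_eq I B C"
  then obtain p q where pq: "p \<in> I" "q \<in> I" "(B - C) p q \<noteq> 0" by (auto simp: kernel_eq_def)
  have herm: "herm_kernel I (B - C)" by (intro herm_kernel_diff pos_kernel_herm fin pos_B pos_C)
  obtain u and \<mu> :: real where u_nonzero: "inner_on I u u \<noteq> 0" and \<mu>_nonzero: "\<mu> \<noteq> 0"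
    and eigen: "\<And>p. p \<in> I \<Longrightarrow> kernel_app I (B - C) u p = of_real \<mu> * u p"
    using herm_kernel_nonzero_eigenvalue[OF fin herm pq] by blast
  define b where "b = kernel_app I B u"
  define c where "c = kernel_app I C u"
  have b_eq: "b p = c p + of_real \<mu> * u p" if "p \<in> I" for p
    using eigen[OF that]
    by (simp add: b_def c_def kernel_app_def left_diff_distrib sum_subtractf algebra_simps)
  have norm: "inner_on I b b = inner_on I c c"
    unfolding b_def c_def inner_on_kernel_app_gram by (rule sform_cong[OF gram])
  have inner_cu: "inner_on I c u = inner_on I u c"
    unfolding c_def by (rule inner_on_kernel_app[OF pos_kernel_herm[OF fin pos_C], symmetric])
  have "inner_on I b b = inner_on I c c + of_real \<mu> * (inner_on I c u + inner_on I u c) +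
      of_real (\<mu>\<^sup>2) * inner_on I u u"
    by (simp add: inner_on_def b_eq sum.distrib sum_distrib_left algebra_simps power2_eq_square)
  then have "of_real \<mu> * (2 * inner_on I u c + of_real \<mu> * inner_on I u u) = 0"
    unfolding norm inner_cu by (simp add: algebra_simps power2_eq_square)
  then have two_c: "2 * inner_on I u c = - of_real \<mu> * inner_on I u u"
    using \<mu>_nonzero by (simp add: add_eq_0_iff2)
  have "inner_on I u b = inner_on I u c + of_real \<mu> * inner_on I u u"
    by (simp add: inner_on_def b_eq sum.distrib sum_distrib_left algebra_simps)
  then have two_b: "2 * inner_on I u b = of_real \<mu> * inner_on I u u" using two_c by simp
  have "0 \<le> inner_on I u b" "0 \<le> inner_on I u c"
    using pos_B pos_C by (simp_all add: b_def c_def sform_eq_inner_on[symmetric] pos_kernel_def)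
  moreover have "0 < Re (inner_on I u u)"
    using u_nonzero inner_on_self_nonneg[of I u] by (auto simp: complex_nonneg_iff complex_eq_iff)
  ultimately have "0 \<le> \<mu> * Re (inner_on I u u)" "\<mu> * Re (inner_on I u u) \<le> 0"
    using arg_cong[OF two_b, of Re] arg_cong[OF two_c, of Re] by (auto simp: complex_nonneg_iff)
  with \<mu>_nonzero \<open>0 < Re (inner_on I u u)\<close> show False by (simp add: zero_le_mult_iff mult_le_0_iff)
qed

lemma singular_decompositionD:
  assumes "singular_decomposition I A J s u v"
  shows "finite J" "\<And>j. j \<in> J \<Longrightarrow> 0 \<le> s j" "orthonormal I J u" "orthonormal I J v"
    "kernel_eq I A (dyad_kernel J s u v)"
  using assms by (auto simp: singular_decomposition_def)

lemma gram_kernel_singular_decomposition: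
  assumes "singular_decomposition I A J s u v"
  shows "kernel_eq I (gram_kernel I A) (dyad_kernel J (\<lambda>j. s j * s j) v v)"
proof -
  note decomposition = singular_decompositionD[OF assms]
  have "adjoint_kernel (dyad_kernel J s u v) = dyad_kernel J s v u"
    by (simp add: adjoint_kernel_def dyad_kernel_def fun_eq_iff mult_ac)
  then have "gram_kernel I (dyad_kernel J s u v) = dyad_kernel J (\<lambda>j. s j * s j) v v"
    unfolding gram_kernel_def by (simp add: kernel_mult_dyad[OF decomposition(1,3)])
  then show ?thesis using gram_kernel_cong[OF decomposition(5)] by simp
qed

lemma sform_singular_decomposition:
  assumes "singular_decomposition I A J s u v" "j \<in> J"
  shows "sform I A (u j) (v j) = of_real (s j)"
proof -
  note decomposition = singular_decompositionD[OF assms(1)]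
  have "sform I A (u j) (v j) = inner_on I (u j) (\<lambda>p. \<Sum>i\<in>J. of_real (s i) * u i p * inner_on I (v i) (v j))"
    unfolding sform_eq_inner_on kernel_app_dyad[symmetric]
    by (intro inner_on_cong refl kernel_app_cong[OF decomposition(5)])
  also have "(\<lambda>p. \<Sum>i\<in>J. of_real (s i) * u i p * inner_on I (v i) (v j)) =
      (\<lambda>p. \<Sum>i\<in>J. if i = j then of_real (s j) * u j p else 0)"
    using decomposition(4) assms(2) by (intro ext sum.cong refl) (auto simp: orthonormalD)
  finally show ?thesis
    using decomposition(1,3) assms(2) by (simp add: inner_on_scale_right orthonormalD)
qed

lemma inner_on_gram_eigenvectors:
  assumes "spectral_decomposition I (gram_kernel I A) a v" "j < card I" "k < card I"
  shows "inner_on I (kernel_app I A (v j)) (kernel_app I A (v k)) = of_real (a k) * of_bool (j = k)"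
  unfolding inner_on_kernel_app_gram by (rule sform_spectral_decomposition[OF assms])

lemma kernel_app_gram_null_eigenvector:
  assumes "finite I" "spectral_decomposition I (gram_kernel I A) a v" "j < card I" "a j = 0" "p \<in> I"
  shows "kernel_app I A (v j) p = 0"
  using inner_on_gram_eigenvectors[OF assms(2,3,3)]
    inner_on_self_eq_0_iff[OF assms(1), of "kernel_app I A (v j)"]
    assms(4,5) by simp

theorem singular_decomposition_exists:
  assumes fin: "finite I"
  obtains J s u v where "singular_decomposition I A J s u v"
proof -
  obtain a v where spec: "spectral_decomposition I (gram_kernel I A) a v"
    and a_nonneg: "\<And>j. j < card I \<Longrightarrow> 0 \<le> a j"
    using pos_kernel_spectral_decomposition[OF fin pos_kernel_gram_kernel] by blast
  define J where "J = {j. j < card I \<and> 0 < a j}"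
  define s where "s j = sqrt (a j)" for j
  define u where "u j p = of_real (1 / s j) * kernel_app I A (v j) p" for j p
  have s_pos: "0 < s j" "s j * s j = a j" "j < card I" if "j \<in> J" for j using that
    by (auto simp: J_def s_def)
  have "orthonormal I J u"
    unfolding orthonormal_def
  proof (intro ballI)
    fix j k assume "j \<in> J" "k \<in> J"
    then have "inner_on I (u j) (u k) = of_real (a k / (s j * s k)) * of_bool (j = k)"
      unfolding u_def[abs_def] inner_on_scale_left inner_on_scale_right
      by (simp add: inner_on_gram_eigenvectors[OF spec] s_pos(3))
    then show "inner_on I (u j) (u k) = of_bool (j = k)"
      using s_pos(1,2)[OF \<open>k \<in> J\<close>] by (cases "j = k") auto
  qed
  moreover have "orthonormal I J v" using spectral_decompositionD(1)[OF spec]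
    by (auto simp: orthonormal_def J_def)
  moreover have "A p q = dyad_kernel J s u v p q" if pq: "p \<in> I" "q \<in> I" for p q
  proof -
    have "A p q = (\<Sum>j<card I. kernel_app I A (v j) p * cnj (v j q))"
      using spec by (intro orthonormal_basis_kernel_expansion fin pq) (simp add: spectral_decomposition_def)
    also have "\<dots> = (\<Sum>j\<in>J. kernel_app I A (v j) p * cnj (v j q))"
      using kernel_app_gram_null_eigenvector[OF fin spec _ _ pq(1)] a_nonneg
      by (intro sum.mono_neutral_right) (auto simp: J_def not_less le_less)
    also have "\<dots> = dyad_kernel J s u v p q"
      unfolding dyad_kernel_def u_def using s_pos(1) by (intro sum.cong refl) (fastforce simp: less_le)
    finally show ?thesis .
  qed
  ultimately have "singular_decomposition I A J s u v"
    by (simp add: singular_decomposition_def kernel_eq_def J_def s_def)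
  then show ?thesis by (rule that)
qed

lemma singular_decomposition_spectral:
  assumes "spectral_decomposition I A a v"
  shows "singular_decomposition I A {..<card I} (\<lambda>j. \<bar>a j\<bar>) (\<lambda>j p. (if a j < 0 then - 1 else 1) * v j p) v"
proof -
  note orth = spectral_decompositionD(1)[OF assms] and A = spectral_decompositionD(2)[OF assms]
  have "inner_on I (\<lambda>p. (if a j < 0 then - 1 else 1) * v j p) (\<lambda>p. (if a k < 0 then - 1 else 1) * v k p) =
      of_bool (j = k)"
    if "j < card I" "k < card I" for j k
    unfolding inner_on_scale_left inner_on_scale_right using orthonormalD[OF orth, of j k] that by auto
  then have "orthonormal I {..<card I} (\<lambda>j p. (if a j < 0 then - 1 else 1) * v j p)"
    by (simp add: orthonormal_def)
  moreover have "dyad_kernel {..<card I} a v v =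
      dyad_kernel {..<card I} (\<lambda>j. \<bar>a j\<bar>) (\<lambda>j p. (if a j < 0 then - 1 else 1) * v j p) v"
    unfolding dyad_kernel_def by (intro ext sum.cong refl) auto
  ultimately show ?thesis using orth A by (simp add: singular_decomposition_def)
qed

lemma kernel_pair_transpose_dyad:
  "kernel_pair I (transpose_kernel A) (dyad_kernel J a u v) = (\<Sum>j\<in>J. of_real (a j) * sform I A (v j) (u j))"
proof -
  have "kernel_pair I (transpose_kernel A) (dyad_kernel J a u v) =
      (\<Sum>j\<in>J. kernel_pair I (transpose_kernel A) (\<lambda>p q. of_real (a j) * u j p * cnj (v j q)))"
    unfolding dyad_kernel_def[abs_def] by (rule kernel_pair_sum_right)
  also have "\<dots> = (\<Sum>j\<in>J. of_real (a j) * sform I A (v j) (u j))"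
    unfolding kernel_pair_def sform_def transpose_kernel_def sum_distrib_left
    by (rule sum.cong[OF refl], subst sum.swap) (simp add: mult_ac)
  finally show ?thesis .
qed

lemma bessel_trace_le:
  assumes "finite I" "finite J" "pos_kernel I A" "orthonormal I J u"
  shows "(\<Sum>j\<in>J. Re (sform I A (u j) (u j))) \<le> Re (kernel_trace I A)"
proof -
  have "0 \<le> kernel_pair I (transpose_kernel A) (residual_kernel J u)"
    by (intro kernel_pair_nonneg pos_kernel_transpose pos_kernel_residual assms)
  also have "\<dots> = kernel_trace I (transpose_kernel A) - (\<Sum>j\<in>J. sform I A (u j) (u j))"
    using kernel_pair_transpose_dyad[of I A J "\<lambda>_. 1" u u]
    by (simp add: residual_kernel_def kernel_pair_diff_right kernel_pair_id[OF assms(1)])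
  finally show ?thesis by (simp add: complex_nonneg_iff kernel_trace_def transpose_kernel_def)
qed

section \<open>Matrices as kernels\<close>

abbreviation grid :: "nat \<Rightarrow> nat \<Rightarrow> (nat \<times> nat) set" where
  "grid r n \<equiv> {..<r} \<times> {..<n}"

definition bip_kernel :: "nat \<Rightarrow> complex mat \<Rightarrow> (nat \<times> nat) kernel" where
  "bip_kernel n A p q = A $$ (fst p * n + snd p, fst q * n + snd q)"

definition mat_of_kernel :: "nat \<Rightarrow> nat \<Rightarrow> (nat \<times> nat) kernel \<Rightarrow> complex mat" where
  "mat_of_kernel r n C = mat (r * n) (r * n) (\<lambda>(p, q). C (p div n, p mod n) (q div n, q mod n))"

lemma pair_index_less:
  assumes "i < r" "a < n"
  shows "i * n + a < r * (n :: nat)"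
proof -
  have "i * n + a < Suc i * n" using assms(2) by simp
  also have "\<dots> \<le> r * n" using assms(1) by (intro mult_le_mono1) simp
  finally show ?thesis .
qed

lemma div_mod_less:
  assumes "p < r * (n :: nat)"
  shows "p div n < r" "p mod n < n"
  using assms by (cases "n = 0"; simp add: less_mult_imp_div_less)+

lemma sum_pair_index: "(\<Sum>p<r * n. f p) = (\<Sum>z\<in>grid r n. f (fst z * n + snd z :: nat))"
  by (rule sum.reindex_bij_witness[where i = "\<lambda>z. fst z * n + snd z" and j = "\<lambda>p. (p div n, p mod n)"])
     (auto simp: div_mod_less pair_index_less)

lemma all_pair_index: "(\<forall>a<r * n. P a) \<longleftrightarrow> (\<forall>z\<in>grid r n. P (fst z * n + snd z :: nat))"
proof (intro iffI allI impI)
  fix a assume all: "\<forall>z\<in>grid r n. P (fst z * n + snd z)" and a_less: "a < r * n"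
  have "(a div n, a mod n) \<in> grid r n" using div_mod_less[OF a_less] by simp
  from all[rule_format, OF this] show "P a" by simp
qed (auto simp: pair_index_less)

lemma bip_kernel_one: "kernel_eq (grid r n) (bip_kernel n (1\<^sub>m (r * n))) id_kernel"
proof (rule kernel_eqI)
  fix p q assume pq: "p \<in> grid r n" "q \<in> grid r n"
  have "fst z = (fst z * n + snd z) div n" "snd z = (fst z * n + snd z) mod n" if "z \<in> grid r n"
    for z :: "nat \<times> nat"
    using that by auto
  then have "fst p * n + snd p = fst q * n + snd q \<longleftrightarrow> p = q" using pq by (metis prod.expand)
  then show "bip_kernel n (1\<^sub>m (r * n)) p q = id_kernel p q"
    using pq by (auto simp: bip_kernel_def id_kernel_def pair_index_less)
qed

lemma mat_of_kernel_carrier [simp]: "mat_of_kernel r n C \<in> carrier_mat (r * n) (r * n)"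
  by (simp add: mat_of_kernel_def)

lemma bip_kernel_mat_of_kernel: "kernel_eq (grid r n) (bip_kernel n (mat_of_kernel r n C)) C"
  by (auto simp: kernel_eq_def bip_kernel_def mat_of_kernel_def pair_index_less)

lemma mat_of_kernel_bip_kernel: "A \<in> carrier_mat (r * n) (r * n) \<Longrightarrow> mat_of_kernel r n (bip_kernel n A) = A"
  by (intro eq_matI) (auto simp: mat_of_kernel_def bip_kernel_def)

lemma mat_of_kernel_cong:
  assumes "kernel_eq (grid r n) C D"
  shows "mat_of_kernel r n C = mat_of_kernel r n D"
  unfolding mat_of_kernel_def using assms
  by (intro cong_mat refl) (auto simp: kernel_eq_def div_mod_less)

lemma eq_mat_bip_kernelI:
  "A \<in> carrier_mat (r * n) (r * n) \<Longrightarrow> B \<in> carrier_mat (r * n) (r * n) \<Longrightarrow>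
    kernel_eq (grid r n) (bip_kernel n A) (bip_kernel n B) \<Longrightarrow> A = B"
  using mat_of_kernel_cong mat_of_kernel_bip_kernel by metis

lemma psd_carrier: "psd d A \<Longrightarrow> A \<in> carrier_mat d d"
  by (simp add: psd_def)

lemma psd_iff_pos_kernel: "psd d A \<longleftrightarrow> A \<in> carrier_mat d d \<and> pos_kernel {..<d} (\<lambda>i j. A $$ (i, j))"
proof (cases "A \<in> carrier_mat d d")
  case True
  have form: "(A *\<^sub>v v) \<bullet> conjugate v = sform {..<d} (\<lambda>i j. A $$ (i, j)) (\<lambda>i. v $ i) (\<lambda>i. v $ i)"
    if v_carrier: "v \<in> carrier_vec d" for v
  proof -
    have "(A *\<^sub>v v) \<bullet> conjugate v = (\<Sum>i<d. (\<Sum>j<d. A $$ (i,j) * v $ j) * cnj (v $ i))"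
      using True v_carrier by (auto simp: scalar_prod_def atLeast0LessThan intro!: sum.cong)
    then show ?thesis by (simp add: sform_def sum_distrib_left sum_distrib_right mult_ac)
  qed
  have vec: "sform {..<d} B v v = sform {..<d} B (\<lambda>i. vec d v $ i) (\<lambda>i. vec d v $ i)" for B v
    unfolding sform_def by simp
  have "(\<forall>v\<in>carrier_vec d. 0 \<le> sform {..<d} B (\<lambda>i. v $ i) (\<lambda>i. v $ i)) \<longleftrightarrow> pos_kernel {..<d} B" for B
    unfolding pos_kernel_def by (metis vec vec_carrier)
  then show ?thesis
    using True by (simp add: psd_def form complex_nonneg_iff complex_is_Real_iff)
qed (simp add: psd_def)

lemma psd_iff_bip_kernel:
  "psd (r * n) A \<longleftrightarrow> A \<in> carrier_mat (r * n) (r * n) \<and> pos_kernel (grid r n) (bip_kernel n A)"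
proof -
  have "pos_kernel (grid r n) (bip_kernel n A)" if "pos_kernel {..<r * n} (\<lambda>i j. A $$ (i, j))"
    unfolding bip_kernel_def[abs_def]
    by (rule pos_kernel_pullback[OF _ that, of "\<lambda>p. fst p * n + snd p"]) (auto simp: pair_index_less)
  moreover have "pos_kernel {..<r * n} (\<lambda>i j. A $$ (i, j))" if "pos_kernel (grid r n) (bip_kernel n A)"
  proof -
    have "pos_kernel {..<r * n} (\<lambda>p q. bip_kernel n A (p div n, p mod n) (q div n, q mod n))"
      by (rule pos_kernel_pullback[OF _ that]) (auto simp: div_mod_less)
    then show ?thesis by (simp add: bip_kernel_def)
  qed
  ultimately show ?thesis unfolding psd_iff_pos_kernel by blast
qed

lemma psd_mat_of_kernel: "pos_kernel (grid r n) C \<Longrightarrow> psd (r * n) (mat_of_kernel r n C)"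
  unfolding psd_iff_bip_kernel
  using pos_kernel_cong[of "grid r n" C "bip_kernel n (mat_of_kernel r n C)"]
    bip_kernel_mat_of_kernel[of r n C]
  by (simp add: kernel_eq_def)

lemma mtrace_bip_kernel:
  "A \<in> carrier_mat (r * n) (r * n) \<Longrightarrow> mtrace A = kernel_trace (grid r n) (bip_kernel n A)"
  by (simp add: mtrace_def sum_pair_index bip_kernel_def kernel_trace_def)

lemma mtrace_mat_of_kernel: "mtrace (mat_of_kernel r n C) = kernel_trace (grid r n) C"
  unfolding mtrace_bip_kernel[OF mat_of_kernel_carrier]
  by (rule kernel_trace_cong[OF bip_kernel_mat_of_kernel])

lemma mtrace_mult_bip_kernel:
  assumes "A \<in> carrier_mat (r * n) (r * n)" "B \<in> carrier_mat (r * n) (r * n)"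
  shows "mtrace (A * B) = kernel_pair (grid r n) (bip_kernel n A) (transpose_kernel (bip_kernel n B))"
  unfolding mtrace_mult[OF assms] kernel_pair_def sum_pair_index bip_kernel_def transpose_kernel_def ..

lemma mat_adjoint_index:
  assumes "A \<in> carrier_mat n m" "i < m" "j < n"
  shows "mat_adjoint A $$ (i, j) = cnj (A $$ (j, i))"
  using assms by (simp add: mat_adjoint_def mat_of_rows_def)

lemma mat_adjoint_carrier: "A \<in> carrier_mat n m \<Longrightarrow> mat_adjoint A \<in> carrier_mat m n"
  by (simp add: mat_adjoint_def mat_of_rows_def)

lemma bip_kernel_mult:
  assumes "A \<in> carrier_mat (r * n) (r * n)" "B \<in> carrier_mat (r * n) (r * n)"
  shows "kernel_eq (grid r n) (bip_kernel n (A * B))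
      (kernel_mult (grid r n) (bip_kernel n A) (bip_kernel n B))"
proof (rule kernel_eqI)
  fix p q assume "p \<in> grid r n" "q \<in> grid r n"
  then have "bip_kernel n (A * B) p q =
      (\<Sum>k<r * n. A $$ (fst p * n + snd p, k) * B $$ (k, fst q * n + snd q))"
    using assms by (auto simp: bip_kernel_def pair_index_less scalar_prod_def atLeast0LessThan)
  then show "bip_kernel n (A * B) p q = kernel_mult (grid r n) (bip_kernel n A) (bip_kernel n B) p q"
    by (simp add: sum_pair_index kernel_mult_def bip_kernel_def)
qed

lemma bip_kernel_adjoint:
  "A \<in> carrier_mat (r * n) (r * n) \<Longrightarrow>
      kernel_eq (grid r n) (bip_kernel n (mat_adjoint A)) (adjoint_kernel (bip_kernel n A))"
  by (auto simp: kernel_eq_def bip_kernel_def adjoint_kernel_def mat_adjoint_index pair_index_less)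

lemma bip_kernel_gram:
  assumes "A \<in> carrier_mat (r * n) (r * n)"
  shows "kernel_eq (grid r n) (bip_kernel n (mat_adjoint A * A)) (gram_kernel (grid r n) (bip_kernel n A))"
  unfolding gram_kernel_def
  using bip_kernel_mult[OF mat_adjoint_carrier[OF assms] assms]
    kernel_mult_cong[OF bip_kernel_adjoint[OF assms] kernel_eqI[OF refl]]
  by (auto simp: kernel_eq_def)

lemma bip_kernel_square_psd:
  assumes "psd (r * n) B"
  shows "kernel_eq (grid r n) (bip_kernel n (B * B)) (gram_kernel (grid r n) (bip_kernel n B))"
proof -
  have B_carrier: "B \<in> carrier_mat (r * n) (r * n)" and "pos_kernel (grid r n) (bip_kernel n B)"
    using assms by (auto simp: psd_iff_bip_kernel)
  then have "kernel_eq (grid r n) (bip_kernel n B) (adjoint_kernel (bip_kernel n B))"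
    using pos_kernel_herm[of "grid r n" "bip_kernel n B"]
    by (simp add: kernel_eq_def adjoint_kernel_def herm_kernel_def)
  from kernel_mult_cong[OF this kernel_eqI[OF refl]] bip_kernel_mult[OF B_carrier B_carrier] show ?thesis
    by (auto simp: kernel_eq_def gram_kernel_def)
qed

section \<open>The trace norm\<close>

lemma trace_norm_eqI:
  assumes A_carrier: "A \<in> carrier_mat (r * n) (r * n)" and pos_B: "pos_kernel (grid r n) B"
    and gram: "kernel_eq (grid r n) (gram_kernel (grid r n) B) (gram_kernel (grid r n) (bip_kernel n A))"
  shows "trace_norm A = Re (kernel_trace (grid r n) B)"
proof -
  define M where "M = mat_of_kernel r n B"
  have psd_M: "psd (r * n) M" unfolding M_def by (rule psd_mat_of_kernel[OF pos_B])
  have gram_iff: "C * C = mat_adjoint A * A \<longleftrightarrow>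
      kernel_eq (grid r n) (gram_kernel (grid r n) (bip_kernel n C)) (gram_kernel (grid r n) B)"
    if psd_C: "psd (r * n) C" for C
  proof -
    have "C * C \<in> carrier_mat (r * n) (r * n)" "mat_adjoint A * A \<in> carrier_mat (r * n) (r * n)"
      using psd_carrier[OF psd_C] A_carrier mat_adjoint_carrier[OF A_carrier] by auto
    then have "C * C = mat_adjoint A * A \<longleftrightarrow>
        kernel_eq (grid r n) (bip_kernel n (C * C)) (bip_kernel n (mat_adjoint A * A))"
      using eq_mat_bip_kernelI[of "C * C" r n "mat_adjoint A * A"] by (auto simp: kernel_eq_def)
    then show ?thesis
      using bip_kernel_square_psd[OF psd_C] bip_kernel_gram[OF A_carrier] gram by (simp add: kernel_eq_def)
  qed
  have "(THE C. psd (dim_col A) C \<and> C * C = mat_adjoint A * A) = M"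
  proof (rule the_equality)
    show "psd (dim_col A) M \<and> M * M = mat_adjoint A * A"
      using A_carrier psd_M gram_iff[OF psd_M] gram_kernel_cong[OF bip_kernel_mat_of_kernel[of r n B]]
      by (simp add: M_def)
    fix C assume "psd (dim_col A) C \<and> C * C = mat_adjoint A * A"
    then have psd_C: "psd (r * n) C" and "C * C = mat_adjoint A * A" using A_carrier by auto
    then have "kernel_eq (grid r n) (bip_kernel n C) B"
      using gram_iff[OF psd_C] psd_C
      by (intro pos_kernel_eq_if_gram_eq[OF _ _ pos_B]) (auto simp: psd_iff_bip_kernel)
    then have "mat_of_kernel r n (bip_kernel n C) = M" unfolding M_def by (rule mat_of_kernel_cong)
    then show "C = M" by (simp add: mat_of_kernel_bip_kernel[OF psd_carrier[OF psd_C]])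
  qed
  then show ?thesis by (simp add: trace_norm_def M_def mtrace_mat_of_kernel)
qed

lemma trace_norm_singular_decomposition:
  assumes "A \<in> carrier_mat (r * n) (r * n)" "singular_decomposition (grid r n) (bip_kernel n A) J s u v"
  shows "trace_norm A = (\<Sum>j\<in>J. s j)"
proof -
  note decomposition = singular_decompositionD[OF assms(2)]
  have "singular_decomposition (grid r n) (dyad_kernel J s v v) J s v v"
    using decomposition by (simp add: singular_decomposition_def kernel_eq_def)
  from gram_kernel_singular_decomposition[OF this] gram_kernel_singular_decomposition[OF assms(2)]
  have "trace_norm A = Re (kernel_trace (grid r n) (dyad_kernel J s v v))"
    by (intro trace_norm_eqI[OF assms(1)] pos_kernel_dyad decomposition(2)) (simp_all add: kernel_eq_def)
  then show ?thesis by (simp add: kernel_trace_dyad_orthonormal[OF decomposition(4)])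
qed

lemma trace_norm_spectral_decomposition:
  assumes "A \<in> carrier_mat (r * n) (r * n)" "spectral_decomposition (grid r n) (bip_kernel n A) a v"
  shows "trace_norm A = (\<Sum>j<card (grid r n). \<bar>a j\<bar>)"
  by (rule trace_norm_singular_decomposition[OF assms(1) singular_decomposition_spectral[OF assms(2)]])

lemma trace_norm_psd:
  assumes "psd (r * n) A"
  shows "trace_norm A = Re (mtrace A)"
  using assms trace_norm_eqI[of A r n "bip_kernel n A"] mtrace_bip_kernel[of A r n]
  by (simp add: psd_iff_bip_kernel kernel_eq_def)

lemma trace_norm_nonneg:
  assumes "A \<in> carrier_mat (r * n) (r * n)"
  shows "0 \<le> trace_norm A"
proof -
  obtain J s u v where "singular_decomposition (grid r n) (bip_kernel n A) J s u v"
    using singular_decomposition_exists[of "grid r n" "bip_kernel n A"] by blast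
  then show ?thesis
    using trace_norm_singular_decomposition[OF assms]
    by (auto simp: singular_decomposition_def intro: sum_nonneg)
qed

lemma trace_norm_zero: "trace_norm (0\<^sub>m (r * n) (r * n)) = 0"
proof -
  have "psd (r * n) (0\<^sub>m (r * n) (r * n))"
    by (simp add: psd_iff_pos_kernel pos_kernel_cong[OF pos_kernel_zero] kernel_eq_def)
  from trace_norm_psd[OF this] show ?thesis by (simp add: mtrace_def)
qed

lemma kernel_pair_le_half_trace_norm:
  assumes D_carrier: "D \<in> carrier_mat (r * n) (r * n)" and herm: "herm_kernel (grid r n) (bip_kernel n D)"
    and traceless: "kernel_trace (grid r n) (bip_kernel n D) = 0"
    and T_effect: "pos_kernel (grid r n) T" "kernel_le (grid r n) T id_kernel"
  shows "Re (kernel_pair (grid r n) T (bip_kernel n D)) \<le> trace_norm D / 2"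
proof -
  let ?I = "grid r n"
  obtain a v where spec: "spectral_decomposition ?I (bip_kernel n D) a v"
    using herm_kernel_spectral_decomposition[OF _ herm] by auto
  note orth = spectral_decompositionD(1)[OF spec] and decomposition = spectral_decompositionD(2)[OF spec]
  define P where "P = dyad_kernel {..<card ?I} (\<lambda>j. max 0 (a j)) v v"
  have pos_P: "pos_kernel ?I P" unfolding P_def by (rule pos_kernel_dyad) simp
  have "complex_of_real (\<Sum>j<card ?I. a j) = 0"
    unfolding kernel_trace_dyad_orthonormal[OF orth, symmetric]
        kernel_trace_cong[OF decomposition, symmetric]
    by (rule traceless)
  then have sum_0: "(\<Sum>j<card ?I. a j) = 0" by (simp only: of_real_eq_0_iff)
  have "pos_kernel ?I (dyad_kernel {..<card ?I} (\<lambda>j. max 0 (a j) - a j) v v)" by (rule pos_kernel_dyad) simp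
  then have "kernel_le ?I (bip_kernel n D) P"
    unfolding kernel_le_def
    by (rule pos_kernel_cong)
      (use decomposition in \<open>simp add: kernel_eq_def P_def dyad_kernel_def left_diff_distrib sum_subtractf\<close>)
  then have "Re (kernel_pair ?I T (bip_kernel n D)) \<le> Re (kernel_pair ?I T P)"
    by (intro kernel_pair_mono T_effect(1)) auto
  also have "\<dots> \<le> Re (kernel_pair ?I P id_kernel)"
    unfolding kernel_pair_commute[of _ T] by (rule kernel_pair_mono[OF _ pos_P T_effect(2)]) simp
  also have "\<dots> = (\<Sum>j<card ?I. max 0 (a j))"
    using kernel_trace_dyad_orthonormal[OF orth] by (simp add: kernel_pair_id P_def)
  also have "\<dots> = (\<Sum>j<card ?I. (\<bar>a j\<bar> + a j) / 2)" by (intro sum.cong refl) auto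
  also have "\<dots> = trace_norm D / 2"
    using sum_0
    by (simp add: trace_norm_spectral_decomposition[OF D_carrier spec] sum.distrib flip: sum_divide_distrib)
  finally show ?thesis .
qed

text \<open>The trace norm of \<open>X\<close> is the least half trace of a positive block matrix with off-diagonal block
  \<open>X\<close>, and completely positive maps preserve such matrices.\<close>

definition block_kernel :: "bool \<Rightarrow> bool \<Rightarrow> ('a \<times> 'b \<times> bool) kernel \<Rightarrow> ('a \<times> 'b) kernel" where
  "block_kernel e f Z p q = Z (fst p, snd p, e) (fst q, snd q, f)"

lemma pos_kernel_block:
  assumes "finite R" "finite N" "pos_kernel (R \<times> N \<times> UNIV) Z"
  shows "pos_kernel (R \<times> N) (block_kernel e e Z)"
  unfolding block_kernel_def[abs_def]
  by (rule pos_kernel_pullback[OF _ assms(3), of "\<lambda>p. (fst p, snd p, e)"]) (use assms in auto)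

lemma block_kernel_herm:
  "herm_kernel (R \<times> N \<times> UNIV) Z \<Longrightarrow>
      kernel_eq (R \<times> N) (block_kernel e f Z) (adjoint_kernel (block_kernel f e Z))"
  by (simp add: kernel_eq_def herm_kernel_def adjoint_kernel_def block_kernel_def)

lemma sum_flagged: "(\<Sum>z\<in>R \<times> N \<times> UNIV. f z) = (\<Sum>p\<in>R \<times> N. f (fst p, snd p, False) + f (fst p, snd p, True))"
  unfolding sum.cartesian_product' by (simp add: UNIV_bool)

lemma sform_flagged:
  "sform (R \<times> N \<times> UNIV) Z x x =
    (\<Sum>e\<in>UNIV. \<Sum>f\<in>UNIV. sform (R \<times> N) (block_kernel e f Z) (\<lambda>p. x (fst p, snd p, e))
        (\<lambda>p. x (fst p, snd p, f)))"
  unfolding sform_def sum_flagged by (simp add: block_kernel_def UNIV_bool sum.distrib)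

lemma trace_norm_block_attained:
  assumes "X \<in> carrier_mat (r * n) (r * n)"
  obtains Z where "pos_kernel ({..<r} \<times> {..<n} \<times> UNIV) Z"
    "kernel_eq (grid r n) (block_kernel False True Z) (bip_kernel n X)"
    "\<And>e. kernel_trace (grid r n) (block_kernel e e Z) = of_real (trace_norm X)"
proof -
  obtain J s u v where decomposition: "singular_decomposition (grid r n) (bip_kernel n X) J s u v"
    using singular_decomposition_exists[of "grid r n" "bip_kernel n X"] by blast
  note decompositionD = singular_decompositionD[OF decomposition]
  define y where "y j z = (if snd (snd z) then v j else u j) (fst z, fst (snd z))" for j
    and z :: "nat \<times> nat \<times> bool"
  define Z where "Z = dyad_kernel J s y y"
  have block: "block_kernel e f Z = dyad_kernel J s (if e then v else u) (if f then v else u)" for e f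
    by (auto simp: fun_eq_iff block_kernel_def Z_def dyad_kernel_def y_def intro!: sum.cong)
  show ?thesis
  proof (rule that)
    show "pos_kernel ({..<r} \<times> {..<n} \<times> UNIV) Z" unfolding Z_def
      by (rule pos_kernel_dyad[OF decompositionD(2)])
    show "kernel_eq (grid r n) (block_kernel False True Z) (bip_kernel n X)"
      unfolding block using decompositionD(5) by (simp add: kernel_eq_def)
    show "kernel_trace (grid r n) (block_kernel e e Z) = of_real (trace_norm X)" for e
      unfolding block trace_norm_singular_decomposition[OF assms decomposition]
      using kernel_trace_dyad_orthonormal[OF decompositionD(3)]
          kernel_trace_dyad_orthonormal[OF decompositionD(4)] by simp
  qed
qed

lemma trace_norm_block_le:
  assumes Y_carrier: "Y \<in> carrier_mat (r * n) (r * n)" and pos_Z: "pos_kernel ({..<r} \<times> {..<n} \<times> UNIV) Z"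
    and off: "kernel_eq (grid r n) (block_kernel False True Z) (bip_kernel n Y)"
  shows "2 * trace_norm Y \<le> Re (kernel_trace (grid r n) (block_kernel False False Z)) +
    Re (kernel_trace (grid r n) (block_kernel True True Z))"
proof -
  let ?I = "grid r n"
  obtain J s u v where decomposition: "singular_decomposition ?I (bip_kernel n Y) J s u v"
    using singular_decomposition_exists[of ?I "bip_kernel n Y"] by blast
  note decompositionD = singular_decompositionD[OF decomposition]
  have "2 * s j \<le> Re (sform ?I (block_kernel False False Z) (u j) (u j)) +
      Re (sform ?I (block_kernel True True Z) (v j) (v j))"
    if "j \<in> J" for j
  proof -
    define x where "x z = (if snd (snd z) then - v j (fst z, fst (snd z)) else u j (fst z, fst (snd z)))"
      for z :: "nat \<times> nat \<times> bool"
    have upper: "sform ?I (block_kernel False True Z) (u j) (v j) = of_real (s j)"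
      unfolding sform_cong[OF off] by (rule sform_singular_decomposition[OF decomposition that])
    have herm: "herm_kernel ({..<r} \<times> {..<n} \<times> UNIV) Z" by (rule pos_kernel_herm[OF _ pos_Z]) simp
    have lower: "sform ?I (block_kernel True False Z) (v j) (u j) = of_real (s j)"
      unfolding sform_cong[OF block_kernel_herm[OF herm, of True False]] cnj_sform[symmetric] upper by simp
    have "sform ?I B (\<lambda>p. - v j p) w = - sform ?I B (v j) w"
      "sform ?I B w (\<lambda>p. - v j p) = - sform ?I B w (v j)" for B w
      by (simp_all add: sform_def sum_negf)
    then have "sform ({..<r} \<times> {..<n} \<times> UNIV) Z x x =
        sform ?I (block_kernel False False Z) (u j) (u j) - 2 * of_real (s j) +
            sform ?I (block_kernel True True Z) (v j) (v j)"
      unfolding sform_flagged by (simp add: UNIV_bool x_def upper lower)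
    moreover have "0 \<le> sform ({..<r} \<times> {..<n} \<times> UNIV) Z x x" using pos_Z by (simp add: pos_kernel_def)
    ultimately show ?thesis by (simp add: complex_nonneg_iff)
  qed
  then have "2 * trace_norm Y \<le> (\<Sum>j\<in>J. Re (sform ?I (block_kernel False False Z) (u j) (u j))) +
      (\<Sum>j\<in>J. Re (sform ?I (block_kernel True True Z) (v j) (v j)))"
    unfolding trace_norm_singular_decomposition[OF Y_carrier decomposition] sum_distrib_left
        sum.distrib[symmetric]
    by (rule sum_mono)
  also have "\<dots> \<le> Re (kernel_trace ?I (block_kernel False False Z)) +
      Re (kernel_trace ?I (block_kernel True True Z))"
    by (intro add_mono bessel_trace_le pos_kernel_block pos_Z decompositionD) auto
  finally show ?thesis .
qed

section \<open>Linear maps and their Choi kernels\<close>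

definition has_kernel :: "nat \<Rightarrow> nat \<Rightarrow> cmap \<Rightarrow> (nat \<times> nat) kernel \<Rightarrow> bool" where
  "has_kernel m n \<phi> F \<longleftrightarrow> (\<forall>X\<in>carrier_mat m m. \<phi> X \<in> carrier_mat n n \<and>
     (\<forall>a<n. \<forall>b<n. \<phi> X $$ (a, b) = (\<Sum>i<m. \<Sum>j<m. X $$ (i, j) * F (i, a) (j, b))))"

definition choi_kernel :: "nat \<Rightarrow> cmap \<Rightarrow> (nat \<times> nat) kernel" where
  "choi_kernel d \<phi> p q = \<phi> (munit d (fst p) (fst q)) $$ (snd p, snd q)"

definition map_of_kernel :: "nat \<Rightarrow> nat \<Rightarrow> (nat \<times> nat) kernel \<Rightarrow> cmap" where
  "map_of_kernel r n c X = mat n n (\<lambda>(a, b). \<Sum>i<r. \<Sum>j<r. X $$ (i, j) * c (i, a) (j, b))"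

lemma munit_carrier [simp]: "munit d i j \<in> carrier_mat d d"
  by (simp add: munit_def)

lemma mtrace_munit: "i < d \<Longrightarrow> mtrace (munit d i j) = of_bool (i = j)"
  by (simp add: mtrace_def munit_def if_distrib cong: if_cong)

lemma sum_munit:
  assumes "i < d" "j < d"
  shows "(\<Sum>x<d. \<Sum>y<d. munit d i j $$ (x, y) * f x y) = f i j"
proof -
  have "(\<Sum>x<d. \<Sum>y<d. munit d i j $$ (x, y) * f x y) =
      (\<Sum>x<d. \<Sum>y<d. if y = j then if x = i then f i j else 0 else 0)"
    by (intro sum.cong refl) (auto simp: munit_def)
  then show ?thesis using assms by simp
qed

lemma has_kernelD:
  assumes "has_kernel m n \<phi> F" "X \<in> carrier_mat m m"
  shows "\<phi> X \<in> carrier_mat n n"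
    "a < n \<Longrightarrow> b < n \<Longrightarrow> \<phi> X $$ (a, b) = (\<Sum>i<m. \<Sum>j<m. X $$ (i, j) * F (i, a) (j, b))"
  using assms by (auto simp: has_kernel_def)

lemma lin_map_has_kernel:
  assumes lin: "lin_map m n \<phi>"
  shows "has_kernel m n \<phi> (choi_kernel m \<phi>)"
  unfolding has_kernel_def
proof (intro ballI conjI allI impI)
  have out: "\<phi> A \<in> carrier_mat n n" if "A \<in> carrier_mat m m" for A
    using lin that by (simp add: lin_map_def)
  fix X :: "complex mat" assume X_carrier: "X \<in> carrier_mat m m"
  then show "\<phi> X \<in> carrier_mat n n" by (rule out)
  fix a b assume ab: "a < n" "b < n"
  define restrict where "restrict S = mat m m (\<lambda>z. if z \<in> S then X $$ z else 0)" for S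
  have restrict_carrier: "restrict S \<in> carrier_mat m m" for S by (simp add: restrict_def)
  have restricted: "\<phi> (restrict S) $$ (a, b) = (\<Sum>z\<in>S. X $$ z * choi_kernel m \<phi> (fst z, a) (snd z, b))"
    if "finite S" "S \<subseteq> grid m m" for S
    using that
  proof (induction S rule: finite_induct)
    case empty
    have "restrict {} = 0 \<cdot>\<^sub>m X" using X_carrier by (intro eq_matI) (auto simp: restrict_def)
    then have "\<phi> (restrict {}) = 0 \<cdot>\<^sub>m \<phi> X" using lin X_carrier by (simp add: lin_map_def)
    then show ?case using out[OF X_carrier] ab by simp
  next
    case (insert z S)
    obtain i j where z_eq: "z = (i, j)" by (cases z)
    have "restrict (insert z S) = restrict S + X $$ z \<cdot>\<^sub>m munit m i j"
      using insert.hyps insert.prems X_carrier by (intro eq_matI) (auto simp: restrict_def munit_def z_eq)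
    then have "\<phi> (restrict (insert z S)) = \<phi> (restrict S) + X $$ z \<cdot>\<^sub>m \<phi> (munit m i j)"
      using lin restrict_carrier by (simp add: lin_map_def)
    then have "\<phi> (restrict (insert z S)) $$ (a, b) =
        \<phi> (restrict S) $$ (a, b) + X $$ z * \<phi> (munit m i j) $$ (a, b)"
      using out[OF restrict_carrier, of S] out[of "munit m i j"] ab by simp
    then show ?case using insert by (simp add: choi_kernel_def z_eq)
  qed
  have "\<phi> (restrict (grid m m)) $$ (a, b) = (\<Sum>i<m. \<Sum>j<m. X $$ (i, j) * choi_kernel m \<phi> (i, a) (j, b))"
    using restricted[of "grid m m"] by (simp add: sum.cartesian_product')
  moreover have "restrict (grid m m) = X" using X_carrier by (intro eq_matI) (auto simp: restrict_def)
  ultimately show "\<phi> X $$ (a, b) = (\<Sum>i<m. \<Sum>j<m. X $$ (i, j) * choi_kernel m \<phi> (i, a) (j, b))" by simp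
qed

lemma has_kernel_lin_map:
  assumes "has_kernel m n \<phi> F"
  shows "lin_map m n \<phi>"
  unfolding lin_map_def
proof (intro conjI ballI allI)
  note out = has_kernelD(1)[OF assms] and entry = has_kernelD(2)[OF assms]
  fix A :: "complex mat" assume A_carrier: "A \<in> carrier_mat m m"
  show "\<phi> A \<in> carrier_mat n n" by (rule out[OF A_carrier])
  show "\<phi> (A + B) = \<phi> A + \<phi> B" if B_carrier: "B \<in> carrier_mat m m" for B
    using out[of A] out[of B] out[of "A + B"] A_carrier B_carrier
    by (intro eq_matI) (auto simp: entry distrib_right sum.distrib)
  show "\<phi> (c \<cdot>\<^sub>m A) = c \<cdot>\<^sub>m \<phi> A" for c
    using out[of A] out[of "c \<cdot>\<^sub>m A"] A_carrier
    by (intro eq_matI) (auto simp: entry mult.assoc sum_distrib_left)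
qed

lemma has_kernel_choi_kernel:
  assumes "has_kernel m n \<phi> F"
  shows "kernel_eq (grid m n) F (choi_kernel m \<phi>)"
  unfolding kernel_eq_def
proof (intro ballI)
  fix p q assume "p \<in> grid m n" "q \<in> grid m n"
  then show "F p q = choi_kernel m \<phi> p q"
    using has_kernelD(2)[OF assms munit_carrier[of m "fst p" "fst q"], of "snd p" "snd q"]
      sum_munit[of "fst p" m "fst q" "\<lambda>i j. F (i, snd p) (j, snd q)"]
    by (auto simp: choi_kernel_def)
qed

lemma has_kernel_map_of_kernel: "has_kernel r n (map_of_kernel r n c) c"
  by (simp add: has_kernel_def map_of_kernel_def)

lemma has_kernel_comp:
  assumes "has_kernel r m \<alpha> c" "has_kernel m n \<phi> d"
  shows "has_kernel r n (\<lambda>X. \<phi> (\<alpha> X)) (choi_comp {..<m} c d)"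
  unfolding has_kernel_def
proof (intro ballI conjI allI impI)
  fix X :: "complex mat" assume X_carrier: "X \<in> carrier_mat r r"
  note \<alpha>_app = has_kernelD[OF assms(1) X_carrier]
  show "\<phi> (\<alpha> X) \<in> carrier_mat n n" by (rule has_kernelD(1)[OF assms(2) \<alpha>_app(1)])
  fix a b assume ab: "a < n" "b < n"
  have "\<phi> (\<alpha> X) $$ (a, b) = (\<Sum>x<m. \<Sum>y<m. \<Sum>i<r. \<Sum>j<r. X $$ (i, j) * c (i, x) (j, y) * d (x, a) (y, b))"
    using has_kernelD(2)[OF assms(2) \<alpha>_app(1) ab] by (simp add: \<alpha>_app(2) sum_distrib_right)
  also have "\<dots> = (\<Sum>i<r. \<Sum>j<r. \<Sum>x<m. \<Sum>y<m. X $$ (i, j) * c (i, x) (j, y) * d (x, a) (y, b))"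
    by (subst sum_rotate3, subst sum_rotate3) (rule refl)
  also have "\<dots> = (\<Sum>i<r. \<Sum>j<r. X $$ (i, j) * choi_comp {..<m} c d (i, a) (j, b))"
    by (simp add: choi_comp_def link_kernel_def swap_kernel_def sum_distrib_left mult.assoc)
  finally show "\<phi> (\<alpha> X) $$ (a, b) = (\<Sum>i<r. \<Sum>j<r. X $$ (i, j) * choi_comp {..<m} c d (i, a) (j, b))" .
qed

lemma has_kernel_diff:
  assumes "has_kernel m n \<phi> F" "has_kernel m n \<psi> G"
  shows "has_kernel m n (\<lambda>X. \<phi> X - \<psi> X) (F - G)"
  unfolding has_kernel_def
proof (intro ballI)
  fix X :: "complex mat" assume X_carrier: "X \<in> carrier_mat m m"
  show "\<phi> X - \<psi> X \<in> carrier_mat n n \<and> (\<forall>a<n. \<forall>b<n. (\<phi> X - \<psi> X) $$ (a, b) =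
      (\<Sum>i<m. \<Sum>j<m. X $$ (i, j) * (F - G) (i, a) (j, b)))"
    using has_kernelD[OF assms(1) X_carrier] has_kernelD[OF assms(2) X_carrier]
    by (auto simp: right_diff_distrib sum_subtractf minus_carrier_mat)
qed

lemma bip_kernel_tensor_id:
  assumes "has_kernel m n \<phi> F"
  shows "kernel_eq (grid n r) (bip_kernel r (tensor_id m n r \<phi> X)) (link_kernel {..<m} F (bip_kernel r X))"
  by (auto simp: kernel_eq_def bip_kernel_def tensor_id_def pair_index_less link_kernel_def
      has_kernelD(2)[OF assms] mult.commute)

lemma bip_kernel_id_tensor:
  assumes "has_kernel m n \<phi> F"
  shows "kernel_eq (grid r n) (bip_kernel n (id_tensor r m n \<phi> X)) (choi_comp {..<m} (bip_kernel m X) F)"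
  by (auto simp: kernel_eq_def bip_kernel_def id_tensor_def pair_index_less choi_comp_def link_kernel_def
      swap_kernel_def has_kernelD(2)[OF assms])

lemma tensor_id_carrier [simp]: "tensor_id m n r \<phi> X \<in> carrier_mat (n * r) (n * r)"
  by (simp add: tensor_id_def)

lemma id_tensor_carrier [simp]: "id_tensor r m n \<phi> X \<in> carrier_mat (r * n) (r * n)"
  by (simp add: id_tensor_def)

lemma bip_kernel_max_ent: "kernel_eq (grid d d) (bip_kernel d (max_ent d)) choi_id"
  by (auto simp: kernel_eq_def bip_kernel_def max_ent_def choi_id_def rank_one_kernel_def pair_index_less)

lemma psd_max_ent: "psd (d * d) (max_ent d)"
proof -
  have "pos_kernel (grid d d) choi_id" unfolding choi_id_def by (rule pos_kernel_rank_one)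
  then have "pos_kernel (grid d d) (bip_kernel d (max_ent d))"
    by (rule pos_kernel_cong) (use bip_kernel_max_ent[of d] in \<open>simp add: kernel_eq_def\<close>)
  then show ?thesis by (simp add: psd_iff_bip_kernel max_ent_def)
qed

lemma bip_kernel_choi:
  assumes "has_kernel n r \<psi> F"
  shows "kernel_eq (grid r n) (bip_kernel n (choi n r \<psi>)) (swap_kernel F)"
proof -
  have "kernel_eq (grid r n) (link_kernel {..<n} F (bip_kernel n (max_ent n)))
      (choi_comp {..<n} (swap_kernel F) choi_id)"
    unfolding choi_comp_def swap_swap_kernel
    by (rule link_kernel_cong[OF kernel_eqI[OF refl] bip_kernel_max_ent])
  then show ?thesis
    using bip_kernel_tensor_id[OF assms, of n "max_ent n"]
      choi_comp_id_right[of "{..<n}" "{..<r}" "swap_kernel F"]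
    by (simp add: kernel_eq_def choi_def)
qed

lemma channel_has_kernel: "channel r n \<phi> \<Longrightarrow> has_kernel r n \<phi> (choi_kernel r \<phi>)"
  by (simp add: channel_def lin_map_has_kernel)

lemma channel_choi_kernel:
  assumes channel_\<phi>: "channel r n \<phi>"
  shows "channel_kernel {..<r} {..<n} (choi_kernel r \<phi>)"
  unfolding scaled_channel_kernel_def
proof
  note has_kernel_\<phi> = channel_has_kernel[OF channel_\<phi>]
  show "pos_kernel (grid r n) (choi_kernel r \<phi>)"
  proof (cases "r = 0")
    case False
    then have "psd (r * n) (id_tensor r r n \<phi> (max_ent r))"
      using channel_\<phi> psd_max_ent by (simp add: channel_def CP_map_def)
    then have "pos_kernel (grid r n) (bip_kernel n (id_tensor r r n \<phi> (max_ent r)))"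
      by (simp add: psd_iff_bip_kernel)
    moreover have "kernel_eq (grid r n) (choi_comp {..<r} (bip_kernel r (max_ent r)) (choi_kernel r \<phi>))
        (choi_comp {..<r} choi_id (choi_kernel r \<phi>))"
      by (rule choi_comp_cong[OF bip_kernel_max_ent kernel_eqI[OF refl]])
    ultimately show ?thesis
      using bip_kernel_id_tensor[OF has_kernel_\<phi>, of r "max_ent r"]
        choi_comp_id_left[of "{..<r}" "{..<n}" "choi_kernel r \<phi>"]
      by (elim pos_kernel_cong) (simp add: kernel_eq_def)
  qed (simp add: pos_kernel_def sform_def)
  have "partial_trace {..<n} (choi_kernel r \<phi>) i j = of_bool (i = j)" if "i < r" for i j
  proof -
    have "partial_trace {..<n} (choi_kernel r \<phi>) i j = mtrace (\<phi> (munit r i j))"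
      using has_kernelD(1)[OF has_kernel_\<phi> munit_carrier[of r i j]]
      by (simp add: mtrace_def partial_trace_def choi_kernel_def)
    also have "\<dots> = mtrace (munit r i j)" using channel_\<phi> by (simp add: channel_def TP_map_def)
    finally show ?thesis using mtrace_munit[OF that] by simp
  qed
  then show "kernel_eq {..<r} (partial_trace {..<n} (choi_kernel r \<phi>)) (1 \<cdot>\<^sub>k id_kernel)"
    by (simp add: kernel_eq_def scale_kernel_def id_kernel_def)
qed

lemma has_kernel_channel:
  assumes "has_kernel r n \<phi> c" "channel_kernel {..<r} {..<n} c"
  shows "channel r n \<phi>"
  unfolding channel_def
proof (intro conjI)
  show "lin_map r n \<phi>" by (rule has_kernel_lin_map[OF assms(1)])
  note channel_c = scaled_channel_kernelD[OF assms(2)]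
  show "CP_map r n \<phi>"
    unfolding CP_map_def
  proof (intro allI impI)
    fix m P assume psd_P: "psd (m * r) P"
    have "pos_kernel (grid m n) (choi_comp {..<r} (bip_kernel r P) c)"
      using psd_P by (intro pos_kernel_choi_comp channel_c(1)) (auto simp: psd_iff_bip_kernel)
    then have "pos_kernel (grid m n) (bip_kernel n (id_tensor m r n \<phi> P))"
      by (rule pos_kernel_cong) (use bip_kernel_id_tensor[OF assms(1), of m P] in \<open>simp add: kernel_eq_def\<close>)
    then show "psd (m * n) (id_tensor m r n \<phi> P)" by (simp add: psd_iff_bip_kernel)
  qed
  show "TP_map r n \<phi>"
    unfolding TP_map_def
  proof
    fix X :: "complex mat" assume X_carrier: "X \<in> carrier_mat r r"
    have "mtrace (\<phi> X) = (\<Sum>a<n. \<Sum>i<r. \<Sum>j<r. X $$ (i, j) * c (i, a) (j, a))"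
      using has_kernelD[OF assms(1) X_carrier] by (simp add: mtrace_def)
    also have "\<dots> = (\<Sum>i<r. \<Sum>j<r. X $$ (i, j) * partial_trace {..<n} c i j)"
      unfolding partial_trace_def sum_distrib_left by (rule sum_rotate3[symmetric])
    also have "\<dots> = (\<Sum>i<r. \<Sum>j<r. X $$ (i, j) * id_kernel i j)"
      using channel_c(2) by (simp add: kernel_eq_def scale_kernel_def)
    also have "\<dots> = mtrace X"
      using X_carrier by (simp add: mtrace_def id_kernel_def of_bool_def if_distrib cong: if_cong)
    finally show "mtrace (\<phi> X) = mtrace X" .
  qed
qed

lemma channel_map_of_kernel: "channel_kernel {..<r} {..<n} c \<Longrightarrow> channel r n (map_of_kernel r n c)"
  by (rule has_kernel_channel[OF has_kernel_map_of_kernel])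

lemma channel_exists: "0 < n \<Longrightarrow> \<exists>\<alpha>. channel r n \<alpha>"
  using channel_map_of_kernel[OF depolarising_channel_kernel[of "{..<r}" "{..<n}"]] by auto

lemma channel_herm_choi_kernel: "channel r n \<phi> \<Longrightarrow> herm_kernel (grid r n) (choi_kernel r \<phi>)"
  by (rule scaled_channel_kernel_herm[OF _ _ channel_choi_kernel]) auto

lemma collect_channels_eq:
  assumes "\<And>\<alpha>. channel r m \<alpha> \<Longrightarrow> f \<alpha> = g (choi_kernel r \<alpha>)"
    "\<And>c c'. kernel_eq (grid r m) c c' \<Longrightarrow> g c = g c'"
  shows "{f \<alpha> | \<alpha>. channel r m \<alpha>} = {g c | c. channel_kernel {..<r} {..<m} c}"
proof (intro equalityI subsetI)
  fix x assume "x \<in> {g c | c. channel_kernel {..<r} {..<m} c}"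
  then obtain c where channel_c: "x = g c" "channel_kernel {..<r} {..<m} c" by blast
  have "x = f (map_of_kernel r m c)"
    using assms(1)[OF channel_map_of_kernel[OF channel_c(2)]]
      assms(2)[OF has_kernel_choi_kernel[OF has_kernel_map_of_kernel]]
    by (simp add: channel_c(1))
  then show "x \<in> {f \<alpha> | \<alpha>. channel r m \<alpha>}" using channel_map_of_kernel[OF channel_c(2)] by blast
qed (use assms(1) channel_choi_kernel in blast)

lemma has_kernel_hs_adj:
  assumes has_kernel_\<phi>: "has_kernel m n \<phi> F" and herm: "herm_kernel (grid m n) F"
  shows "has_kernel n m (hs_adj m n \<phi>) (transpose_kernel (swap_kernel F))"
  unfolding has_kernel_def
proof (intro ballI conjI allI impI)
  fix Z :: "complex mat" assume Z_carrier: "Z \<in> carrier_mat n n"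
  show "hs_adj m n \<phi> Z \<in> carrier_mat m m" by (simp add: hs_adj_def)
  fix i j assume ij: "i < m" "j < m"
  have image_carrier: "\<phi> (munit m i j) \<in> carrier_mat n n"
    by (rule has_kernelD(1)[OF has_kernel_\<phi> munit_carrier])
  have "\<phi> (munit m i j) $$ (l, k) = F (i, l) (j, k)" if "l < n" "k < n" for l k
    using has_kernel_choi_kernel[OF has_kernel_\<phi>] ij that by (simp add: kernel_eq_def choi_kernel_def)
  then have "hs_adj m n \<phi> Z $$ (i, j) = (\<Sum>k<n. \<Sum>l<n. cnj (F (i, l) (j, k)) * Z $$ (l, k))"
    using ij mtrace_mult[OF mat_adjoint_carrier[OF image_carrier] Z_carrier]
    by (simp add: hs_adj_def mat_adjoint_index[OF image_carrier])
  also have "\<dots> = (\<Sum>l<n. \<Sum>k<n. cnj (F (i, l) (j, k)) * Z $$ (l, k))" by (rule sum.swap)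
  also have "\<dots> = (\<Sum>l<n. \<Sum>k<n. Z $$ (l, k) * transpose_kernel (swap_kernel F) (l, i) (k, j))"
    using herm ij
    by (intro sum.cong refl) (simp add: herm_kernel_def transpose_kernel_def swap_kernel_def mult.commute)
  finally show "hs_adj m n \<phi> Z $$ (i, j) =
      (\<Sum>l<n. \<Sum>k<n. Z $$ (l, k) * transpose_kernel (swap_kernel F) (l, i) (k, j))" .
qed

lemma has_kernel_map_transp:
  assumes "has_kernel m n \<phi> F" "herm_kernel (grid m n) F"
  shows "has_kernel n m (map_transp m n \<phi>) (swap_kernel F)"
  unfolding has_kernel_def
proof (intro ballI conjI allI impI)
  fix Z :: "complex mat" assume Z_carrier: "Z \<in> carrier_mat n n"
  then have Zt_carrier: "transp Z \<in> carrier_mat n n" by (simp add: transp_def)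
  note adj = has_kernelD[OF has_kernel_hs_adj[OF assms] Zt_carrier]
  show "map_transp m n \<phi> Z \<in> carrier_mat m m" using adj(1) by (simp add: map_transp_def transp_def)
  fix i j assume ij: "i < m" "j < m"
  have "map_transp m n \<phi> Z $$ (i, j) = hs_adj m n \<phi> (transp Z) $$ (j, i)"
    using adj(1) ij by (simp add: map_transp_def transp_def)
  also have "\<dots> = (\<Sum>k<n. \<Sum>l<n. transp Z $$ (k, l) * transpose_kernel (swap_kernel F) (k, j) (l, i))"
    by (rule adj(2)[OF ij(2,1)])
  also have "\<dots> = (\<Sum>l<n. \<Sum>k<n. transp Z $$ (k, l) * transpose_kernel (swap_kernel F) (k, j) (l, i))"
    by (rule sum.swap)
  also have "\<dots> = (\<Sum>l<n. \<Sum>k<n. Z $$ (l, k) * swap_kernel F (l, i) (k, j))"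
    using Z_carrier by (simp add: transp_def transpose_kernel_def)
  finally show "map_transp m n \<phi> Z $$ (i, j) = (\<Sum>l<n. \<Sum>k<n. Z $$ (l, k) * swap_kernel F (l, i) (k, j))" .
qed

lemma pairing_eq_kernel_pair:
  assumes channel_\<alpha>: "channel r n \<alpha>" and X_carrier: "X \<in> carrier_mat (r * n) (r * n)"
  shows "pairing r n X \<alpha> = kernel_pair (grid r n) (bip_kernel n X) (choi_kernel r \<alpha>)"
proof -
  have "kernel_eq (grid r n) (bip_kernel n (choi n r (hs_adj r n \<alpha>))) (transpose_kernel (choi_kernel r \<alpha>))"
    using bip_kernel_choi[OF has_kernel_hs_adj[OF channel_has_kernel[OF channel_\<alpha>]
        channel_herm_choi_kernel[OF channel_\<alpha>]]]
    by (simp add: transpose_swap_kernel[symmetric])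
  then have "kernel_pair (grid r n) (bip_kernel n X)
      (transpose_kernel (bip_kernel n (choi n r (hs_adj r n \<alpha>)))) =
      kernel_pair (grid r n) (bip_kernel n X) (choi_kernel r \<alpha>)"
    by (intro kernel_pair_cong) (simp_all add: kernel_eq_def transpose_kernel_def)
  then show ?thesis
    unfolding pairing_def by (simp add: mtrace_mult_bip_kernel[OF X_carrier] choi_def)
qed

lemma cond_dnorm_eq_cond_norm:
  assumes "X \<in> carrier_mat (r * n) (r * n)"
  shows "cond_dnorm r n X = cond_norm {..<r} {..<n} (bip_kernel n X)"
  unfolding cond_dnorm_def cond_norm_def
proof (rule arg_cong[where f = Sup], rule collect_channels_eq)
  show "Re (kernel_pair (grid r n) (bip_kernel n X) c) = Re (kernel_pair (grid r n) (bip_kernel n X) c')"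
    if "kernel_eq (grid r n) c c'" for c c'
    using kernel_pair_cong[OF kernel_eqI[OF refl] that] by simp
qed (simp add: pairing_eq_kernel_pair[OF _ assms])

section \<open>The diamond norm of a difference of completely positive maps\<close>

lemma block_link_kernel: "block_kernel e f (link_kernel R A Z) = link_kernel R A (block_kernel e f Z)"
  by (simp add: block_kernel_def link_kernel_def fun_eq_iff)

lemma trace_norm_tensor_id_le:
  assumes has_kernel_\<Delta>: "has_kernel m n \<Delta> (G - H)"
    and scaled_channel_G: "scaled_channel_kernel t {..<m} {..<n} G"
    and scaled_channel_H: "scaled_channel_kernel t {..<m} {..<n} H"
    and X_carrier: "X \<in> carrier_mat (m * r) (m * r)"
  shows "trace_norm (tensor_id m n r \<Delta> X) \<le> 2 * t * trace_norm X"
proof -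
  obtain Z where pos_Z: "pos_kernel ({..<m} \<times> {..<r} \<times> UNIV) Z"
    and off: "kernel_eq (grid m r) (block_kernel False True Z) (bip_kernel r X)"
    and block_trace: "\<And>e. kernel_trace (grid m r) (block_kernel e e Z) = of_real (trace_norm X)"
    using trace_norm_block_attained[OF X_carrier] by blast
  define s :: "nat \<times> nat \<times> bool \<Rightarrow> complex" where "s z = (if snd (snd z) then - 1 else 1)" for z
  define W where "W = link_kernel {..<m} G Z + (\<lambda>p q. s p * link_kernel {..<m} H Z p q * cnj (s q))"
  have pos_W: "pos_kernel ({..<n} \<times> {..<r} \<times> UNIV) W"
    unfolding W_def
    by (intro pos_kernel_add pos_kernel_diag_congruence pos_kernel_link pos_Z
        scaled_channel_kernelD(1)[OF scaled_channel_G]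
        scaled_channel_kernelD(1)[OF scaled_channel_H]) auto
  have W_off: "block_kernel False True W = link_kernel {..<m} (G - H) (block_kernel False True Z)"
    by (simp add: link_kernel_diff_left block_link_kernel[symmetric] W_def block_kernel_def s_def
        fun_eq_iff)
  have W_off_image: "kernel_eq (grid n r) (block_kernel False True W) (bip_kernel r (tensor_id m n r \<Delta> X))"
    unfolding W_off
    by (rule kernel_eq_trans[OF link_kernel_cong[OF kernel_eqI[OF refl] off]
        kernel_eq_sym[OF bip_kernel_tensor_id[OF has_kernel_\<Delta>]]])
  have "block_kernel e e W =
      link_kernel {..<m} G (block_kernel e e Z) + link_kernel {..<m} H (block_kernel e e Z)" for e
    by (simp add: block_link_kernel[symmetric] W_def block_kernel_def s_def fun_eq_iff)
  then have "kernel_trace (grid n r) (block_kernel e e W) = of_real (2 * t * trace_norm X)" for e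
    by (simp add: kernel_trace_add kernel_trace_link[OF _ scaled_channel_G]
        kernel_trace_link[OF _ scaled_channel_H] block_trace)
  then show ?thesis using trace_norm_block_le[OF tensor_id_carrier pos_W W_off_image] by simp
qed

locale cp_difference =
  fixes m n :: nat and \<Delta> :: cmap and G H :: "(nat \<times> nat) kernel" and t :: real
  assumes has_kernel_\<Delta>: "has_kernel m n \<Delta> (G - H)"
    and scaled_channel_G: "scaled_channel_kernel t {..<m} {..<n} G"
    and scaled_channel_H: "scaled_channel_kernel t {..<m} {..<n} H"
    and t_nonneg: "0 \<le> t"
begin

lemma trace_norm_tensor_id_unit_ball:
  assumes "X \<in> carrier_mat (m * m) (m * m)" "trace_norm X \<le> 1"
  shows "trace_norm (tensor_id m n m \<Delta> X) \<le> 2 * t"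
proof -
  have "2 * t * trace_norm X \<le> 2 * t * 1" using assms(2) t_nonneg by (intro mult_left_mono) auto
  with trace_norm_tensor_id_le[OF has_kernel_\<Delta> scaled_channel_G scaled_channel_H assms(1)] show ?thesis
    by simp
qed

lemma dnorm_le: "dnorm m n \<Delta> \<le> 2 * t"
  unfolding dnorm_def
proof (rule cSup_least)
  have "0\<^sub>m (m * m) (m * m) \<in> carrier_mat (m * m) (m * m) \<and> trace_norm (0\<^sub>m (m * m) (m * m)) \<le> 1"
    by (simp add: trace_norm_zero)
  then show "{trace_norm (tensor_id m n m \<Delta> X) |X. X \<in> carrier_mat (m * m) (m * m) \<and> trace_norm X \<le> 1} \<noteq> {}"
    by blast
qed (use trace_norm_tensor_id_unit_ball in blast)

lemma trace_norm_tensor_id_le_dnorm: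
  assumes "X \<in> carrier_mat (m * m) (m * m)" "trace_norm X \<le> 1"
  shows "trace_norm (tensor_id m n m \<Delta> X) \<le> dnorm m n \<Delta>"
  unfolding dnorm_def
proof (rule cSup_upper)
  show "bdd_above {trace_norm (tensor_id m n m \<Delta> X) |X. X \<in> carrier_mat (m * m) (m * m) \<and> trace_norm X \<le> 1}"
    using trace_norm_tensor_id_unit_ball by (intro bdd_aboveI) blast
qed (use assms in blast)

lemma dnorm_nonneg: "0 \<le> dnorm m n \<Delta>"
  using trace_norm_nonneg[OF tensor_id_carrier[of m n m \<Delta> "0\<^sub>m (m * m) (m * m)"]]
    trace_norm_tensor_id_le_dnorm[of "0\<^sub>m (m * m) (m * m)"]
  by (simp add: trace_norm_zero)

end

lemma pos_definite_kernel_spectral: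
  assumes "finite I" "0 < \<eta>" "kernel_le I (\<eta> \<cdot>\<^sub>k id_kernel) T"
  obtains d v where "spectral_decomposition I T d v" "\<And>j. j < card I \<Longrightarrow> 0 < d j"
proof -
  have "pos_kernel I (T - \<eta> \<cdot>\<^sub>k id_kernel)" using assms(3) by (simp add: kernel_le_def)
  then obtain a v where spec: "spectral_decomposition I (T - \<eta> \<cdot>\<^sub>k id_kernel) a v"
    and a_nonneg: "\<And>j. j < card I \<Longrightarrow> 0 \<le> a j"
    using pos_kernel_spectral_decomposition[OF assms(1)] by blast
  have "1 \<cdot>\<^sub>k (T - \<eta> \<cdot>\<^sub>k id_kernel) + \<eta> \<cdot>\<^sub>k id_kernel = T"
    by (simp add: fun_eq_iff scale_kernel_def)
  with spectral_decomposition_affine[OF spec, of 1 \<eta>]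
  have "spectral_decomposition I T (\<lambda>j. a j + \<eta>) v" by simp
  moreover have "0 < a j + \<eta>" if "j < card I" for j using a_nonneg[OF that] assms(2) by simp
  ultimately show ?thesis by (rule that)
qed

lemma link_kernel_tensor_id_rank_one:
  "link_kernel I (kernel_tensor T id_kernel) (rank_one_kernel \<omega>) p q =
    of_bool (fst p = fst q) * sform I T (\<lambda>x. cnj (\<omega> (x, snd p))) (\<lambda>x. cnj (\<omega> (x, snd q)))"
  by (simp add: link_kernel_def kernel_tensor_def rank_one_kernel_def id_kernel_def sform_def
      sum_distrib_left mult_ac)

text \<open>If \<open>T = \<Sum> d\<^sub>j v\<^sub>j v\<^sub>j\<^sup>*\<close>, then \<open>X\<close> is the purification \<open>\<Sum> \<surd>d\<^sub>j v\<^sub>j \<otimes> e\<^sub>j\<close> of \<open>T\<close>, and \<open>\<Omega>\<close>, with the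
  inverse weights, undoes it.\<close>

lemma pos_definite_kernel_purification:
  assumes fin: "finite I" and \<eta>_bound: "0 < \<eta>" "kernel_le I (\<eta> \<cdot>\<^sub>k id_kernel) T"
  obtains X \<Omega> :: "('i \<times> nat) kernel" where
    "pos_kernel (I \<times> {..<card I}) X" "pos_kernel (I \<times> {..<card I}) \<Omega>"
    "kernel_trace (I \<times> {..<card I}) X = kernel_trace I T"
    "kernel_eq (I \<times> I) (choi_comp {..<card I} X (swap_kernel \<Omega>)) choi_id"
    "kernel_eq ((N :: 'n set) \<times> {..<card I}) (link_kernel I (kernel_tensor T id_kernel) \<Omega>) id_kernel"
proof -
  let ?K = "{..<card I}"
  obtain d v where spec: "spectral_decomposition I T d v" and d_pos: "\<And>j. j < card I \<Longrightarrow> 0 < d j"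
    using pos_definite_kernel_spectral[OF assms] by blast
  then have T_dyad: "kernel_eq I T (dyad_kernel ?K d v v)"
    and complete: "\<And>x y. x \<in> I \<Longrightarrow> y \<in> I \<Longrightarrow> (\<Sum>j\<in>?K. v j x * cnj (v j y)) = of_bool (x = y)"
    by (auto simp: spectral_decomposition_def orthonormal_basis_def kernel_eq_def id_kernel_def
        dyad_kernel_def)
  have sqrt_d: "complex_of_real (sqrt (d j)) * complex_of_real (sqrt (d j)) = complex_of_real (d j)"
    "complex_of_real (sqrt (d j)) \<noteq> 0" if "j < card I" for j
    using d_pos[OF that] by (simp_all flip: of_real_mult)
  define \<xi> where "\<xi> z = of_real (sqrt (d (snd z))) * v (snd z) (fst z)" for z
  define \<omega> where "\<omega> z = cnj (v (snd z) (fst z)) / of_real (sqrt (d (snd z)))" for z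
  show ?thesis
  proof (rule that[of "rank_one_kernel \<xi>" "rank_one_kernel \<omega>"])
    have "kernel_trace (I \<times> ?K) (rank_one_kernel \<xi>) = (\<Sum>x\<in>I. \<Sum>j\<in>?K. of_real (d j) * v j x * cnj (v j x))"
      unfolding kernel_trace_def sum.cartesian_product' rank_one_kernel_def \<xi>_def
      by (intro sum.cong refl) (simp add: sqrt_d(1)[symmetric])
    then show "kernel_trace (I \<times> ?K) (rank_one_kernel \<xi>) = kernel_trace I T"
      unfolding kernel_trace_cong[OF T_dyad] by (simp add: kernel_trace_def dyad_kernel_def)
    have "(\<Sum>j\<in>?K. \<xi> (x, j) * \<omega> (y, j)) = of_bool (x = y)" if "x \<in> I" "y \<in> I" for x y
      unfolding complete[OF that, symmetric]
      by (intro sum.cong refl) (use sqrt_d(2) in \<open>simp add: \<xi>_def \<omega>_def\<close>)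
    then show "kernel_eq (I \<times> I)
        (choi_comp ?K (rank_one_kernel \<xi>) (swap_kernel (rank_one_kernel \<omega>))) choi_id"
      unfolding swap_rank_one_kernel choi_comp_rank_one choi_id_def by (intro rank_one_kernel_cong) auto
    have cnj_\<omega>: "(\<lambda>x. cnj (\<omega> (x, j))) = (\<lambda>x. of_real (1 / sqrt (d j)) * v j x)" for j
      by (simp add: \<omega>_def)
    have "sform I T (\<lambda>x. cnj (\<omega> (x, j))) (\<lambda>x. cnj (\<omega> (x, k))) = of_bool (j = k)" if "j \<in> ?K" "k \<in> ?K"
      for j k
      unfolding cnj_\<omega> sform_scale_left sform_scale_right
      using sform_spectral_decomposition[OF spec, of j k] sqrt_d[of k] that by auto
    then show "kernel_eq (N \<times> ?K) (link_kernel I (kernel_tensor T id_kernel) (rank_one_kernel \<omega>)) id_kernel"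
      by (auto simp: kernel_eq_def link_kernel_tensor_id_rank_one id_kernel_def)
  qed (rule pos_kernel_rank_one)+
qed

lemma kernel_pair_link_purification:
  assumes "kernel_eq (M \<times> M) (choi_comp K X (swap_kernel \<Omega>)) choi_id" "finite M"
  shows "kernel_pair (N \<times> K) (link_kernel M \<rho> \<Omega>) (link_kernel M F X) = kernel_pair (M \<times> N) \<rho> F"
proof -
  have "kernel_pair (N \<times> K) (link_kernel M \<rho> \<Omega>) (link_kernel M F X) =
      kernel_pair (N \<times> M) (swap_kernel \<rho>) (choi_comp K (choi_comp M (swap_kernel F) X) (swap_kernel \<Omega>))"
    using kernel_pair_choi_comp_left[of N K M "swap_kernel \<rho>" \<Omega> "link_kernel M F X"]
    by (simp add: choi_comp_def)
  also have "\<dots> = kernel_pair (N \<times> M) (swap_kernel \<rho>)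
      (choi_comp M (swap_kernel F) (choi_comp K X (swap_kernel \<Omega>)))"
    by (simp only: choi_comp_assoc)
  also have "\<dots> = kernel_pair (N \<times> M) (swap_kernel \<rho>) (swap_kernel F)"
  proof (rule kernel_pair_cong[OF kernel_eqI[OF refl]])
    have "kernel_eq (N \<times> M) (choi_comp M (swap_kernel F) (choi_comp K X (swap_kernel \<Omega>)))
        (choi_comp M (swap_kernel F) choi_id)"
      by (rule choi_comp_cong[OF kernel_eqI[OF refl] assms(1)])
    then show "kernel_eq (N \<times> M) (choi_comp M (swap_kernel F) (choi_comp K X (swap_kernel \<Omega>)))
        (swap_kernel F)"
      using choi_comp_id_right[OF assms(2), of N "swap_kernel F"] by (simp add: kernel_eq_def)
  qed
  also have "\<dots> = kernel_pair (M \<times> N) \<rho> F" by (rule kernel_pair_swap)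
  finally show ?thesis .
qed

context cp_difference
begin

lemma bip_kernel_tensor_id_traceless:
  assumes "pos_kernel (grid m r) X" "kernel_eq (grid m r) (bip_kernel r A) X"
  shows "kernel_eq (grid n r) (bip_kernel r (tensor_id m n r \<Delta> A)) (link_kernel {..<m} (G - H) X)"
    and "herm_kernel (grid n r) (bip_kernel r (tensor_id m n r \<Delta> A))"
    and "kernel_trace (grid n r) (bip_kernel r (tensor_id m n r \<Delta> A)) = 0"
proof -
  show image_eq: "kernel_eq (grid n r) (bip_kernel r (tensor_id m n r \<Delta> A)) (link_kernel {..<m} (G - H) X)"
    by (rule kernel_eq_trans[OF bip_kernel_tensor_id[OF has_kernel_\<Delta>]
        link_kernel_cong[OF kernel_eqI[OF refl] assms(2)]])
  have "pos_kernel (grid n r) (link_kernel {..<m} G X)" "pos_kernel (grid n r) (link_kernel {..<m} H X)"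
    by (intro pos_kernel_link assms(1) scaled_channel_kernelD(1)[OF scaled_channel_G]
        scaled_channel_kernelD(1)[OF scaled_channel_H]; simp)+
  then have "herm_kernel (grid n r) (link_kernel {..<m} (G - H) X)"
    unfolding link_kernel_diff_left by (intro herm_kernel_diff pos_kernel_herm) auto
  then show "herm_kernel (grid n r) (bip_kernel r (tensor_id m n r \<Delta> A))"
    using image_eq by (simp add: herm_kernel_def kernel_eq_def)
  show "kernel_trace (grid n r) (bip_kernel r (tensor_id m n r \<Delta> A)) = 0"
    unfolding kernel_trace_cong[OF image_eq] link_kernel_diff_left kernel_trace_diff
    by (simp add: kernel_trace_link[OF _ scaled_channel_G] kernel_trace_link[OF _ scaled_channel_H])
qed

lemma kernel_pair_link_le_dnorm:
  assumes density_X: "density_kernel (grid m m) X"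
    and S_effect: "pos_kernel (grid n m) S" "kernel_le (grid n m) S id_kernel"
  shows "- Re (kernel_pair (grid n m) S (link_kernel {..<m} (G - H) X)) \<le> dnorm m n \<Delta> / 2"
proof -
  let ?I = "grid n m"
  define A where "A = mat_of_kernel m m X"
  define D where "D = tensor_id m n m \<Delta> A"
  have pos_X: "pos_kernel (grid m m) X" and "kernel_trace (grid m m) X = 1"
    using density_X by (auto simp: density_kernel_def)
  then have "trace_norm A = 1"
    using trace_norm_psd[OF psd_mat_of_kernel[OF pos_X]] by (simp add: A_def mtrace_mat_of_kernel)
  then have D_le: "trace_norm D \<le> dnorm m n \<Delta>"
    unfolding D_def by (intro trace_norm_tensor_id_le_dnorm) (simp_all add: A_def)
  note image_D =
    bip_kernel_tensor_id_traceless[OF pos_X bip_kernel_mat_of_kernel[of m m X, folded A_def], folded D_def]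
  have "pos_kernel ?I (id_kernel - S)" "kernel_le ?I (id_kernel - S) id_kernel"
    using S_effect by (simp_all add: kernel_le_def)
  then have "Re (kernel_pair ?I (id_kernel - S) (bip_kernel m D)) \<le> trace_norm D / 2"
    using image_D(2,3) by (intro kernel_pair_le_half_trace_norm) (simp_all add: D_def)
  moreover have "kernel_pair ?I (id_kernel - S) (bip_kernel m D) = - kernel_pair ?I S (bip_kernel m D)"
    unfolding kernel_pair_commute[of _ _ "bip_kernel m D"] kernel_pair_diff_right using image_D(3)
    by (simp add: kernel_pair_id)
  moreover have "kernel_pair ?I S (bip_kernel m D) = kernel_pair ?I S (link_kernel {..<m} (G - H) X)"
    by (rule kernel_pair_cong[OF kernel_eqI[OF refl] image_D(1)])
  ultimately show ?thesis using D_le by simp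
qed

lemma kernel_pair_le_dnorm_dominated:
  assumes m_pos: "0 < m" and pos_\<rho>: "pos_kernel (grid m n) \<rho>"
    and \<eta>_bound: "0 < \<eta>" "kernel_le {..<m} (\<eta> \<cdot>\<^sub>k id_kernel) T"
    and dominated: "kernel_le (grid m n) \<rho> (kernel_tensor T id_kernel)"
  shows "Re (kernel_pair (grid m n) \<rho> (H - G)) \<le> Re (kernel_trace {..<m} T) * (dnorm m n \<Delta> / 2)"
proof -
  let ?M = "{..<m}" and ?N = "{..<n}"
  obtain X \<Omega> :: "(nat \<times> nat) kernel" where pos_X: "pos_kernel (grid m m) X"
    and pos_\<Omega>: "pos_kernel (grid m m) \<Omega>"
    and trace_X: "kernel_trace (grid m m) X = kernel_trace ?M T"
    and inv: "kernel_eq (grid m m) (choi_comp ?M X (swap_kernel \<Omega>)) choi_id"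
    and T\<Omega>: "kernel_eq (grid n m) (link_kernel ?M (kernel_tensor T id_kernel) \<Omega>) id_kernel"
    using pos_definite_kernel_purification[of ?M \<eta> T ?N, OF _ \<eta>_bound]
    by (metis finite_lessThan card_lessThan)
  define \<tau> where "\<tau> = Re (kernel_trace ?M T)"
  have "0 \<le> Re (kernel_trace ?M (T - \<eta> \<cdot>\<^sub>k id_kernel))"
    using pos_kernel_trace_nonneg[of ?M] \<eta>_bound(2) by (auto simp: kernel_le_def complex_nonneg_iff)
  then have "\<eta> * m \<le> \<tau>" by (simp add: \<tau>_def kernel_trace_diff kernel_trace_scale kernel_trace_id)
  moreover have "0 < \<eta> * m" using m_pos \<eta>_bound(1) by simp
  ultimately have \<tau>_pos: "0 < \<tau>" by linarith
  have "kernel_trace (grid m m) X = of_real \<tau>"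
    using pos_kernel_trace_real[OF _ pos_X] by (simp add: trace_X \<tau>_def)
  then have density: "density_kernel (grid m m) ((1 / \<tau>) \<cdot>\<^sub>k X)"
    using pos_X \<tau>_pos by (simp add: density_kernel_def pos_kernel_scale kernel_trace_scale)
  have "pos_kernel (grid n m) (link_kernel ?M \<rho> \<Omega>)" by (intro pos_kernel_link pos_\<rho> pos_\<Omega>) auto
  moreover have "kernel_le (grid n m) (link_kernel ?M \<rho> \<Omega>) id_kernel"
  proof -
    have "pos_kernel (grid n m) (link_kernel ?M (kernel_tensor T id_kernel - \<rho>) \<Omega>)"
      using dominated by (intro pos_kernel_link pos_\<Omega>) (auto simp: kernel_le_def)
    then show ?thesis
      unfolding kernel_le_def link_kernel_diff_left
      by (rule pos_kernel_cong) (use T\<Omega> in \<open>simp add: kernel_eq_def\<close>)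
  qed
  ultimately have "- Re (kernel_pair (grid n m) (link_kernel ?M \<rho> \<Omega>)
      (link_kernel ?M (G - H) ((1 / \<tau>) \<cdot>\<^sub>k X))) \<le> dnorm m n \<Delta> / 2"
    by (rule kernel_pair_link_le_dnorm[OF density])
  then have "- Re (kernel_pair (grid m n) \<rho> (G - H)) / \<tau> \<le> dnorm m n \<Delta> / 2"
    unfolding link_kernel_scale_right kernel_pair_scale_right
    by (simp add: kernel_pair_link_purification[OF inv])
  then show ?thesis
    using \<tau>_pos by (simp add: kernel_pair_diff_right \<tau>_def[symmetric] field_simps)
qed

theorem kernel_pair_le_dnorm_cond_norm:
  assumes pos: "0 < m" "0 < n" and pos_\<rho>: "pos_kernel (grid m n) \<rho>"
  shows "Re (kernel_pair (grid m n) \<rho> (H - G)) \<le> dnorm m n \<Delta> / 2 * cond_norm {..<m} {..<n} \<rho>"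
proof (rule field_le_epsilon)
  fix e :: real assume e_pos: "0 < e"
  define v where "v = cond_norm {..<m} {..<n} \<rho>"
  define \<eta> where "\<eta> = e / (m * (dnorm m n \<Delta> / 2) + 1)"
  have v_nonneg: "0 \<le> v" unfolding v_def using pos by (intro cond_norm_nonneg pos_\<rho>) auto
  have "0 < m * (dnorm m n \<Delta> / 2) + 1" using dnorm_nonneg by (intro add_nonneg_pos) auto
  then have \<eta>_small: "0 < \<eta>" "\<eta> * m * (dnorm m n \<Delta> / 2) \<le> e"
    using e_pos unfolding \<eta>_def by (simp, simp add: pos_divide_le_eq mult.assoc mult_left_mono)
  obtain \<sigma> where density_\<sigma>: "density_kernel {..<m} \<sigma>"
    and dominated: "kernel_le (grid m n) \<rho> (kernel_tensor (v \<cdot>\<^sub>k \<sigma> + \<eta> \<cdot>\<^sub>k id_kernel) id_kernel)"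
    using cond_norm_dual[OF _ _ _ _ pos_\<rho> \<eta>_small(1)] pos by (auto simp: v_def)
  have "kernel_le {..<m} (\<eta> \<cdot>\<^sub>k id_kernel) (v \<cdot>\<^sub>k \<sigma> + \<eta> \<cdot>\<^sub>k id_kernel)"
    using density_\<sigma> v_nonneg by (simp add: kernel_le_def density_kernel_def pos_kernel_scale)
  from kernel_pair_le_dnorm_dominated[OF pos(1) pos_\<rho> \<eta>_small(1) this dominated]
  have "Re (kernel_pair (grid m n) \<rho> (H - G)) \<le> (v + \<eta> * m) * (dnorm m n \<Delta> / 2)"
    using density_\<sigma> by (simp add: kernel_trace_add kernel_trace_scale kernel_trace_id density_kernel_def)
  then show "Re (kernel_pair (grid m n) \<rho> (H - G)) \<le> dnorm m n \<Delta> / 2 * cond_norm {..<m} {..<n} \<rho> + e"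
    using \<eta>_small(2) by (simp add: v_def algebra_simps)
qed

end

section \<open>Approximating a channel by precomposition\<close>

definition precomp_norm :: "'r set \<Rightarrow> 'a set \<Rightarrow> 'b set \<Rightarrow> ('a \<times> 'b) kernel \<Rightarrow> ('r \<times> 'b) kernel \<Rightarrow> real" where
  "precomp_norm R M N J \<rho> = cond_norm R M (choi_comp N \<rho> (swap_kernel J))"

lemma kernel_pair_choi_comp_swap:
  "kernel_pair (R \<times> M) (choi_comp N \<rho> (swap_kernel J)) c = kernel_pair (R \<times> N) \<rho> (choi_comp M c J)"
  using kernel_pair_choi_comp_left[of R M N \<rho> "swap_kernel J" c] by simp

lemma precomp_norm_upper:
  assumes "finite R" "finite M" "channel_kernel R M c"
  shows "Re (kernel_pair (R \<times> N) \<rho> (choi_comp M c J)) \<le> precomp_norm R M N J \<rho>"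
  using cond_norm_upper[OF assms, of "choi_comp N \<rho> (swap_kernel J)"]
  by (simp add: precomp_norm_def kernel_pair_choi_comp_swap)

lemma precomp_norm_least:
  assumes "finite R" "finite M" "M \<noteq> {}"
    "\<And>c. channel_kernel R M c \<Longrightarrow> Re (kernel_pair (R \<times> N) \<rho> (choi_comp M c J)) \<le> B"
  shows "precomp_norm R M N J \<rho> \<le> B"
  using assms by (auto simp: precomp_norm_def kernel_pair_choi_comp_swap intro!: cond_norm_least)

lemma precomp_norm_approx:
  assumes "finite R" "finite M" "M \<noteq> {}" "0 < \<delta>"
  obtains c where "channel_kernel R M c"
    "precomp_norm R M N J \<rho> - \<delta> < Re (kernel_pair (R \<times> N) \<rho> (choi_comp M c J))"
  using cond_norm_approx[OF assms, of "choi_comp N \<rho> (swap_kernel J)"]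
  by (auto simp: precomp_norm_def kernel_pair_choi_comp_swap)

lemma precomp_norm_cong: "kernel_eq (R \<times> N) \<rho> \<rho>' \<Longrightarrow> precomp_norm R M N J \<rho> = precomp_norm R M N J \<rho>'"
  unfolding precomp_norm_def by (intro cond_norm_cong choi_comp_cong kernel_eqI[OF refl])

lemma precomp_norm_scale:
  "finite R \<Longrightarrow> finite M \<Longrightarrow> M \<noteq> {} \<Longrightarrow> 0 < s \<Longrightarrow> precomp_norm R M N J (s \<cdot>\<^sub>k \<rho>) = s * precomp_norm R M N J \<rho>"
  by (simp add: precomp_norm_def choi_comp_scale_left cond_norm_scale)

definition precomposition_defects ::
    "'m set \<Rightarrow> 'a set \<Rightarrow> 'n set \<Rightarrow> ('a \<times> 'n) kernel \<Rightarrow> ('m \<times> 'n) kernel \<Rightarrow> real \<Rightarrow> ('m \<times> 'n) kernel set" where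
  "precomposition_defects M A N J1 J2 e =
     {choi_comp A L J1 + e \<cdot>\<^sub>k \<gamma> - J2 | L \<gamma>. channel_kernel M A L \<and> channel_kernel M N \<gamma>}"

lemma precomposition_defects_nonempty:
  "finite M \<Longrightarrow> finite A \<Longrightarrow> A \<noteq> {} \<Longrightarrow> finite N \<Longrightarrow> N \<noteq> {} \<Longrightarrow> precomposition_defects M A N J1 J2 e \<noteq> {}"
  using depolarising_channel_kernel[of M A] depolarising_channel_kernel[of M N]
  unfolding precomposition_defects_def by blast

lemma convex_precomposition_defects: "convex_kernels (precomposition_defects M A N J1 J2 e)"
  unfolding convex_kernels_def
proof (intro ballI allI impI)
  fix x y and t :: real
  assume "x \<in> precomposition_defects M A N J1 J2 e" "y \<in> precomposition_defects M A N J1 J2 e"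
    and t_bounds: "0 \<le> t" "t \<le> 1"
  then obtain L L' \<gamma> \<gamma>' where channel_L: "channel_kernel M A L" "channel_kernel M A L'"
    and channel_\<gamma>: "channel_kernel M N \<gamma>" "channel_kernel M N \<gamma>'"
    and x_eq: "x = choi_comp A L J1 + e \<cdot>\<^sub>k \<gamma> - J2" and y_eq: "y = choi_comp A L' J1 + e \<cdot>\<^sub>k \<gamma>' - J2"
    unfolding precomposition_defects_def by blast
  have "(1 - t) \<cdot>\<^sub>k x + t \<cdot>\<^sub>k y =
      choi_comp A ((1 - t) \<cdot>\<^sub>k L + t \<cdot>\<^sub>k L') J1 + e \<cdot>\<^sub>k ((1 - t) \<cdot>\<^sub>k \<gamma> + t \<cdot>\<^sub>k \<gamma>') - J2"
    unfolding x_eq y_eq choi_comp_add_left choi_comp_scale_left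
    by (simp add: fun_eq_iff scale_kernel_def algebra_simps)
  then show "(1 - t) \<cdot>\<^sub>k x + t \<cdot>\<^sub>k y \<in> precomposition_defects M A N J1 J2 e"
    unfolding precomposition_defects_def
    using channel_kernel_convex[OF channel_L t_bounds] channel_kernel_convex[OF channel_\<gamma> t_bounds]
    by blast
qed

locale kernel_precomposition =
  fixes M :: "'m set" and A :: "'a set" and N :: "'n set" and J1 :: "('a \<times> 'n) kernel"
    and J2 :: "('m \<times> 'n) kernel"
  assumes fin: "finite M" "finite A" "finite N" and ne: "M \<noteq> {}" "A \<noteq> {}" "N \<noteq> {}"
    and J1: "channel_kernel A N J1" and J2: "channel_kernel M N J2"
begin

lemma precomposition_defects_herm_bounded:
  assumes e_nonneg: "0 \<le> e" and x_in: "x \<in> precomposition_defects M A N J1 J2 e"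
  shows "herm_kernel (M \<times> N) x"
    and "p \<in> M \<times> N \<Longrightarrow> q \<in> M \<times> N \<Longrightarrow> cmod (x p q) \<le> (2 + e) * card M"
proof -
  obtain L \<gamma> where channel_L: "channel_kernel M A L" and channel_\<gamma>: "channel_kernel M N \<gamma>"
    and x_eq: "x = choi_comp A L J1 + e \<cdot>\<^sub>k \<gamma> - J2"
    using x_in unfolding precomposition_defects_def by blast
  have channel_LJ: "channel_kernel M N (choi_comp A L J1)"
    by (rule channel_kernel_comp[OF fin channel_L J1])
  note herm = scaled_channel_kernel_herm[OF fin(1,3)]
  show "herm_kernel (M \<times> N) x"
    unfolding x_eq
    by (intro herm_kernel_diff herm_kernel_add herm_kernel_scale herm[OF channel_LJ] herm[OF channel_\<gamma>]
        herm[OF J2])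
  assume pq: "p \<in> M \<times> N" "q \<in> M \<times> N"
  have entry: "cmod (c p q) \<le> card M" if "channel_kernel M N c" for c
    by (rule cmod_channel_kernel_le[OF fin(1,3) that pq])
  have "cmod (x p q) \<le> cmod (choi_comp A L J1 p q) + e * cmod (\<gamma> p q) + cmod (J2 p q)"
    using norm_triangle_ineq4[of "(choi_comp A L J1 + e \<cdot>\<^sub>k \<gamma>) p q" "J2 p q"]
      norm_triangle_ineq[of "choi_comp A L J1 p q" "(e \<cdot>\<^sub>k \<gamma>) p q"] e_nonneg
    by (simp add: x_eq scale_kernel_def norm_mult)
  also have "\<dots> \<le> card M + e * card M + card M"
    using e_nonneg by (intro add_mono mult_left_mono entry channel_LJ channel_\<gamma> J2)
  finally show "cmod (x p q) \<le> (2 + e) * card M" by (simp add: algebra_simps)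
qed

lemma precomposition_defect_near_norms:
  assumes "0 \<le> e" "0 < \<delta>"
  obtains x where "x \<in> precomposition_defects M A N J1 J2 e"
    "precomp_norm M A N J1 Y + e * cond_norm M N Y - Re (kernel_pair (M \<times> N) Y J2) - \<delta> \<le>
        Re (kernel_pair (M \<times> N) Y x)"
proof -
  define \<kappa> where "\<kappa> = \<delta> / (1 + e)"
  have \<kappa>_pos: "0 < \<kappa>" "(1 + e) * \<kappa> = \<delta>" using assms by (simp_all add: \<kappa>_def)
  obtain L where channel_L: "channel_kernel M A L"
    "precomp_norm M A N J1 Y - \<kappa> < Re (kernel_pair (M \<times> N) Y (choi_comp A L J1))"
    by (rule precomp_norm_approx[OF fin(1,2) ne(2) \<kappa>_pos(1)])
  obtain \<gamma> where channel_\<gamma>: "channel_kernel M N \<gamma>" "cond_norm M N Y - \<kappa> < Re (kernel_pair (M \<times> N) Y \<gamma>)"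
    by (rule cond_norm_approx[OF fin(1,3) ne(3) \<kappa>_pos(1)])
  have "e * (cond_norm M N Y - \<kappa>) \<le> e * Re (kernel_pair (M \<times> N) Y \<gamma>)"
    using channel_\<gamma>(2) assms(1) by (intro mult_left_mono) auto
  with channel_L(2) \<kappa>_pos(2) have "precomp_norm M A N J1 Y + e * cond_norm M N Y -
      Re (kernel_pair (M \<times> N) Y J2) - \<delta> \<le>
      Re (kernel_pair (M \<times> N) Y (choi_comp A L J1 + e \<cdot>\<^sub>k \<gamma> - J2))"
    by (simp add: kernel_pair_diff_right kernel_pair_add_right kernel_pair_scale_right algebra_simps)
  moreover have "choi_comp A L J1 + e \<cdot>\<^sub>k \<gamma> - J2 \<in> precomposition_defects M A N J1 J2 e"
    unfolding precomposition_defects_def using channel_L(1) channel_\<gamma>(1) by blast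
  ultimately show ?thesis using that by blast
qed

theorem channel_kernel_le_precomposition:
  assumes e_nonneg: "0 \<le> e" and \<eta>_pos: "0 < \<eta>"
    and dominated: "\<And>\<rho>. density_kernel (M \<times> N) \<rho> \<Longrightarrow>
      Re (kernel_pair (M \<times> N) \<rho> J2) \<le> precomp_norm M A N J1 \<rho> + e * cond_norm M N \<rho>"
  obtains L \<gamma> where "channel_kernel M A L" "channel_kernel M N \<gamma>"
    "kernel_le (M \<times> N) J2 (choi_comp A L J1 + e \<cdot>\<^sub>k \<gamma> + \<eta> \<cdot>\<^sub>k id_kernel)"
proof -
  let ?C = "precomposition_defects M A N J1 J2 e"
  have "finite (M \<times> N)" using fin by simp
  moreover note convex_precomposition_defects[of M A N J1 J2 e]
    precomposition_defects_nonempty[OF fin(1,2) ne(2) fin(3) ne(3), of J1 J2 e]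
  moreover have "\<forall>x\<in>?C. herm_kernel (M \<times> N) x"
    using precomposition_defects_herm_bounded(1)[OF e_nonneg] by blast
  moreover have "\<forall>x\<in>?C. \<forall>p\<in>M \<times> N. \<forall>q\<in>M \<times> N. cmod (x p q) \<le> (2 + e) * card M"
    using precomposition_defects_herm_bounded(2)[OF e_nonneg] by blast
  ultimately show ?thesis using \<eta>_pos
  proof (cases rule: convex_kernels_positive_or_separated)
    case (positive x)
    then obtain L \<gamma> where channels: "channel_kernel M A L" "channel_kernel M N \<gamma>"
      and x_eq: "x = choi_comp A L J1 + e \<cdot>\<^sub>k \<gamma> - J2"
      unfolding precomposition_defects_def by blast
    have "choi_comp A L J1 + e \<cdot>\<^sub>k \<gamma> + \<eta> \<cdot>\<^sub>k id_kernel - J2 = x + \<eta> \<cdot>\<^sub>k id_kernel"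
      by (simp add: x_eq fun_eq_iff)
    with positive(2) have "kernel_le (M \<times> N) J2 (choi_comp A L J1 + e \<cdot>\<^sub>k \<gamma> + \<eta> \<cdot>\<^sub>k id_kernel)"
      by (simp only: kernel_le_def)
    then show ?thesis by (rule that[OF channels])
  next
    case (separated Y m)
    obtain x where "x \<in> ?C"
      "precomp_norm M A N J1 Y + e * cond_norm M N Y - Re (kernel_pair (M \<times> N) Y J2) - m / 2 \<le>
          Re (kernel_pair (M \<times> N) Y x)"
      using precomposition_defect_near_norms[OF e_nonneg, of "m / 2" Y] separated(2) by auto
    then show ?thesis using separated(2) separated(3)[of x] dominated[OF separated(1)] by simp
  qed
qed

end

locale channel_precomposition =
  fixes dA0 dA0' dA1 :: nat and \<Phi>1 \<Phi>2 :: cmap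
  assumes dims: "0 < dA0" "0 < dA0'" "0 < dA1"
    and \<Phi>1: "channel dA0 dA1 \<Phi>1" and \<Phi>2: "channel dA0' dA1 \<Phi>2"
begin

abbreviation "J1 \<equiv> choi_kernel dA0 \<Phi>1"
abbreviation "J2 \<equiv> choi_kernel dA0' \<Phi>2"

sublocale kernel_precomposition "{..<dA0'}" "{..<dA0}" "{..<dA1}" J1 J2
  using dims by unfold_locales (auto intro: channel_choi_kernel \<Phi>1 \<Phi>2)

lemma has_kernel_precomposition_defect:
  "channel dA0' dA0 \<Lambda> \<Longrightarrow> has_kernel dA0' dA1 (\<lambda>X. \<Phi>1 (\<Lambda> X) - \<Phi>2 X)
      (choi_comp {..<dA0} (choi_kernel dA0' \<Lambda>) J1 - J2)"
  by (intro has_kernel_diff has_kernel_comp channel_has_kernel \<Phi>1 \<Phi>2)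

lemma cp_difference_precomposition:
  assumes "channel dA0' dA0 \<Lambda>"
  shows "cp_difference dA0' dA1 (\<lambda>X. \<Phi>1 (\<Lambda> X) - \<Phi>2 X) (choi_comp {..<dA0} (choi_kernel dA0' \<Lambda>) J1) J2 1"
  using has_kernel_precomposition_defect[OF assms]
    channel_kernel_comp[OF _ _ _ channel_choi_kernel[OF assms] J1] J2
  by unfold_locales auto

lemma delta_pre_le:
  assumes "channel dA0' dA0 \<Lambda>"
  shows "delta_pre dA0 dA0' dA1 \<Phi>1 \<Phi>2 \<le> dnorm dA0' dA1 (\<lambda>X. \<Phi>1 (\<Lambda> X) - \<Phi>2 X)"
  unfolding delta_pre_def
proof (rule cInf_lower)
  show "bdd_below {dnorm dA0' dA1 (\<lambda>X. \<Phi>1 (\<Lambda> X) - \<Phi>2 X) |\<Lambda>. channel dA0' dA0 \<Lambda>}"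
    using cp_difference.dnorm_nonneg[OF cp_difference_precomposition] by (intro bdd_belowI[of _ 0]) blast
qed (use assms in blast)

lemma delta_pre_approx:
  assumes "0 < \<eta>"
  obtains \<Lambda> where "channel dA0' dA0 \<Lambda>"
    "dnorm dA0' dA1 (\<lambda>X. \<Phi>1 (\<Lambda> X) - \<Phi>2 X) < delta_pre dA0 dA0' dA1 \<Phi>1 \<Phi>2 + \<eta>"
proof -
  let ?D = "{dnorm dA0' dA1 (\<lambda>X. \<Phi>1 (\<Lambda> X) - \<Phi>2 X) |\<Lambda>. channel dA0' dA0 \<Lambda>}"
  have "?D \<noteq> {}" using channel_exists[OF dims(1)] by blast
  moreover have "Inf ?D < delta_pre dA0 dA0' dA1 \<Phi>1 \<Phi>2 + \<eta>" using assms by (simp add: delta_pre_def)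
  ultimately have "\<exists>x\<in>?D. x < delta_pre dA0 dA0' dA1 \<Phi>1 \<Phi>2 + \<eta>" by (rule cInf_lessD)
  then show ?thesis using that by auto
qed

lemma precomp_norm_le_dnorm:
  assumes channel_\<Lambda>: "channel dA0' dA0 \<Lambda>" and pos_\<rho>: "pos_kernel (grid r dA1) \<rho>"
  shows "precomp_norm {..<r} {..<dA0'} {..<dA1} J2 \<rho> \<le> precomp_norm {..<r} {..<dA0} {..<dA1} J1 \<rho> +
    dnorm dA0' dA1 (\<lambda>X. \<Phi>1 (\<Lambda> X) - \<Phi>2 X) / 2 * cond_norm {..<r} {..<dA1} \<rho>" (is "_ \<le> ?norm + ?d / 2 * _")
proof (rule precomp_norm_least)
  fix c assume channel_c: "channel_kernel {..<r} {..<dA0'} c"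
  define L where "L = choi_kernel dA0' \<Lambda>"
  define \<rho>' where "\<rho>' = link_kernel {..<r} c \<rho>"
  have channel_L: "channel_kernel {..<dA0'} {..<dA0} L" unfolding L_def
    by (rule channel_choi_kernel[OF channel_\<Lambda>])
  interpret cp_difference dA0' dA1 "\<lambda>X. \<Phi>1 (\<Lambda> X) - \<Phi>2 X" "choi_comp {..<dA0} L J1" J2 1
    unfolding L_def by (rule cp_difference_precomposition[OF channel_\<Lambda>])
  have "pos_kernel (grid dA0' dA1) \<rho>'"
    unfolding \<rho>'_def by (intro pos_kernel_link scaled_channel_kernelD(1)[OF channel_c] pos_\<rho>) auto
  then have "Re (kernel_pair (grid dA0' dA1) \<rho>' (J2 - choi_comp {..<dA0} L J1)) \<le>
      ?d / 2 * cond_norm {..<dA0'} {..<dA1} \<rho>'"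
    by (rule kernel_pair_le_dnorm_cond_norm[OF dims(2,3)])
  also have "\<dots> \<le> ?d / 2 * cond_norm {..<r} {..<dA1} \<rho>"
    unfolding \<rho>'_def using dnorm_nonneg dims channel_c by (intro mult_left_mono cond_norm_link_le) auto
  finally have "Re (kernel_pair (grid dA0' dA1) \<rho>' J2) \<le>
      Re (kernel_pair (grid dA0' dA1) \<rho>' (choi_comp {..<dA0} L J1)) + ?d / 2 * cond_norm {..<r} {..<dA1} \<rho>"
    by (simp add: kernel_pair_diff_right)
  moreover have "kernel_pair (grid dA0' dA1) \<rho>' F = kernel_pair (grid r dA1) \<rho> (choi_comp {..<dA0'} c F)"
    for F
    unfolding \<rho>'_def choi_comp_def by (rule kernel_pair_link)
  moreover have "Re (kernel_pair (grid r dA1) \<rho> (choi_comp {..<dA0'} c (choi_comp {..<dA0} L J1))) \<le> ?norm"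
    unfolding choi_comp_assoc by (intro precomp_norm_upper channel_kernel_comp channel_c channel_L) auto
  ultimately show "Re (kernel_pair (grid r dA1) \<rho> (choi_comp {..<dA0'} c J2)) \<le>
      ?norm + ?d / 2 * cond_norm {..<r} {..<dA1} \<rho>"
    by simp
qed (use dims in auto)

theorem precomp_norm_le_delta_pre:
  assumes pos_\<rho>: "pos_kernel (grid r dA1) \<rho>"
  shows "precomp_norm {..<r} {..<dA0'} {..<dA1} J2 \<rho> \<le> precomp_norm {..<r} {..<dA0} {..<dA1} J1 \<rho> +
    delta_pre dA0 dA0' dA1 \<Phi>1 \<Phi>2 / 2 * cond_norm {..<r} {..<dA1} \<rho>" (is "_ \<le> ?norm + ?\<delta> / 2 * ?v")
proof (rule field_le_epsilon)
  fix \<eta> :: real assume "0 < \<eta>"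
  have v_nonneg: "0 \<le> ?v" using dims pos_\<rho> by (intro cond_norm_nonneg) auto
  define \<kappa> where "\<kappa> = 2 * \<eta> / (?v + 1)"
  have \<kappa>_pos: "0 < \<kappa>" "\<kappa> * (?v + 1) = 2 * \<eta>" using \<open>0 < \<eta>\<close> v_nonneg by (simp_all add: \<kappa>_def)
  obtain \<Lambda> where channel_\<Lambda>: "channel dA0' dA0 \<Lambda>" and "dnorm dA0' dA1 (\<lambda>X. \<Phi>1 (\<Lambda> X) - \<Phi>2 X) < ?\<delta> + \<kappa>"
    by (rule delta_pre_approx[OF \<kappa>_pos(1)])
  then have "dnorm dA0' dA1 (\<lambda>X. \<Phi>1 (\<Lambda> X) - \<Phi>2 X) / 2 * ?v \<le> (?\<delta> + \<kappa>) / 2 * ?v"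
    using v_nonneg by (intro mult_right_mono) auto
  also have "\<dots> \<le> ?\<delta> / 2 * ?v + \<eta>" using \<kappa>_pos by (simp add: algebra_simps)
  finally show "precomp_norm {..<r} {..<dA0'} {..<dA1} J2 \<rho> \<le> ?norm + ?\<delta> / 2 * ?v + \<eta>"
    using precomp_norm_le_dnorm[OF channel_\<Lambda> pos_\<rho>] by simp
qed

theorem delta_pre_le_of_dominated:
  assumes \<epsilon>_nonneg: "0 \<le> \<epsilon>"
    and dominated: "\<And>\<rho>. density_kernel (grid dA0' dA1) \<rho> \<Longrightarrow> Re (kernel_pair (grid dA0' dA1) \<rho> J2) \<le>
      precomp_norm {..<dA0'} {..<dA0} {..<dA1} J1 \<rho> + \<epsilon> / 2 * cond_norm {..<dA0'} {..<dA1} \<rho>"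
  shows "delta_pre dA0 dA0' dA1 \<Phi>1 \<Phi>2 \<le> \<epsilon>"
proof (rule field_le_epsilon)
  fix \<eta> :: real assume "0 < \<eta>"
  define s where "s = \<eta> / (2 * dA1)"
  have "0 < s" using \<open>0 < \<eta>\<close> dims by (simp add: s_def)
  then obtain L \<gamma> where channel_L: "channel_kernel {..<dA0'} {..<dA0} L"
    and channel_\<gamma>: "channel_kernel {..<dA0'} {..<dA1} \<gamma>"
    and J2_le: "kernel_le (grid dA0' dA1) J2 (choi_comp {..<dA0} L J1 + (\<epsilon> / 2) \<cdot>\<^sub>k \<gamma> + s \<cdot>\<^sub>k id_kernel)"
    using channel_kernel_le_precomposition[OF _ _ dominated, where \<eta> = s] \<epsilon>_nonneg by auto
  define H where "H = (\<epsilon> / 2) \<cdot>\<^sub>k \<gamma> + s \<cdot>\<^sub>k id_kernel"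
  define \<Lambda> where "\<Lambda> = map_of_kernel dA0' dA0 L"
  have channel_\<Lambda>: "channel dA0' dA0 \<Lambda>" unfolding \<Lambda>_def by (rule channel_map_of_kernel[OF channel_L])
  have scaled_channel_H: "scaled_channel_kernel ((\<epsilon> + \<eta>) / 2) {..<dA0'} {..<dA1} H"
    using scaled_channel_kernel_add[OF scaled_channel_kernel_scale[OF channel_\<gamma>, of "\<epsilon> / 2"]
        scaled_channel_kernel_scale[OF scaled_channel_kernel_id[of "{..<dA0'}" "{..<dA1}"], of s]]
      \<epsilon>_nonneg \<open>0 < s\<close> dims
    by (simp add: H_def s_def add_divide_distrib)
  have channel_LJ: "channel_kernel {..<dA0'} {..<dA1} (choi_comp {..<dA0} L J1)"
    by (rule channel_kernel_comp[OF fin channel_L J1])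
  have "pos_kernel (grid dA0' dA1) (choi_comp {..<dA0} L J1 - J2 + H)"
    using J2_le by (simp add: kernel_le_def H_def algebra_simps)
  then have scaled_channel_G:
      "scaled_channel_kernel ((\<epsilon> + \<eta>) / 2) {..<dA0'} {..<dA1} (choi_comp {..<dA0} L J1 - J2 + H)"
    using scaled_channel_kernelD(2)[OF channel_LJ] scaled_channel_kernelD(2)[OF J2]
      scaled_channel_kernelD(2)[OF scaled_channel_H]
    by (simp add: scaled_channel_kernel_def kernel_eq_def partial_trace_add partial_trace_diff)
  interpret cp_difference dA0' dA1 "\<lambda>X. \<Phi>1 (\<Lambda> X) - \<Phi>2 X" "choi_comp {..<dA0} L J1 - J2 + H" H "(\<epsilon> + \<eta>) / 2"
  proof
    show "has_kernel dA0' dA1 (\<lambda>X. \<Phi>1 (\<Lambda> X) - \<Phi>2 X) (choi_comp {..<dA0} L J1 - J2 + H - H)"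
      unfolding add_diff_cancel_right' \<Lambda>_def
      by (intro has_kernel_diff has_kernel_comp channel_has_kernel has_kernel_map_of_kernel \<Phi>1 \<Phi>2)
  qed (use scaled_channel_G scaled_channel_H \<epsilon>_nonneg \<open>0 < \<eta>\<close> in auto)
  show "delta_pre dA0 dA0' dA1 \<Phi>1 \<Phi>2 \<le> \<epsilon> + \<eta>"
    using delta_pre_le[OF channel_\<Lambda>] dnorm_le by simp
qed

end

section \<open>Condition (ii)\<close>

lemma state_iff_density_kernel:
  "state (r * n) X \<longleftrightarrow> X \<in> carrier_mat (r * n) (r * n) \<and> density_kernel (grid r n) (bip_kernel n X)"
  by (auto simp: state_def density_kernel_def psd_iff_bip_kernel mtrace_bip_kernel)

lemma state_mat_of_kernel: "density_kernel (grid r n) C \<Longrightarrow> state (r * n) (mat_of_kernel r n C)"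
  using density_kernel_cong[OF _ kernel_eq_sym[OF bip_kernel_mat_of_kernel]]
  by (simp add: state_iff_density_kernel)

lemma cond_dnorm_id_tensor_map_transp:
  assumes channel_\<Phi>: "channel m n \<Phi>" and X_carrier: "X \<in> carrier_mat (r * n) (r * n)"
  shows "cond_dnorm r m (id_tensor r n m (map_transp m n \<Phi>) X) =
    precomp_norm {..<r} {..<m} {..<n} (choi_kernel m \<Phi>) (bip_kernel n X)"
  unfolding cond_dnorm_eq_cond_norm[OF id_tensor_carrier] precomp_norm_def
  by (intro cond_norm_cong bip_kernel_id_tensor has_kernel_map_transp channel_has_kernel
      channel_herm_choi_kernel channel_\<Phi>)

lemma kernel_pair_le_precomp_norm:
  assumes "finite M"
  shows "Re (kernel_pair (M \<times> N) \<rho> J) \<le> precomp_norm M M N J \<rho>"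
  using precomp_norm_upper[OF assms assms channel_kernel_choi_id[OF assms], of N \<rho> J]
  by (simp add: kernel_pair_cong_right[OF choi_comp_id_left[OF assms]])

context channel_precomposition
begin

lemma precomp_norm_le_of_delta_pre:
  assumes "delta_pre dA0 dA0' dA1 \<Phi>1 \<Phi>2 \<le> \<epsilon>" "pos_kernel (grid r dA1) \<rho>"
  shows "precomp_norm {..<r} {..<dA0'} {..<dA1} J2 \<rho> \<le>
    precomp_norm {..<r} {..<dA0} {..<dA1} J1 \<rho> + \<epsilon> / 2 * cond_norm {..<r} {..<dA1} \<rho>"
proof -
  have "0 \<le> cond_norm {..<r} {..<dA1} \<rho>" using dims assms(2) by (intro cond_norm_nonneg) auto
  then have "delta_pre dA0 dA0' dA1 \<Phi>1 \<Phi>2 / 2 * cond_norm {..<r} {..<dA1} \<rho> \<le>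
      \<epsilon> / 2 * cond_norm {..<r} {..<dA1} \<rho>"
    using assms(1) by (intro mult_right_mono) auto
  with precomp_norm_le_delta_pre[OF assms(2)] show ?thesis by simp
qed

theorem cond_ii_of_delta_pre:
  assumes "delta_pre dA0 dA0' dA1 \<Phi>1 \<Phi>2 \<le> \<epsilon>"
  shows "cond_ii dA0 dA0' dA1 \<Phi>1 \<Phi>2 \<epsilon> r"
  unfolding cond_ii_def
proof (intro allI impI)
  fix X assume "state (r * dA1) X"
  then have X_carrier: "X \<in> carrier_mat (r * dA1) (r * dA1)" "pos_kernel (grid r dA1) (bip_kernel dA1 X)"
    by (simp_all add: state_iff_density_kernel density_kernel_def)
  show "cond_dnorm r dA0' (id_tensor r dA1 dA0' (map_transp dA0' dA1 \<Phi>2) X) \<le>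
      cond_dnorm r dA0 (id_tensor r dA1 dA0 (map_transp dA0 dA1 \<Phi>1) X) + \<epsilon> / 2 * cond_dnorm r dA1 X"
    unfolding cond_dnorm_id_tensor_map_transp[OF \<Phi>1 X_carrier(1)]
      cond_dnorm_id_tensor_map_transp[OF \<Phi>2 X_carrier(1)]
      cond_dnorm_eq_cond_norm[OF X_carrier(1)]
    by (rule precomp_norm_le_of_delta_pre[OF assms X_carrier(2)])
qed

theorem delta_pre_of_cond_ii:
  assumes "0 \<le> \<epsilon>" "cond_ii dA0 dA0' dA1 \<Phi>1 \<Phi>2 \<epsilon> dA0'"
  shows "delta_pre dA0 dA0' dA1 \<Phi>1 \<Phi>2 \<le> \<epsilon>"
proof (rule delta_pre_le_of_dominated[OF assms(1)])
  fix \<rho> assume density_\<rho>: "density_kernel (grid dA0' dA1) \<rho>"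
  define X where "X = mat_of_kernel dA0' dA1 \<rho>"
  have X_carrier: "X \<in> carrier_mat (dA0' * dA1) (dA0' * dA1)"
    and bip_X: "kernel_eq (grid dA0' dA1) (bip_kernel dA1 X) \<rho>"
    unfolding X_def by (rule mat_of_kernel_carrier bip_kernel_mat_of_kernel)+
  have "cond_dnorm dA0' dA0' (id_tensor dA0' dA1 dA0' (map_transp dA0' dA1 \<Phi>2) X) \<le>
      cond_dnorm dA0' dA0 (id_tensor dA0' dA1 dA0 (map_transp dA0 dA1 \<Phi>1) X) +
          \<epsilon> / 2 * cond_dnorm dA0' dA1 X"
    using assms(2) state_mat_of_kernel[OF density_\<rho>] by (simp add: cond_ii_def X_def)
  then show "Re (kernel_pair (grid dA0' dA1) \<rho> J2) \<le>
      precomp_norm {..<dA0'} {..<dA0} {..<dA1} J1 \<rho> + \<epsilon> / 2 * cond_norm {..<dA0'} {..<dA1} \<rho>"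
    unfolding cond_dnorm_id_tensor_map_transp[OF \<Phi>1 X_carrier]
      cond_dnorm_id_tensor_map_transp[OF \<Phi>2 X_carrier]
      cond_dnorm_eq_cond_norm[OF X_carrier] precomp_norm_cong[OF bip_X] cond_norm_cong[OF bip_X]
    by (rule order_trans[OF kernel_pair_le_precomp_norm[OF finite_lessThan]])
qed

end

section \<open>Ensembles and guessing probabilities\<close>

definition effect_kernel :: "nat \<Rightarrow> complex mat \<Rightarrow> (nat \<times> nat) kernel" where
  "effect_kernel n M = transpose_kernel (bip_kernel n M)"

text \<open>The success probability after a channel with Choi kernel \<open>F\<close> is linear in \<open>F\<close>: it is the pairing
  of \<open>F\<close> with the following kernel.\<close>

definition ensemble_kernel ::
    "nat \<Rightarrow> nat \<Rightarrow> (nat \<Rightarrow> real) \<Rightarrow> (nat \<Rightarrow> complex mat) \<Rightarrow> (nat \<Rightarrow> complex mat) \<Rightarrow> (nat \<times> nat) kernel" where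
  "ensemble_kernel n k lam rho M p q =
     (\<Sum>i<k. (lam i \<cdot>\<^sub>k choi_comp {..<n} (bip_kernel n (rho i)) (swap_kernel (effect_kernel n (M i)))) p q)"

lemma mtrace_mult_effect_kernel:
  "A \<in> carrier_mat (r * n) (r * n) \<Longrightarrow> B \<in> carrier_mat (r * n) (r * n) \<Longrightarrow>
    mtrace (A * B) = kernel_pair (grid r n) (bip_kernel n A) (effect_kernel n B)"
  unfolding effect_kernel_def by (rule mtrace_mult_bip_kernel)

lemma psd_iff_effect_kernel:
  "psd (r * n) M \<longleftrightarrow> M \<in> carrier_mat (r * n) (r * n) \<and> pos_kernel (grid r n) (effect_kernel n M)"
  unfolding psd_iff_bip_kernel effect_kernel_def by (metis pos_kernel_transpose transpose_transpose_kernel)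

lemma ensemble_iff_density_kernel:
  "ensemble (r * n) k lam rho \<longleftrightarrow> (\<forall>i<k. 0 \<le> lam i \<and> rho i \<in> carrier_mat (r * n) (r * n) \<and>
     density_kernel (grid r n) (bip_kernel n (rho i))) \<and> (\<Sum>i<k. lam i) = 1"
  by (simp add: ensemble_def state_iff_density_kernel)

lemma measurement_iff_effect_kernels:
  "measurement (r * n) k M \<longleftrightarrow>
    (\<forall>i<k. M i \<in> carrier_mat (r * n) (r * n) \<and> pos_kernel (grid r n) (effect_kernel n (M i))) \<and>
    kernel_eq (grid r n) (\<lambda>p q. \<Sum>i<k. effect_kernel n (M i) p q) id_kernel"
proof -
  have "(\<forall>a<r * n. \<forall>b<r * n. (\<Sum>i<k. M i $$ (a, b)) = 1\<^sub>m (r * n) $$ (a, b)) \<longleftrightarrow>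
      kernel_eq (grid r n) (\<lambda>p q. \<Sum>i<k. bip_kernel n (M i) p q) (bip_kernel n (1\<^sub>m (r * n)))"
    unfolding all_pair_index kernel_eq_def bip_kernel_def ..
  also have "\<dots> \<longleftrightarrow> kernel_eq (grid r n) (\<lambda>p q. \<Sum>i<k. bip_kernel n (M i) p q) id_kernel"
    using kernel_eq_trans kernel_eq_sym bip_kernel_one by blast
  also have "\<dots> \<longleftrightarrow> kernel_eq (grid r n) (\<lambda>p q. \<Sum>i<k. effect_kernel n (M i) p q) id_kernel"
    by (auto simp: kernel_eq_def effect_kernel_def transpose_kernel_def id_kernel_def)
  finally show ?thesis by (simp add: measurement_def psd_iff_effect_kernel)
qed

lemma mtrace_tensor_id_mult:
  assumes has_kernel_F: "has_kernel r n \<phi> F" and M_carrier: "M \<in> carrier_mat (n * n) (n * n)"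
  shows "mtrace (tensor_id r n n \<phi> X * M) =
    kernel_pair (grid r n) (bip_kernel n X) (choi_comp {..<n} F (effect_kernel n M))"
proof -
  have "mtrace (tensor_id r n n \<phi> X * M) =
      kernel_pair (grid n n) (bip_kernel n (tensor_id r n n \<phi> X)) (effect_kernel n M)"
    by (rule mtrace_mult_effect_kernel[OF tensor_id_carrier M_carrier])
  also have "\<dots> = kernel_pair (grid n n) (link_kernel {..<r} F (bip_kernel n X)) (effect_kernel n M)"
    by (rule kernel_pair_cong[OF bip_kernel_tensor_id[OF has_kernel_F] kernel_eqI[OF refl]])
  also have "\<dots> = kernel_pair (grid r n) (bip_kernel n X) (choi_comp {..<n} F (effect_kernel n M))"
    unfolding choi_comp_def by (rule kernel_pair_link)
  finally show ?thesis .
qed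

lemma kernel_pair_ensemble_kernel:
  "kernel_pair (grid r n) (ensemble_kernel n k lam rho M) F = (\<Sum>i<k. of_real (lam i) *
     kernel_pair (grid r n) (bip_kernel n (rho i)) (choi_comp {..<n} F (effect_kernel n (M i))))"
  unfolding kernel_pair_commute[of _ _ F] ensemble_kernel_def[abs_def] kernel_pair_sum_right
    kernel_pair_scale_right
  by (simp add: kernel_pair_commute[of _ F] kernel_pair_choi_comp_swap)

lemma psucc_tensor_id:
  assumes has_kernel_F: "has_kernel r n \<phi> F" and measurement_M: "measurement (n * n) k M"
  shows "psucc k lam (\<lambda>i. tensor_id r n n \<phi> (rho i)) M =
      Re (kernel_pair (grid r n) (ensemble_kernel n k lam rho M) F)"
  using measurement_M
  by (simp add: psucc_def kernel_pair_ensemble_kernel measurement_iff_effect_kernels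
      mtrace_tensor_id_mult[OF has_kernel_F])

lemma psucc_eq_kernel_pair:
  assumes "ensemble (r * n) k lam rho" "measurement (r * n) k N"
  shows "psucc k lam rho N =
    (\<Sum>i<k. lam i * Re (kernel_pair (grid r n) (bip_kernel n (rho i)) (effect_kernel n (N i))))"
  using assms unfolding psucc_def ensemble_iff_density_kernel measurement_iff_effect_kernels
  by (intro sum.cong refl) (simp add: mtrace_mult_effect_kernel[of _ r n])

lemma Sup_psucc_eq_precomp_norm:
  assumes channel_\<Phi>: "channel m n \<Phi>" and measurement_M: "measurement (n * n) k M"
  shows "Sup {psucc k lam (\<lambda>i. tensor_id r n n (\<lambda>X. \<Phi> (\<alpha> X)) (rho i)) M | \<alpha>. channel r m \<alpha>} =
    precomp_norm {..<r} {..<m} {..<n} (choi_kernel m \<Phi>) (ensemble_kernel n k lam rho M)"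
  unfolding precomp_norm_def cond_norm_def kernel_pair_choi_comp_swap
proof (rule arg_cong[where f = Sup], rule collect_channels_eq)
  fix \<alpha> assume "channel r m \<alpha>"
  then show "psucc k lam (\<lambda>i. tensor_id r n n (\<lambda>X. \<Phi> (\<alpha> X)) (rho i)) M =
      Re (kernel_pair (grid r n) (ensemble_kernel n k lam rho M)
          (choi_comp {..<m} (choi_kernel r \<alpha>) (choi_kernel m \<Phi>)))"
    by (intro psucc_tensor_id has_kernel_comp channel_has_kernel channel_\<Phi> measurement_M)
next
  fix c c' :: "(nat \<times> nat) kernel" assume "kernel_eq (grid r m) c c'"
  then show "Re (kernel_pair (grid r n) (ensemble_kernel n k lam rho M)
      (choi_comp {..<m} c (choi_kernel m \<Phi>))) =
      Re (kernel_pair (grid r n) (ensemble_kernel n k lam rho M) (choi_comp {..<m} c' (choi_kernel m \<Phi>)))"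
    by (intro arg_cong[where f = Re] kernel_pair_cong choi_comp_cong kernel_eqI[OF refl])
qed

lemma pos_ensemble_kernel:
  assumes "ensemble (r * n) k lam rho" "measurement (n * n) k M"
  shows "pos_kernel (grid r n) (ensemble_kernel n k lam rho M)"
  unfolding ensemble_kernel_def[abs_def]
  using assms unfolding ensemble_iff_density_kernel measurement_iff_effect_kernels density_kernel_def
  by (intro pos_kernel_sum pos_kernel_scale pos_kernel_choi_comp pos_kernel_swap) auto

lemma psucc_le_1:
  assumes ens: "ensemble (r * n) k lam rho" and meas: "measurement (r * n) k N"
  shows "psucc k lam rho N \<le> 1"
proof -
  note ens = ens[unfolded ensemble_iff_density_kernel density_kernel_def]
  note meas = meas[unfolded measurement_iff_effect_kernels]
  let ?N = "\<lambda>i. effect_kernel n (N i)"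
  have total: "kernel_pair (grid r n) (bip_kernel n (rho i)) (\<lambda>p q. \<Sum>j<k. ?N j p q) = 1" if "i < k" for i
    using ens that by (simp add: kernel_pair_cong_right[OF conjunct2[OF meas]] kernel_pair_id)
  have "Re (kernel_pair (grid r n) (bip_kernel n (rho i)) (?N i)) \<le> 1" if i_less: "i < k" for i
  proof -
    have "0 \<le> kernel_pair (grid r n) (bip_kernel n (rho i)) (?N j)" if "j < k" for j
      using ens meas i_less that by (intro kernel_pair_nonneg) auto
    then have "Re (kernel_pair (grid r n) (bip_kernel n (rho i)) (?N i)) \<le>
        (\<Sum>j<k. Re (kernel_pair (grid r n) (bip_kernel n (rho i)) (?N j)))"
      using i_less by (intro member_le_sum) (auto simp: complex_nonneg_iff)
    also have "\<dots> = 1" using total[OF i_less] unfolding kernel_pair_sum_right by (simp flip: Re_sum)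
    finally show ?thesis .
  qed
  then have "psucc k lam rho N \<le> (\<Sum>i<k. lam i * 1)"
    unfolding psucc_eq_kernel_pair[OF assms] using ens by (intro sum_mono mult_left_mono) auto
  then show ?thesis using ens by simp
qed

lemma psucc_le_psucc_opt:
  assumes "ensemble (r * n) k lam rho" "measurement (r * n) k N"
  shows "psucc k lam rho N \<le> psucc_opt (r * n) k lam rho"
  unfolding psucc_opt_def
proof (rule cSup_upper)
  show "bdd_above {psucc k lam rho M |M. measurement (r * n) k M}"
    using psucc_le_1[OF assms(1)] by (intro bdd_aboveI[of _ 1]) blast
qed (use assms(2) in blast)

definition heisenberg_effect :: "nat \<Rightarrow> nat \<Rightarrow> (nat \<times> nat) kernel \<Rightarrow> complex mat \<Rightarrow> complex mat" where
  "heisenberg_effect r n c M =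
      mat_of_kernel r n (transpose_kernel (choi_comp {..<n} c (effect_kernel n M)))"

lemma effect_kernel_heisenberg:
  "kernel_eq (grid r n) (effect_kernel n (heisenberg_effect r n c M))
      (choi_comp {..<n} c (effect_kernel n M))"
  using bip_kernel_mat_of_kernel[of r n "transpose_kernel (choi_comp {..<n} c (effect_kernel n M))"]
  unfolding heisenberg_effect_def kernel_eq_def effect_kernel_def[of n "mat_of_kernel _ _ _"]
  by (simp add: transpose_kernel_def)

lemma measurement_heisenberg:
  assumes channel_c: "channel_kernel {..<r} {..<n} c" and measurement_M: "measurement (n * n) k M"
  shows "measurement (r * n) k (\<lambda>i. heisenberg_effect r n c (M i))"
  unfolding measurement_iff_effect_kernels
proof (intro conjI allI impI)
  note effects_M = measurement_M[unfolded measurement_iff_effect_kernels]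
  fix i assume "i < k"
  then have "pos_kernel (grid r n) (choi_comp {..<n} c (effect_kernel n (M i)))"
    using effects_M by (intro pos_kernel_choi_comp scaled_channel_kernelD(1)[OF channel_c]) auto
  then show "pos_kernel (grid r n) (effect_kernel n (heisenberg_effect r n c (M i)))"
    by (rule pos_kernel_cong[OF _ kernel_eq_sym[OF effect_kernel_heisenberg]])
  show "heisenberg_effect r n c (M i) \<in> carrier_mat (r * n) (r * n)" by (simp add: heisenberg_effect_def)
next
  have "kernel_eq (grid r n) (choi_comp {..<n} c (\<lambda>p q. \<Sum>i<k. effect_kernel n (M i) p q))
      (choi_comp {..<n} c id_kernel)"
    using measurement_M
    by (intro choi_comp_cong kernel_eqI[OF refl]) (simp add: measurement_iff_effect_kernels)
  then show "kernel_eq (grid r n)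
      (\<lambda>p q. \<Sum>i<k. effect_kernel n (heisenberg_effect r n c (M i)) p q) id_kernel"
    using effect_kernel_heisenberg[of r n c] scaled_channel_kernelD(2)[OF channel_c]
    by (auto simp: choi_comp_def link_kernel_sum_right choi_comp_id_kernel[unfolded choi_comp_def]
        kernel_eq_def kernel_tensor_def scale_kernel_def id_kernel_def)
qed

lemma cond_norm_le_psucc_opt:
  assumes n_pos: "0 < n" and ens: "ensemble (r * n) k lam rho" and measurement_M: "measurement (n * n) k M"
  shows "cond_norm {..<r} {..<n} (ensemble_kernel n k lam rho M) \<le> psucc_opt (r * n) k lam rho"
proof (rule cond_norm_least)
  fix c assume channel_c: "channel_kernel {..<r} {..<n} c"
  let ?N = "\<lambda>i. heisenberg_effect r n c (M i)"
  note measurement_N = measurement_heisenberg[OF channel_c measurement_M]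
  have "Re (kernel_pair (grid r n) (ensemble_kernel n k lam rho M) c) = psucc k lam rho ?N"
    by (simp add: kernel_pair_ensemble_kernel psucc_eq_kernel_pair[OF ens measurement_N]
        kernel_pair_cong_right[OF effect_kernel_heisenberg])
  also have "\<dots> \<le> psucc_opt (r * n) k lam rho" by (rule psucc_le_psucc_opt[OF ens measurement_N])
  finally show "Re (kernel_pair (grid r n) (ensemble_kernel n k lam rho M) c) \<le>
      psucc_opt (r * n) k lam rho" .
qed (use n_pos in auto)

context channel_precomposition
begin

lemma cond_iii_iff_precomp_norm:
  "cond_iii dA0 dA0' dA1 \<Phi>1 \<Phi>2 \<epsilon> r \<longleftrightarrow>
    (\<forall>k lam rho M. ensemble (r * dA1) k lam rho \<longrightarrow> measurement (dA1 * dA1) k M \<longrightarrow>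
      precomp_norm {..<r} {..<dA0'} {..<dA1} J2 (ensemble_kernel dA1 k lam rho M) \<le>
      precomp_norm {..<r} {..<dA0} {..<dA1} J1 (ensemble_kernel dA1 k lam rho M) +
          \<epsilon> / 2 * psucc_opt (r * dA1) k lam rho)"
  unfolding cond_iii_def by (simp add: Sup_psucc_eq_precomp_norm[OF \<Phi>1] Sup_psucc_eq_precomp_norm[OF \<Phi>2])

theorem cond_iii_of_delta_pre:
  assumes "0 \<le> \<epsilon>" "delta_pre dA0 dA0' dA1 \<Phi>1 \<Phi>2 \<le> \<epsilon>"
  shows "cond_iii dA0 dA0' dA1 \<Phi>1 \<Phi>2 \<epsilon> r"
  unfolding cond_iii_iff_precomp_norm
proof (intro allI impI)
  fix k lam rho M assume ens: "ensemble (r * dA1) k lam rho" and meas: "measurement (dA1 * dA1) k M"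
  let ?E = "ensemble_kernel dA1 k lam rho M"
  have "\<epsilon> / 2 * cond_norm {..<r} {..<dA1} ?E \<le> \<epsilon> / 2 * psucc_opt (r * dA1) k lam rho"
    using assms(1) by (intro mult_left_mono cond_norm_le_psucc_opt dims(3) ens meas) simp
  with precomp_norm_le_of_delta_pre[OF assms(2) pos_ensemble_kernel[OF ens meas]]
  show "precomp_norm {..<r} {..<dA0'} {..<dA1} J2 ?E \<le>
      precomp_norm {..<r} {..<dA0} {..<dA1} J1 ?E + \<epsilon> / 2 * psucc_opt (r * dA1) k lam rho"
    by simp
qed

end

section \<open>Unitary error bases\<close>

definition unitary_on :: "nat \<Rightarrow> (nat \<times> nat \<Rightarrow> complex) \<Rightarrow> bool" where
  "unitary_on n u \<longleftrightarrow> (\<forall>x<n. \<forall>y<n. (\<Sum>a<n. u (x, a) * cnj (u (y, a))) = of_bool (x = y) \<and>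
     (\<Sum>a<n. u (a, x) * cnj (u (a, y))) = of_bool (x = y))"

definition unitary_error_basis :: "nat \<Rightarrow> (nat \<Rightarrow> nat \<times> nat \<Rightarrow> complex) \<Rightarrow> bool" where
  "unitary_error_basis n u \<longleftrightarrow> (\<forall>i<n * n. unitary_on n (u i)) \<and>
     (\<forall>p\<in>grid n n. \<forall>q\<in>grid n n. (\<Sum>i<n * n. u i p * cnj (u i q)) = of_nat n * of_bool (p = q))"

lemma channel_kernel_unitary: "unitary_on n u \<Longrightarrow> channel_kernel {..<n} {..<n} (rank_one_kernel u)"
  by (auto simp: scaled_channel_kernel_def pos_kernel_rank_one kernel_eq_def partial_trace_def
      unitary_on_def rank_one_kernel_def scale_kernel_def id_kernel_def)

lemma channel_kernel_unitary_swap: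
  "unitary_on n u \<Longrightarrow> channel_kernel {..<n} {..<n} (swap_kernel (rank_one_kernel u))"
  unfolding swap_rank_one_kernel by (rule channel_kernel_unitary) (simp add: unitary_on_def)

lemma choi_comp_unitary_inverse:
  assumes "unitary_on n u"
  shows "kernel_eq (grid n n)
      (choi_comp {..<n} (rank_one_kernel u) (swap_kernel (transpose_kernel (rank_one_kernel u)))) choi_id"
  unfolding transpose_rank_one_kernel swap_rank_one_kernel choi_comp_rank_one choi_id_def
  using assms by (intro rank_one_kernel_cong) (auto simp: unitary_on_def)

lemma channel_kernel_of_measurement:
  assumes measurement_N: "measurement (r * n) k N"
    and channel_d: "\<And>i. i < k \<Longrightarrow> channel_kernel {..<n} {..<n} (d i)"
    and n_pos: "0 < n"
  shows "channel_kernel {..<r} {..<n}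
      (\<lambda>p q. \<Sum>i<k. ((1 / n) \<cdot>\<^sub>k choi_comp {..<n} (effect_kernel n (N i)) (d i)) p q)"
proof (rule scaled_channel_kernel_sum)
  note effects_N = measurement_N[unfolded measurement_iff_effect_kernels]
  fix i assume "i \<in> {..<k}"
  with effects_N show "pos_kernel (grid r n) ((1 / n) \<cdot>\<^sub>k choi_comp {..<n} (effect_kernel n (N i)) (d i))"
    by (intro pos_kernel_scale pos_kernel_choi_comp scaled_channel_kernelD(1)[OF channel_d]) auto
next
  fix x y assume xy: "x \<in> {..<r}" "y \<in> {..<r}"
  have "partial_trace {..<n} ((1 / n) \<cdot>\<^sub>k choi_comp {..<n} (effect_kernel n (N i)) (d i)) x y =
      of_real (1 / n) * (\<Sum>a<n. effect_kernel n (N i) (x, a) (y, a))" if "i < k" for i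
    by (simp add: partial_trace_scale
        partial_trace_choi_comp[OF finite_lessThan scaled_channel_kernelD(2)[OF channel_d[OF that]]]
        scale_kernel_def partial_trace_def[of _ "effect_kernel _ _"])
  then have "(\<Sum>i<k. partial_trace {..<n} ((1 / n) \<cdot>\<^sub>k choi_comp {..<n} (effect_kernel n (N i)) (d i)) x y) =
      of_real (1 / n) * (\<Sum>a<n. \<Sum>i<k. effect_kernel n (N i) (x, a) (y, a))"
    by (simp add: sum_distrib_left sum.swap[of _ "{..<k}" "{..<n}"])
  also have "\<dots> = of_real (1 / n) * (\<Sum>a<n. id_kernel (x, a) (y, a))"
    using measurement_N xy by (simp add: measurement_iff_effect_kernels kernel_eq_def)
  also have "\<dots> = (1 \<cdot>\<^sub>k id_kernel) x y" using n_pos by (simp add: id_kernel_def scale_kernel_def)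
  finally show "(\<Sum>i<k. partial_trace {..<n}
      ((1 / n) \<cdot>\<^sub>k choi_comp {..<n} (effect_kernel n (N i)) (d i)) x y) =
      (1 \<cdot>\<^sub>k id_kernel) x y" .
qed

definition error_state :: "nat \<Rightarrow> nat \<Rightarrow> (nat \<times> nat) kernel \<Rightarrow> (nat \<times> nat \<Rightarrow> complex) \<Rightarrow> complex mat" where
  "error_state m n C u = mat_of_kernel m n (choi_comp {..<n} C (rank_one_kernel u))"

definition error_effect :: "nat \<Rightarrow> (nat \<times> nat \<Rightarrow> complex) \<Rightarrow> complex mat" where
  "error_effect n u = mat_of_kernel n n ((1 / n) \<cdot>\<^sub>k rank_one_kernel u)"

lemma bip_kernel_error_state:
  "kernel_eq (grid m n) (bip_kernel n (error_state m n C u)) (choi_comp {..<n} C (rank_one_kernel u))"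
  unfolding error_state_def by (rule bip_kernel_mat_of_kernel)

lemma effect_kernel_error_effect:
  "kernel_eq (grid n n) (effect_kernel n (error_effect n u))
      ((1 / n) \<cdot>\<^sub>k transpose_kernel (rank_one_kernel u))"
  using bip_kernel_mat_of_kernel[of n n "(1 / n) \<cdot>\<^sub>k rank_one_kernel u"]
  by (simp add: error_effect_def effect_kernel_def kernel_eq_def transpose_kernel_def scale_kernel_def)

lemma error_state_effect_cancel:
  assumes unitary_u: "unitary_on n u"
  shows "kernel_eq (grid m n)
    (choi_comp {..<n} (bip_kernel n (error_state m n C u))
        (swap_kernel (effect_kernel n (error_effect n u)))) ((1 / n) \<cdot>\<^sub>k C)"
proof -
  let ?\<Omega> = "rank_one_kernel u"
  have "kernel_eq (grid n n) (swap_kernel (effect_kernel n (error_effect n u)))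
      ((1 / n) \<cdot>\<^sub>k swap_kernel (transpose_kernel ?\<Omega>))"
    using effect_kernel_error_effect[of n u] by (auto simp: kernel_eq_def swap_kernel_def scale_kernel_def)
  from choi_comp_cong[OF bip_kernel_error_state this]
  have "kernel_eq (grid m n)
      (choi_comp {..<n} (bip_kernel n (error_state m n C u))
          (swap_kernel (effect_kernel n (error_effect n u))))
      ((1 / n) \<cdot>\<^sub>k choi_comp {..<n} C (choi_comp {..<n} ?\<Omega> (swap_kernel (transpose_kernel ?\<Omega>))))"
    by (simp only: choi_comp_scale_right choi_comp_assoc)
  moreover have "kernel_eq (grid m n)
      (choi_comp {..<n} C (choi_comp {..<n} ?\<Omega> (swap_kernel (transpose_kernel ?\<Omega>)))) C"
    by (rule kernel_eq_trans[OF choi_comp_cong choi_comp_id_right])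
      (rule kernel_eqI[OF refl] choi_comp_unitary_inverse[OF unitary_u] finite_lessThan)+
  ultimately show ?thesis by (simp add: kernel_eq_def scale_kernel_def)
qed

locale error_ensemble =
  fixes m n :: nat and u :: "nat \<Rightarrow> nat \<times> nat \<Rightarrow> complex" and C :: "(nat \<times> nat) kernel"
  assumes n_pos: "0 < n" and basis_u: "unitary_error_basis n u" and density_C: "density_kernel (grid m n) C"
begin

abbreviation "weight \<equiv> \<lambda>i :: nat. 1 / (n * n) :: real"
abbreviation "states \<equiv> \<lambda>i. error_state m n C (u i)"
abbreviation "effects \<equiv> \<lambda>i. error_effect n (u i)"

lemma unitary: "i < n * n \<Longrightarrow> unitary_on n (u i)"
  using basis_u by (simp add: unitary_error_basis_def)

lemma ensemble_error_states: "ensemble (m * n) (n * n) weight states"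
proof -
  have "state (m * n) (states i)" if "i < n * n" for i
  proof -
    have channel_\<Omega>: "channel_kernel {..<n} {..<n} (rank_one_kernel (u i))"
      by (rule channel_kernel_unitary[OF unitary[OF that]])
    have "pos_kernel (grid m n) (choi_comp {..<n} C (rank_one_kernel (u i)))"
      using density_C by (intro pos_kernel_choi_comp pos_kernel_rank_one) (auto simp: density_kernel_def)
    then have "density_kernel (grid m n) (choi_comp {..<n} C (rank_one_kernel (u i)))"
      using density_C by (simp add: density_kernel_def kernel_trace_choi_comp[OF finite_lessThan channel_\<Omega>])
    then show ?thesis unfolding error_state_def by (rule state_mat_of_kernel)
  qed
  then show ?thesis using n_pos by (simp add: ensemble_def)
qed

lemma measurement_error_effects: "measurement (n * n) (n * n) effects"
  unfolding measurement_iff_effect_kernels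
proof (intro conjI allI impI)
  fix i
  have "pos_kernel (grid n n) ((1 / n) \<cdot>\<^sub>k transpose_kernel (rank_one_kernel (u i)))"
    by (intro pos_kernel_scale pos_kernel_transpose pos_kernel_rank_one) simp
  then show "pos_kernel (grid n n) (effect_kernel n (effects i))"
    by (rule pos_kernel_cong[OF _ kernel_eq_sym[OF effect_kernel_error_effect]])
  show "effects i \<in> carrier_mat (n * n) (n * n)" by (simp add: error_effect_def)
next
  have "(\<Sum>i<n * n. effect_kernel n (effects i) p q) = id_kernel p q" if pq: "p \<in> grid n n" "q \<in> grid n n"
    for p q
  proof -
    have "(\<Sum>i<n * n. effect_kernel n (effects i) p q) = of_real (1 / n) * (\<Sum>i<n * n. u i q * cnj (u i p))"
      unfolding sum_distrib_left kernel_eqD[OF effect_kernel_error_effect pq]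
      by (simp add: scale_kernel_def transpose_kernel_def rank_one_kernel_def)
    also have "(\<Sum>i<n * n. u i q * cnj (u i p)) = of_nat n * of_bool (q = p)"
      using basis_u pq unfolding unitary_error_basis_def by blast
    finally show ?thesis using n_pos by (auto simp: id_kernel_def)
  qed
  then show "kernel_eq (grid n n) (\<lambda>p q. \<Sum>i<n * n. effect_kernel n (effects i) p q) id_kernel"
    by (simp add: kernel_eq_def)
qed

lemma ensemble_kernel_error:
  "kernel_eq (grid m n) (ensemble_kernel n (n * n) weight states effects) ((1 / n) \<cdot>\<^sub>k C)"
  using error_state_effect_cancel[OF unitary] n_pos
  by (auto simp: kernel_eq_def ensemble_kernel_def scale_kernel_def)

lemma psucc_opt_error_le: "psucc_opt (m * n) (n * n) weight states \<le> 1 / n * cond_norm {..<m} {..<n} C"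
  unfolding psucc_opt_def
proof (rule cSup_least)
  have "\<exists>N. measurement (m * n) (n * n) N"
    by (rule exI, rule measurement_heisenberg[OF depolarising_channel_kernel measurement_error_effects])
      (use n_pos in auto)
  then show "{psucc (n * n) weight states N |N. measurement (m * n) (n * n) N} \<noteq> {}" by blast
next
  fix s assume "s \<in> {psucc (n * n) weight states N |N. measurement (m * n) (n * n) N}"
  then obtain N where s_eq: "s = psucc (n * n) weight states N"
    and measurement_N: "measurement (m * n) (n * n) N" by blast
  let ?N = "\<lambda>i. effect_kernel n (N i)"
  let ?d = "\<lambda>i. swap_kernel (rank_one_kernel (u i))"
  define c where "c = (\<lambda>p q. \<Sum>i<n * n. ((1 / n) \<cdot>\<^sub>k choi_comp {..<n} (?N i) (?d i)) p q)"
  have channel_c: "channel_kernel {..<m} {..<n} c"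
    unfolding c_def
    by (intro channel_kernel_of_measurement measurement_N channel_kernel_unitary_swap unitary n_pos)
  have "kernel_pair (grid m n) (bip_kernel n (states i)) F =
      kernel_pair (grid m n) C (choi_comp {..<n} F (?d i))" for i F
    unfolding kernel_pair_choi_comp_left[symmetric]
    by (rule kernel_pair_cong[OF bip_kernel_error_state kernel_eqI[OF refl]])
  then have "s = (\<Sum>i<n * n. 1 / n *
      Re (kernel_pair (grid m n) C ((1 / n) \<cdot>\<^sub>k choi_comp {..<n} (?N i) (?d i))))"
    unfolding s_eq psucc_eq_kernel_pair[OF ensemble_error_states measurement_N]
    by (simp add: kernel_pair_scale_right)
  also have "\<dots> = 1 / n * Re (kernel_pair (grid m n) C c)"
    unfolding c_def kernel_pair_sum_right Re_sum sum_distrib_left ..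
  also have "\<dots> \<le> 1 / n * cond_norm {..<m} {..<n} C"
    by (intro mult_left_mono cond_norm_upper channel_c) auto
  finally show "s \<le> 1 / n * cond_norm {..<m} {..<n} C" .
qed

end

subsection \<open>The Weyl operators\<close>

definition root_of_unity :: "nat \<Rightarrow> nat \<Rightarrow> complex" where
  "root_of_unity n a = cis (2 * pi * real a / real n)"

definition weyl :: "nat \<Rightarrow> nat \<Rightarrow> nat \<times> nat \<Rightarrow> complex" where
  "weyl n i p = of_bool (fst p = (snd p + i div n) mod n) * root_of_unity n (snd p) ^ (i mod n)"

lemma root_of_unity_cnj:
  "root_of_unity n a * cnj (root_of_unity n a) = 1" "cnj (root_of_unity n a) * root_of_unity n a = 1"
  by (simp_all add: root_of_unity_def cis_cnj cis_mult)

lemma sum_root_of_unity_orthogonal: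
  assumes "a < n" "b < n"
  shows "(\<Sum>l<n. root_of_unity n a ^ l * cnj (root_of_unity n b ^ l)) = of_nat n * of_bool (a = b)"
proof (cases "a = b")
  case True
  then show ?thesis by (simp add: root_of_unity_cnj flip: power_mult_distrib)
next
  case False
  define z where "z = root_of_unity n a * cnj (root_of_unity n b)"
  have "inj_on (root_of_unity n) {..<n}"
    using bij_betw_roots_unity[of n] assms(1) unfolding root_of_unity_def by (auto simp: bij_betw_def)
  then have "root_of_unity n a \<noteq> root_of_unity n b" using False assms by (auto dest: inj_onD)
  then have "z \<noteq> 1"
    unfolding z_def by (metis mult.assoc mult_1 mult_1_right root_of_unity_cnj(2))
  have pow: "root_of_unity n c ^ n = 1" for c
    using assms(1) cis_multiple_2pi[of "real c"] by (simp add: root_of_unity_def DeMoivre)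
  have "z ^ n = 1" unfolding z_def power_mult_distrib by (simp add: pow flip: complex_cnj_power)
  with \<open>z \<noteq> 1\<close> have "(\<Sum>l<n. z ^ l) = 0" by (simp add: geometric_sum)
  then show ?thesis using False by (simp add: z_def power_mult_distrib)
qed

lemma add_mod_right_cancel: "(a + k) mod n = (b + k) mod n \<Longrightarrow> a < n \<Longrightarrow> b < n \<Longrightarrow> a = (b :: nat)"
  by (metis cong_add_rcancel_nat cong_def mod_less)

lemma sum_shift_mod:
  fixes g :: "nat \<Rightarrow> 'a :: comm_monoid_add"
  shows "(\<Sum>a<n. g ((a + k) mod n)) = (\<Sum>x<n. g x)"
proof (rule sum.reindex_bij_betw)
  have inj: "inj_on (\<lambda>a. (a + k) mod n) {..<n}"
    by (auto intro!: inj_onI dest: add_mod_right_cancel)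
  moreover have "(\<lambda>a. (a + k) mod n) ` {..<n} \<subseteq> {..<n}" by (cases "n = 0") auto
  ultimately have "(\<lambda>a. (a + k) mod n) ` {..<n} = {..<n}" by (intro endo_inj_surj) auto
  then show "bij_betw (\<lambda>a. (a + k) mod n) {..<n} {..<n}" using inj by (simp add: bij_betw_def)
qed

lemma sum_shift_mod_of_bool:
  fixes x y n :: nat
  assumes "x < n"
  shows "(\<Sum>a<n. of_bool (x = (a + k) mod n) * of_bool (y = (a + k) mod n)) = (of_bool (x = y) :: complex)"
proof -
  have "(\<Sum>a<n. of_bool (x = (a + k) mod n) * of_bool (y = (a + k) mod n)) =
      (\<Sum>z<n. of_bool (x = z) * of_bool (y = z) :: complex)"
    by (rule sum_shift_mod[of "\<lambda>z. of_bool (x = z) * of_bool (y = z)"])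
  also have "\<dots> = (\<Sum>z<n. if z = x then of_bool (x = y) else 0)" by (intro sum.cong refl) auto
  finally show ?thesis using assms by simp
qed

lemma unitary_weyl: "unitary_on n (weyl n i)"
  unfolding unitary_on_def
proof (intro allI impI conjI)
  fix x y assume xy: "x < n" "y < n"
  have "(\<Sum>a<n. weyl n i (x, a) * cnj (weyl n i (y, a))) =
      (\<Sum>a<n. of_bool (x = (a + i div n) mod n) * of_bool (y = (a + i div n) mod n))"
    by (intro sum.cong refl) (simp add: weyl_def root_of_unity_cnj mult_ac flip: power_mult_distrib)
  then show "(\<Sum>a<n. weyl n i (x, a) * cnj (weyl n i (y, a))) = of_bool (x = y)"
    using sum_shift_mod_of_bool[OF xy(1)] by simp
  have "weyl n i (a, x) * cnj (weyl n i (a, y)) = (if a = (x + i div n) mod n then of_bool (x = y) else 0)"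
    for a
    using add_mod_right_cancel[of x "i div n" n y] xy
    by (auto simp: weyl_def root_of_unity_cnj simp flip: power_mult_distrib)
  then show "(\<Sum>a<n. weyl n i (a, x) * cnj (weyl n i (a, y))) = of_bool (x = y)" using xy by simp
qed

lemma weyl_complete:
  assumes "p \<in> grid n n" "q \<in> grid n n"
  shows "(\<Sum>i<n * n. weyl n i p * cnj (weyl n i q)) = of_nat n * of_bool (p = q)"
proof -
  obtain x a y b where pq_eq: "p = (x, a)" "q = (y, b)" "x < n" "a < n" "b < n" using assms by auto
  have "(\<Sum>i<n * n. weyl n i p * cnj (weyl n i q)) =
      (\<Sum>k<n. \<Sum>l<n. weyl n (k * n + l) p * cnj (weyl n (k * n + l) q))"
    unfolding sum_pair_index sum.cartesian_product' by simp
  also have "\<dots> = (\<Sum>k<n. of_bool (x = (a + k) mod n) * of_bool (y = (b + k) mod n) *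
      (\<Sum>l<n. root_of_unity n a ^ l * cnj (root_of_unity n b ^ l)))"
    unfolding sum_distrib_left by (intro sum.cong refl) (auto simp: weyl_def pq_eq)
  also have "\<dots> = (\<Sum>k<n. of_bool (x = (k + a) mod n) * of_bool (y = (k + a) mod n)) *
      (of_nat n * of_bool (a = b))"
    unfolding sum_root_of_unity_orthogonal[OF pq_eq(4,5)] sum_distrib_right
    by (intro sum.cong refl) (auto simp: add.commute)
  also have "\<dots> = of_nat n * of_bool (p = q)"
    unfolding sum_shift_mod_of_bool[OF pq_eq(3)] by (auto simp: pq_eq)
  finally show ?thesis .
qed

lemma unitary_error_basis_weyl: "unitary_error_basis n (weyl n)"
  by (simp add: unitary_error_basis_def unitary_weyl weyl_complete)

section \<open>Condition (iii) and the theorem\<close>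

theorem (in channel_precomposition) delta_pre_of_cond_iii:
  assumes "0 \<le> \<epsilon>" "cond_iii dA0 dA0' dA1 \<Phi>1 \<Phi>2 \<epsilon> dA0'"
  shows "delta_pre dA0 dA0' dA1 \<Phi>1 \<Phi>2 \<le> \<epsilon>"
proof (rule delta_pre_le_of_dominated[OF assms(1)])
  fix \<rho> assume "density_kernel (grid dA0' dA1) \<rho>"
  then interpret error_ensemble dA0' dA1 "weyl dA1" \<rho>
    using dims unitary_error_basis_weyl by unfold_locales
  let ?norm1 = "precomp_norm {..<dA0'} {..<dA0} {..<dA1} J1"
    and ?norm2 = "precomp_norm {..<dA0'} {..<dA0'} {..<dA1} J2"
  let ?v = "cond_norm {..<dA0'} {..<dA1} \<rho>"
  let ?opt = "psucc_opt (dA0' * dA1) (dA1 * dA1) weight states"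
  have "?norm2 ((1 / dA1) \<cdot>\<^sub>k \<rho>) \<le> ?norm1 ((1 / dA1) \<cdot>\<^sub>k \<rho>) + \<epsilon> / 2 * ?opt"
    using assms(2) ensemble_error_states measurement_error_effects
    unfolding cond_iii_iff_precomp_norm precomp_norm_cong[OF ensemble_kernel_error, symmetric] by blast
  also have "\<epsilon> / 2 * ?opt \<le> \<epsilon> / 2 * (1 / dA1 * ?v)"
    using assms(1) by (intro mult_left_mono psucc_opt_error_le) simp
  finally have "?norm2 \<rho> / dA1 \<le> (?norm1 \<rho> + \<epsilon> / 2 * ?v) / dA1"
    using dims
    by (simp add: precomp_norm_scale[OF fin(1) fin(1) ne(1)] precomp_norm_scale[OF fin(1) fin(2) ne(2)]
        add_divide_distrib)
  then have "?norm2 \<rho> \<le> ?norm1 \<rho> + \<epsilon> / 2 * ?v" using dims by (simp add: divide_le_cancel)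
  with kernel_pair_le_precomp_norm[of "{..<dA0'}" "{..<dA1}" \<rho> J2]
  show "Re (kernel_pair (grid dA0' dA1) \<rho> J2) \<le> ?norm1 \<rho> + \<epsilon> / 2 * ?v" by simp
qed

theorem theorem6:
  fixes dA0 dA0' dA1 :: nat and \<Phi>1 \<Phi>2 :: cmap and \<epsilon> :: real
  assumes "0 < dA0" and "0 < dA0'" and "0 < dA1"
    and "channel dA0 dA1 \<Phi>1" and "channel dA0' dA1 \<Phi>2"
    and "0 \<le> \<epsilon>"
  shows "(delta_pre dA0 dA0' dA1 \<Phi>1 \<Phi>2 \<le> \<epsilon> \<longleftrightarrow>
            (\<forall>dR>0. cond_ii dA0 dA0' dA1 \<Phi>1 \<Phi>2 \<epsilon> dR))
       \<and> (delta_pre dA0 dA0' dA1 \<Phi>1 \<Phi>2 \<le> \<epsilon> \<longleftrightarrow>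
            (\<forall>dR>0. cond_iii dA0 dA0' dA1 \<Phi>1 \<Phi>2 \<epsilon> dR))
       \<and> (delta_pre dA0 dA0' dA1 \<Phi>1 \<Phi>2 \<le> \<epsilon> \<longleftrightarrow>
            cond_ii dA0 dA0' dA1 \<Phi>1 \<Phi>2 \<epsilon> dA0')
       \<and> (delta_pre dA0 dA0' dA1 \<Phi>1 \<Phi>2 \<le> \<epsilon> \<longleftrightarrow>
            cond_iii dA0 dA0' dA1 \<Phi>1 \<Phi>2 \<epsilon> dA0')"
proof -
  interpret channel_precomposition dA0 dA0' dA1 \<Phi>1 \<Phi>2
    using assms by unfold_locales
  show ?thesis
    using assms(2,6) cond_ii_of_delta_pre cond_iii_of_delta_pre delta_pre_of_cond_ii delta_pre_of_cond_iii
    by blast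
qed

end
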